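(* Let $f \colon \mathbb{C} \to \widehat{\mathbb{C}}$ be a meromorphic function such that $f$ and $f'$ share two finite values, i.e. there are distinct $a, b \in \mathbb{C}$ such that for all $z \in \mathbb{C}$ $$f(z) = a \Leftrightarrow f'(z) = a \quad \text{and} \quad f(z) = b \Leftrightarrow f'(z) = b.$$ Then $f$ and $f'$ are normal functions.
   Context: $\widehat{\mathbb{C}} = \mathbb{C} \cup \{\infty\}$. A meromorphic function $h \colon \mathbb{C} \to \widehat{\mathbb{C}}$ is called normal if for every sequence $z_n \to \infty$ the family of functions $z \mapsto h(z_n + z)$ is a normal family on $\mathbb{C}$ (every sequence in it has a subsequence converging locally uniformly in the spherical metric to a meromorphic function or to the constant $\infty$). Equivalently, the spherical derivative $h^{\#}(z) = |h'(z)|/(1+|h(z)|^2)$ (extended continuously to the poles of $h$) is bounded on $\mathbb{C}$. *)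

theory Defs
  imports "HOL-Complex_Analysis.Complex_Analysis"
begin

datatype riemann_sphere = Fin complex | Infty

text \<open>Inverse stereographic projection onto the unit sphere of \<open>\<complex> \<times> \<real>\<close>,
  with \<open>\<infinity>\<close> as the north pole.\<close>

fun stereo :: "riemann_sphere \<Rightarrow> complex \<times> real" where
  "stereo (Fin z) = ((2 / (1 + (norm z)\<^sup>2)) *\<^sub>R z, ((norm z)\<^sup>2 - 1) / (1 + (norm z)\<^sup>2))"
| "stereo Infty = (0, 1)"

lemma norm_stereo: "norm (stereo p) = 1"
proof (cases p)
  case (Fin z)
  define t where "t = (norm z)\<^sup>2"
  have t: "t \<ge> 0" "1 + t > 0" unfolding t_def by (simp_all add: add_pos_nonneg)
  have "(norm (stereo p))\<^sup>2 = (2 / (1 + t))\<^sup>2 * t + ((t - 1) / (1 + t))\<^sup>2"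
    using t by (simp add: Fin norm_Pair power_mult_distrib power_divide flip: t_def)
  also have "\<dots> = ((2\<^sup>2 * t) + (t - 1)\<^sup>2) / (1 + t)\<^sup>2"
    by (simp add: power_divide add_divide_distrib)
  also have "2\<^sup>2 * t + (t - 1)\<^sup>2 = (1 + t)\<^sup>2"
    by (simp add: power2_eq_square algebra_simps)
  finally have "(norm (stereo p))\<^sup>2 = 1"
    using t by simp
  thus ?thesis using norm_ge_zero[of "stereo p"] unfolding power2_eq_1_iff by linarith
qed (simp add: norm_Pair)

lemma inj_stereo: "stereo p = stereo q \<Longrightarrow> p = q"
proof -
  have snd_less: "snd (stereo (Fin z)) \<noteq> 1" for z
  proof -
    have "1 + (norm z)\<^sup>2 > 0" by (simp add: add_pos_nonneg)
    thus ?thesis by (simp add: divide_eq_1_iff)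
  qed
  have fin: "z = w" if "stereo (Fin z) = stereo (Fin w)" for z w
  proof -
    define s t where "s = (norm z)\<^sup>2" and "t = (norm w)\<^sup>2"
    have pos: "1 + s > 0" "1 + t > 0" unfolding s_def t_def by (simp_all add: add_pos_nonneg)
    have "(s - 1) / (1 + s) = (t - 1) / (1 + t)"
      using that by (simp flip: s_def t_def)
    hence "(s - 1) * (1 + t) = (t - 1) * (1 + s)"
      using pos by (simp add: frac_eq_eq)
    hence "s = t" by (simp add: algebra_simps)
    moreover have "(2 / (1 + s)) *\<^sub>R z = (2 / (1 + t)) *\<^sub>R w"
      using that by (simp flip: s_def t_def)
    ultimately show ?thesis using pos by simp
  qed
  show "stereo p = stereo q \<Longrightarrow> p = q"
    using snd_less fin by (metis riemann_sphere.exhaust snd_conv stereo.simps(2))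
qed

lemma arccos_inner_triangle:
  fixes a b c :: "'a::real_inner"
  assumes n: "norm a = 1" "norm b = 1" "norm c = 1"
  shows "arccos (inner a c) \<le> arccos (inner a b) + arccos (inner b c)"
proof -
  have bnd: "\<bar>inner x y\<bar> \<le> 1" if "norm x = 1" "norm y = 1" for x y :: 'a
    using Cauchy_Schwarz_ineq2[of x y] that by simp
  define u v where "u = inner a b" and "v = inner b c"
  have u: "\<bar>u\<bar> \<le> 1" and v: "\<bar>v\<bar> \<le> 1" using bnd n by (auto simp: u_def v_def)
  have one: "inner a a = 1" "inner b b = 1" "inner c c = 1"
    using n by (simp_all add: norm_eq_1)
  show ?thesis
  proof (cases "arccos u + arccos v \<le> pi")
    case True
    have nu: "norm (a - u *\<^sub>R b) = sqrt (1 - u\<^sup>2)"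
      unfolding norm_eq_sqrt_inner u_def
      by (simp add: inner_diff_left inner_diff_right one power2_eq_square inner_commute)
    have nv: "norm (c - v *\<^sub>R b) = sqrt (1 - v\<^sup>2)"
      unfolding norm_eq_sqrt_inner v_def
      by (simp add: inner_diff_left inner_diff_right one power2_eq_square inner_commute)
    have "inner (a - u *\<^sub>R b) (c - v *\<^sub>R b) = inner a c - u * v"
      by (simp add: inner_diff_left inner_diff_right one u_def v_def inner_commute)
    hence "inner a c \<ge> u * v - sqrt (1 - u\<^sup>2) * sqrt (1 - v\<^sup>2)"
      using Cauchy_Schwarz_ineq2[of "a - u *\<^sub>R b" "c - v *\<^sub>R b"]
      unfolding nu nv by (simp only: abs_le_iff) linarith
    also have "u * v - sqrt (1 - u\<^sup>2) * sqrt (1 - v\<^sup>2) = cos (arccos u + arccos v)"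
      using u v by (simp add: cos_add cos_arccos_abs sin_arccos_abs)
    finally have "arccos (inner a c) \<le> arccos (cos (arccos u + arccos v))"
      using bnd[OF n(1,3)] by (intro arccos_le_arccos) auto
    also have "\<dots> = arccos u + arccos v"
      using True u v by (intro arccos_cos) (auto intro!: add_nonneg_nonneg arccos_lbound)
    finally show ?thesis by (simp add: u_def v_def)
  next
    case False
    thus ?thesis
      using bnd[OF n(1,3)] arccos_ubound[of "inner a c"] by (simp add: u_def v_def abs_le_iff)
  qed
qed

text \<open>The spherical metric is half the great-circle distance on the unit sphere, so that its
  length element is \<open>|dz| / (1 + |z|\<^sup>2)\<close>.\<close>

instantiation riemann_sphere :: metric_space
begin

definition dist_riemann_sphere :: "riemann_sphere \<Rightarrow> riemann_sphere \<Rightarrow> real" where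
  "dist p q = arccos (inner (stereo p) (stereo q)) / 2"

definition uniformity_riemann_sphere_def:
  "(uniformity :: (riemann_sphere \<times> riemann_sphere) filter) = (INF e\<in>{0<..}. principal {(p, q). dist p q < e})"

definition open_riemann_sphere_def:
  "open (U :: riemann_sphere set) \<longleftrightarrow> (\<forall>p\<in>U. \<forall>\<^sub>F (p', q) in uniformity. p' = p \<longrightarrow> q \<in> U)"

instance
proof
  fix p q r :: riemann_sphere
  have bnd: "\<bar>inner (stereo p) (stereo q)\<bar> \<le> 1"
    using Cauchy_Schwarz_ineq2[of "stereo p" "stereo q"] by (simp add: norm_stereo)
  have one: "inner (stereo x) (stereo x) = 1" for x
    using norm_stereo[of x] by (simp add: norm_eq_1)
  show "dist p q = 0 \<longleftrightarrow> p = q"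
  proof
    assume "dist p q = 0"
    hence "inner (stereo p) (stereo q) = 1"
      using cos_arccos_abs[OF bnd] by (simp add: dist_riemann_sphere_def)
    hence "inner (stereo p - stereo q) (stereo p - stereo q) = 0"
      by (simp add: inner_diff_left inner_diff_right one inner_commute)
    thus "p = q" by (intro inj_stereo) simp
  qed (simp add: dist_riemann_sphere_def one)
  show "dist p q \<le> dist p r + dist q r"
    using arccos_inner_triangle[of "stereo p" "stereo r" "stereo q"]
    by (simp add: dist_riemann_sphere_def norm_stereo inner_commute)
qed (fact uniformity_riemann_sphere_def open_riemann_sphere_def)+

end

text \<open>The library represents a meromorphic function by a function \<open>\<complex> \<Rightarrow> \<complex>\<close> that is
  \<open>0\<close> at its poles; \<open>to_sphere f\<close> is the corresponding map into the sphere. Whether \<open>f\<close>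
  has a pole at \<open>z\<close> depends on \<open>f\<close> only near \<open>z\<close>, not at \<open>z\<close>. Hence \<open>to_sphere (deriv f)\<close>
  is \<open>\<infinity>\<close> at the poles of \<open>f\<close>, although \<open>deriv f\<close> itself is unspecified there.\<close>

definition to_sphere :: "(complex \<Rightarrow> complex) \<Rightarrow> complex \<Rightarrow> riemann_sphere" where
  "to_sphere f z = (if is_pole f z then Infty else Fin (f z))"

definition meromorphic_function :: "(complex \<Rightarrow> riemann_sphere) \<Rightarrow> bool" where
  "meromorphic_function h \<longleftrightarrow> (\<exists>f. f nicely_meromorphic_on UNIV \<and> h = to_sphere f)"

definition locally_uniform_limit ::
    "(nat \<Rightarrow> 'a::topological_space \<Rightarrow> 'b::metric_space) \<Rightarrow> ('a \<Rightarrow> 'b) \<Rightarrow> bool" where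
  "locally_uniform_limit s g \<longleftrightarrow>
     (\<forall>z. \<exists>U. open U \<and> z \<in> U \<and> uniform_limit U s g sequentially)"

definition normal_family :: "(complex \<Rightarrow> riemann_sphere) set \<Rightarrow> bool" where
  "normal_family \<F> \<longleftrightarrow>
     (\<forall>s :: nat \<Rightarrow> complex \<Rightarrow> riemann_sphere. range s \<subseteq> \<F> \<longrightarrow>
        (\<exists>r g. strict_mono r \<and> (meromorphic_function g \<or> g = (\<lambda>_. Infty)) \<and>
               locally_uniform_limit (s \<circ> r) g))"

definition normal_function :: "(complex \<Rightarrow> riemann_sphere) \<Rightarrow> bool" where
  "normal_function h \<longleftrightarrow> meromorphic_function h \<and>
     (\<forall>\<zeta> :: nat \<Rightarrow> complex. filterlim \<zeta> at_infinity sequentially \<longrightarrow>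
        normal_family (range (\<lambda>n z. h (\<zeta> n + z))))"

end

theory Submission
  imports Defs
begin

text \<open>
  Both functions have bounded spherical derivative, and for such functions normality of the
  translates is the theorem of Arzela and Ascoli on the sphere. Boundedness is proved by
  contradiction, rescaling at points supplied by a doubling argument.

  For \<open>f\<close>, assume \<open>b \<noteq> 0\<close>. Since \<open>|f'| \<le> |a|\<close> at the zeros of \<open>f - a\<close>, Pang's form of Zalcman's
  rescaling gives \<open>g\<^sub>n(\<zeta>) = (f - a)(z\<^sub>n + \<rho>\<^sub>n \<zeta>) / \<rho>\<^sub>n\<close> with a nonconstant limit \<open>g\<close>. The derivative of
  \<open>g\<^sub>n\<close> is that of \<open>f\<close>, the value \<open>a\<close> of \<open>f\<close> becomes \<open>0\<close> and the value \<open>b\<close> becomes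
  \<open>(b - a) / \<rho>\<^sub>n \<rightarrow> \<infinity>\<close>. As \<open>b \<noteq> 0\<close>, near a pole of order \<open>k\<close> of \<open>g\<close> the latter value would be taken at
  \<open>k\<close> distinct points, which leaves no room among the \<open>k - 1\<close> zeros of \<open>(1/g\<^sub>n)' + b (1/g\<^sub>n)\<^sup>2\<close>; so \<open>g\<close>
  is entire. Moreover \<open>g'\<close> omits \<open>b\<close> (or is constant) and \<open>g' = a\<close> forces \<open>g = 0\<close>. By the
  Clunie--Hayman theorem \<open>g\<close> has exponential type, hence \<open>g' = b + exp (\<alpha>z + \<beta>)\<close>, which takes the
  value \<open>a\<close> at infinitely many points where \<open>g\<close> differs from \<open>bz\<close> by a constant: contradiction.

  For \<open>f'\<close>, rescale \<open>P = 1/(f' - b)\<close>. At the rescaling points \<open>f\<close> must tend to \<open>\<infinity>\<close>, since otherwise \<open>f''\<close>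
  would be bounded there; by equicontinuity \<open>f\<close>, and hence \<open>f'\<close>, omits \<open>a\<close> and \<open>b\<close> on discs of fixed
  radius around them. So the limit of the rescaled \<open>P\<close> is
  entire, omits \<open>1/(a - b)\<close>, and has no simple zeros because the poles of \<open>f'\<close> are multiple; but it
  is \<open>1/(a - b) + exp (\<alpha>z + \<beta>)\<close>.
\<close>

section \<open>Entire functions with bounded spherical derivative\<close>

text \<open>Dividing by \<open>\<rho>\<close> in the first rescaling leaves the derivative
  unchanged; only so does a condition comparing a function with its own derivative survive the
  change of scale. The price is that the scale at a point is given implicitly, by an equation that
  is solvable only where the derivative is large, and that needs the bound on the derivative at the
  zeros in order to make sense there. Normalising with a constant above \<open>|a|\<close> excludes
  limits whose derivative is constantly \<open>a\<close>. A bound for \<open>f\<close> does not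
  settle \<open>f'\<close>: it gives no uniform bound for \<open>f''\<close> where \<open>f\<close>
  is large, and that is where the second argument takes place. In place of Zalcman's maximum of a
  weighted quantity over a disc, the doubling argument only asks that the quantity be locally
  bounded on the plane. Compactness is argued with the chordal distance, which comes from a norm and
  so fits the Arzela-Ascoli theorem for maps into a Euclidean space; the angular metric enters only
  at the very end.\<close>

lemma harnack_schwarz:
  fixes L :: "complex \<Rightarrow> complex"
  assumes hol: "L holomorphic_on ball a d" and pos: "\<And>z. z \<in> ball a d \<Longrightarrow> Re (L z) > 0" and w: "w \<in> ball a d"
  shows "norm (L w - L a) \<le> dist a w / d * norm (L w + cnj (L a))"
proof -
  have d: "d > 0" using w by (metis dist_nz ball_eq_empty empty_iff not_le)
  have aa: "a \<in> ball a d" using d by simp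
  have nz: "L z + cnj (L a) \<noteq> 0" if "z \<in> ball a d" for z
    using pos[OF that] pos[OF aa] by (auto simp: complex_eq_iff)
  \<comment> \<open>The Cayley transform of the right half-plane that sends \<open>L a\<close> to 0,
    so that the Schwarz lemma applies.\<close>
  define f where "f = (\<lambda>z::complex. (L (a + d * z) - L a) / (L (a + d * z) + cnj (L a)))"
  have in': "a + d * z \<in> ball a d" if "z \<in> ball 0 1" for z :: complex
    using that d by (simp add: dist_norm norm_mult)
  have "(\<lambda>z::complex. L (a + d * z)) holomorphic_on ball 0 1"
    by (rule holomorphic_on_compose_gen[OF _ hol, unfolded o_def]) (auto intro!: holomorphic_intros in')
  hence holf: "f holomorphic_on ball 0 1"
    unfolding f_def by (intro holomorphic_intros) (use nz in' in blast)+
  have f0: "f 0 = 0" by (simp add: f_def)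
  have less: "norm (f z) < 1" if "norm z < 1" for z
  proof -
    have z: "a + d * z \<in> ball a d" using in' that by simp
    define X where "X = L (a + d * z)"
    have "norm (X - L a) ^ 2 < norm (X + cnj (L a)) ^ 2"
      using mult_pos_pos[OF pos[OF z] pos[OF aa]] unfolding cmod_power2 X_def[symmetric]
      by (simp add: power2_eq_square algebra_simps)
    hence "norm (X - L a) < norm (X + cnj (L a))" by (rule power_less_imp_less_base) simp
    thus ?thesis unfolding f_def X_def[symmetric] by (simp add: norm_divide divide_less_eq)
  qed
  define z :: complex where "z = (w - a) / d"
  have z1: "norm z = dist a w / d" using d by (simp add: z_def norm_divide dist_norm norm_minus_commute)
  hence z2: "norm z < 1" using w d by simp
  have "norm (f z) \<le> norm z" by (rule Schwarz_Lemma(1)[OF holf f0 less z2])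
  moreover have "a + d * z = w" using d by (simp add: z_def)
  ultimately have "norm ((L w - L a) / (L w + cnj (L a))) \<le> dist a w / d" by (simp add: f_def z1)
  thus ?thesis using nz[OF w] by (simp add: norm_divide divide_le_eq)
qed

lemma harnack_lower:
  fixes L :: "complex \<Rightarrow> complex"
  assumes hol: "L holomorphic_on ball a d" and pos: "\<And>z. z \<in> ball a d \<Longrightarrow> Re (L z) > 0" and w: "w \<in> ball a d"
  shows "Re (L a) * (1 - dist a w / d) \<le> 2 * Re (L w)"
proof -
  have d: "d > 0" using w by (metis dist_nz ball_eq_empty empty_iff not_le)
  define t where "t = dist a w / d"
  have t: "0 \<le> t" "t < 1" using w d by (auto simp: t_def)
  have pa: "Re (L a) > 0" and pw: "Re (L w) > 0" using pos w d by auto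
  have "norm (L w - L a) ^ 2 \<le> t ^ 2 * norm (L w + cnj (L a)) ^ 2"
    using power_mono[OF harnack_schwarz[OF assms] norm_ge_zero, of 2] by (simp only: t_def power_mult_distrib)
  hence "(Re (L w) - Re (L a))^2 + (Im (L w) - Im (L a))^2
      \<le> t^2 * (Re (L w) + Re (L a))^2 + t^2 * (Im (L w) - Im (L a))^2"
    by (simp add: cmod_power2 distrib_left)
  moreover have "t^2 * (Im (L w) - Im (L a))^2 \<le> 1 * (Im (L w) - Im (L a))^2"
    using t by (intro mult_right_mono) (auto simp: power_le_one)
  ultimately have "(Re (L w) - Re (L a))^2 \<le> (t * (Re (L w) + Re (L a)))^2"
    by (simp add: power_mult_distrib)
  hence "\<bar>Re (L w) - Re (L a)\<bar> \<le> t * (Re (L w) + Re (L a))"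
    using t pa pw by (intro power2_le_imp_le[of "\<bar>_\<bar>"]) auto
  hence "Re (L a) - Re (L w) \<le> t * (Re (L w) + Re (L a))" by linarith
  hence "Re (L a) * (1 - t) \<le> Re (L w) * (1 + t)" by (simp add: algebra_simps)
  also have "\<dots> \<le> Re (L w) * 2" using t pw by (intro mult_left_mono) auto
  finally show ?thesis by (simp add: t_def mult.commute)
qed

text \<open>At half the radius the Schwarz factor is at most 1/2, so the term containing
  \<open>L w\<close> can be absorbed on the left. Controlling the full modulus by a real part is the
  Borel-Caratheodory principle.\<close>

lemma harnack_upper:
  fixes L :: "complex \<Rightarrow> complex"
  assumes hol: "L holomorphic_on ball a d" and pos: "\<And>z. z \<in> ball a d \<Longrightarrow> Re (L z) > 0" and w: "dist a w \<le> d / 2" "d > 0"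
  shows "norm (L w - L a) \<le> 2 * Re (L a)"
proof -
  have wb: "w \<in> ball a d" using w by auto
  have pa: "Re (L a) > 0" using pos w by auto
  have "L w + cnj (L a) = (L w - L a) + 2 * Re (L a)" by (simp add: complex_eq_iff)
  hence "norm (L w + cnj (L a)) \<le> norm (L w - L a) + norm (of_real (2 * Re (L a)) :: complex)"
    by (metis norm_triangle_ineq)
  also have "norm (of_real (2 * Re (L a)) :: complex) = 2 * Re (L a)" using pa by (simp only: norm_of_real)
  finally have "norm (L w + cnj (L a)) \<le> norm (L w - L a) + 2 * Re (L a)" .
  hence "norm (L w - L a) \<le> (1/2) * (norm (L w - L a) + 2 * Re (L a))"
    using w by (intro order_trans[OF harnack_schwarz[OF hol pos wb]] mult_mono) (auto simp: field_simps)
  thus ?thesis by simp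
qed

text \<open>The Clunie--Hayman theorem, by a Hopf-lemma argument: compare the positive harmonic function
  \<open>ln |g|\<close> on the largest disc around \<open>a\<close> in \<open>|g| > 1\<close> with its slope at a boundary point \<open>z1\<close> of that
  disc with \<open>|g z1| \<le> 1\<close>, where \<open>|g'| \<le> 2K\<close>.\<close>

lemma entire_bounded_spherical_deriv_growth:
  fixes g :: "complex \<Rightarrow> complex"
  assumes hol: "g holomorphic_on UNIV" and K: "\<And>z. norm (deriv g z) \<le> K * (1 + (norm (g z))\<^sup>2)"
  shows "\<exists>C\<ge>0. \<forall>z. norm (g z) \<le> exp (C * (1 + norm z))"
proof (cases "\<exists>z0. norm (g z0) \<le> 1")
  case False
  hence gt: "norm (g z) > 1" for z by (auto simp: not_le)
  hence nz: "g z \<noteq> 0" for z by (metis norm_zero not_one_less_zero)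
  have "(\<lambda>z. inverse (g z)) holomorphic_on UNIV" using nz by (intro holomorphic_intros hol)
  moreover have "bounded (range (\<lambda>z. inverse (g z)))"
    by (rule boundedI[of _ 1]) (use less_imp_le[OF gt] in \<open>auto simp: norm_inverse inverse_le_1_iff\<close>)
  ultimately obtain c where "\<And>z. inverse (g z) = c" by (metis Liouville_theorem constant_on_def UNIV_I)
  hence gc: "g z = g 0" for z by (metis inverse_inverse_eq)
  have "norm (g z) \<le> exp (norm (g 0) * (1 + norm z))" for z
  proof -
    have "norm (g z) \<le> 1 + norm (g 0) * (1 + norm z)" using gc[of z] by (simp add: algebra_simps)
    also have "\<dots> \<le> exp (norm (g 0) * (1 + norm z))" by (rule exp_ge_add_one_self)
    finally show ?thesis .
  qed
  thus ?thesis by (intro exI[of _ "norm (g 0)"]) auto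
next
  case True
  then obtain z0 where z0: "norm (g z0) \<le> 1" by blast
  \<comment> \<open>From \<open>4 * K * dist a z0\<close> below, with
    \<open>norm a + norm z0 \<le> (1 + norm z0) * (1 + norm a)\<close>.\<close>
  define C where "C = 4 * \<bar>K\<bar> * (1 + norm z0)"
  have K0: "K \<ge> 0" using order_trans[OF norm_ge_zero K[of 0]]
    by (metis add_pos_nonneg zero_le_power2 zero_less_one zero_le_mult_iff not_le)
  have cont: "continuous_on UNIV g" using hol holomorphic_on_imp_continuous_on by blast
  have cl: "closed {z. norm (g z) \<le> 1}"
    by (intro closed_Collect_le continuous_intros cont)
  have main: "norm (g a) \<le> exp (4 * K * dist a z0)" if ga: "norm (g a) > 1" for a
  proof -
    obtain z1 where z1: "norm (g z1) \<le> 1" "\<And>y. norm (g y) \<le> 1 \<Longrightarrow> dist a z1 \<le> dist a y"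
      using distance_attains_inf[OF cl, of a] z0 by auto
    define d where "d = dist a z1"
    have d0: "d > 0" using ga z1 by (auto simp: d_def)
    have gt: "norm (g z) > 1" if "z \<in> ball a d" for z
      using that z1(2)[of z] by (force simp: d_def)
    have nz: "g z \<noteq> 0" if "z \<in> ball a d" for z using gt[OF that] by auto
    obtain L where L: "L holomorphic_on ball a d" "\<And>z. z \<in> ball a d \<Longrightarrow> g z = exp (L z)"
      using contractible_imp_holomorphic_log[of g "ball a d"] nz hol
      by (metis convex_ball convex_imp_contractible holomorphic_on_subset subset_UNIV)
    have ReL: "Re (L z) = ln (norm (g z))" if "z \<in> ball a d" for z using L(2)[OF that] by simp
    have posL: "Re (L z) > 0" if "z \<in> ball a d" for z using ReL[OF that] ln_gt_zero[OF gt[OF that]] by linarith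
    have ab: "a \<in> ball a d" using d0 by simp
    \<comment> \<open>On the radius from \<open>z1\<close> to \<open>a\<close>, Harnack bounds
      \<open>ln |g z|\<close> below by a multiple of the distance \<open>s * d\<close> to
      \<open>z1\<close>. Since \<open>ln x \<le> x - 1\<close> and \<open>|g z1| \<le> 1\<close>,
      the same holds for \<open>|g z - g z1|\<close>, so the slope at \<open>z1\<close> is bounded
      below.\<close>
    have quot: "Re (L a) / (2 * d) \<le> norm ((g z - g z1) / (z - z1))"
      if z: "z = z1 + of_real s * (a - z1)" "0 < s" "s < 1" for z s
    proof -
      have az: "dist a z = (1 - s) * d"
      proof -
        have "a - z = of_real (1 - s) * (a - z1)" using z by (simp add: algebra_simps)
        thus ?thesis using z by (simp add: dist_norm norm_mult d_def del: of_real_diff)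
      qed
      have zz1: "norm (z - z1) = s * d" using z by (simp add: norm_mult d_def dist_norm)
      have zb: "z \<in> ball a d" using az z d0 by simp
      have "Re (L a) * s \<le> 2 * Re (L z)"
        using harnack_lower[OF L(1) posL zb] az d0 by simp
      also have "Re (L z) \<le> norm (g z) - 1"
        using ReL[OF zb] gt[OF zb] ln_le_minus_one[of "norm (g z)"] by linarith
      also have "\<dots> \<le> norm (g z) - norm (g z1)" using z1 by simp
      also have "\<dots> \<le> norm (g z - g z1)" by (rule norm_triangle_ineq2)
      finally have "Re (L a) * s \<le> 2 * norm (g z - g z1)" by simp
      thus ?thesis unfolding norm_divide zz1 using z(2) d0 by (simp add: field_simps)
    qed
    have "g field_differentiable (at z1)" using hol holomorphic_on_imp_differentiable_at open_UNIV by blast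
    hence lim: "((\<lambda>z. (g z - g z1) / (z - z1)) \<longlongrightarrow> deriv g z1) (at z1)"
      using field_differentiable_derivI has_field_derivative_iff by blast
    have fl: "filterlim (\<lambda>s. z1 + of_real s * (a - z1)) (at z1) (at_right (0::real))"
    proof (rule filterlim_atI)
      show "((\<lambda>s. z1 + of_real s * (a - z1)) \<longlongrightarrow> z1) (at_right (0::real))"
        by (auto intro!: tendsto_eq_intros)
      show "\<forall>\<^sub>F s in at_right (0::real). z1 + of_real s * (a - z1) \<noteq> z1"
        using eventually_at_right_less[of 0] by eventually_elim (use d0 in \<open>auto simp: d_def\<close>)
    qed
    have "Re (L a) / (2 * d) \<le> norm (deriv g z1)"
    proof (rule tendsto_le[OF _ tendsto_norm[OF filterlim_compose[OF lim fl]] tendsto_const])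
      show "\<forall>\<^sub>F s in at_right (0::real). Re (L a) / (2 * d) \<le>
        norm ((g (z1 + of_real s * (a - z1)) - g z1) / (z1 + of_real s * (a - z1) - z1))"
        using eventually_at_right_real[of 0 1, simplified] by eventually_elim (intro quot, auto)
    qed simp
    also have "\<dots> \<le> K * (1 + 1)"
      using z1(1) by (intro order_trans[OF K] mult_left_mono add_mono K0) (auto simp: power_le_one)
    finally have "Re (L a) \<le> 4 * K * d" using d0 by (simp add: field_simps)
    also have "\<dots> \<le> 4 * K * dist a z0" using z1(2)[OF z0] K0 by (intro mult_left_mono) (auto simp: d_def)
    finally have "exp (ln (norm (g a))) \<le> exp (4 * K * dist a z0)" using ReL[OF ab] by simp
    moreover have "norm (g a) > 0" using ga by linarith
    ultimately show ?thesis by (simp only: exp_ln)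
  qed
  have "norm (g a) \<le> exp (C * (1 + norm a))" for a
  proof (cases "norm (g a) > 1")
    case True
    have "dist a z0 \<le> norm a + norm z0" by (simp add: dist_norm norm_triangle_ineq4)
    also have "\<dots> \<le> (1 + norm z0) * (1 + norm a)" by (simp add: algebra_simps)
    finally have "4 * K * dist a z0 \<le> 4 * K * ((1 + norm z0) * (1 + norm a))" using K0 by (intro mult_left_mono) auto
    with main[OF True] K0 show ?thesis unfolding C_def by (simp add: mult.assoc order_trans)
  next
    case False
    have "norm (g a) \<le> 1" using False by simp
    also have "1 \<le> exp (C * (1 + norm a))" by (simp add: C_def)
    finally show ?thesis .
  qed
  thus ?thesis by (intro exI[of _ C]) (auto simp: C_def)
qed

section \<open>Functions of exponential type\<close>

lemma zero_free_exponential_type: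
  fixes u :: "complex \<Rightarrow> complex"
  assumes hol: "u holomorphic_on UNIV" and nz: "\<And>z. u z \<noteq> 0"
    and C: "\<And>z. norm (u z) \<le> exp (C * (1 + norm z))" "C \<ge> 0"
  shows "\<exists>c d. \<forall>z. u z = exp (c * z + d)"
proof -
  obtain P where P: "P holomorphic_on UNIV" "\<And>z. u z = exp (P z)"
    using contractible_imp_holomorphic_log[of u UNIV] nz hol by (metis UNIV_I contractible_UNIV)
  have ReP: "Re (P z) \<le> C * (1 + norm z)" for z
    using C(1)[of z] P(2)[of z] by simp
  have lin: "norm (P w - P 0) \<le> 2 * (2 * C + 1 + \<bar>Re (P 0)\<bar>) + 4 * C * norm w" for w
  proof -
    \<comment> \<open>\<open>R\<close> puts \<open>w\<close> inside half the radius, and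
      \<open>A\<close> exceeds \<open>Re (P z)\<close> on the disc, so that \<open>A - P\<close> has
      positive real part. This turns the one-sided bound on the logarithm \<open>P\<close> into a
      linear bound on its modulus, and \<open>P\<close> is a polynomial of degree at most 1.\<close>
    define R where "R = 2 * norm w + 1"
    define A where "A = C * (1 + R) + 1"
    have R0: "R > 0" by (simp add: R_def add_nonneg_pos)
    have "norm ((A - P w) - (A - P 0)) \<le> 2 * Re (A - P 0)"
    proof (rule harnack_upper[of "\<lambda>z. A - P z" 0 R w])
      show "(\<lambda>z. A - P z) holomorphic_on ball 0 R"
        using holomorphic_on_subset[OF P(1)] by (intro holomorphic_intros) auto
      fix z assume "z \<in> ball (0::complex) R"
      hence "C * (1 + norm z) \<le> C * (1 + R)" using C(2) by (intro mult_left_mono) auto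
      thus "Re (A - P z) > 0" using ReP[of z] by (simp add: A_def)
    qed (use R0 in \<open>auto simp: R_def\<close>)
    hence "norm (P w - P 0) \<le> 2 * (2 * C + 1 - Re (P 0)) + 4 * C * norm w"
      by (simp add: A_def R_def norm_minus_commute algebra_simps)
    thus ?thesis using abs_ge_minus_self[of "Re (P 0)"] by (simp add: algebra_simps)
  qed
  have "\<exists>a. \<forall>z. P z = (\<Sum>k\<le>1. a k * z ^ k)"
  proof -
    define B where "B = 2 * (2 * C + 1 + \<bar>Re (P 0)\<bar>) + 4 * C + norm (P 0)"
    have "norm (P z) \<le> B * norm z ^ 1" if "1 \<le> norm z" for z
    proof -
      have "norm (P z) \<le> norm (P 0) + norm (P z - P 0)" by (metis norm_triangle_sub)
      also have "\<dots> \<le> norm (P 0) + (2 * (2 * C + 1 + \<bar>Re (P 0)\<bar>) + 4 * C * norm z)" using lin by simp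
      also have "\<dots> \<le> norm (P 0) * norm z + (2 * (2 * C + 1 + \<bar>Re (P 0)\<bar>) * norm z + 4 * C * norm z)"
        using that C(2) mult_left_mono[OF that, of "norm (P 0)"] mult_left_mono[OF that, of "2 * (2 * C + 1 + \<bar>Re (P 0)\<bar>)"] by simp
      finally show ?thesis by (simp add: B_def algebra_simps)
    qed
    from Liouville_polynomial[OF P(1) this] show ?thesis by metis
  qed
  then obtain a where "\<forall>z. P z = (\<Sum>k\<le>1. a k * z ^ k)" by blast
  hence "u z = exp (a 1 * z + a 0)" for z using P(2)[of z] by (simp add: add.commute)
  thus ?thesis by blast
qed

text \<open>Cauchy's estimate on the unit circle about \<open>z\<close>, where
  \<open>1 + norm w \<le> 2 * (1 + norm z)\<close>; hence the doubled constant.\<close>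

lemma exponential_type_deriv:
  fixes g :: "complex \<Rightarrow> complex"
  assumes hol: "g holomorphic_on UNIV" and C: "\<And>z. norm (g z) \<le> exp (C * (1 + norm z))" "C \<ge> 0"
  shows "norm (deriv g z) \<le> exp (2 * C * (1 + norm z))"
proof -
  have "norm ((deriv ^^ 1) g z) \<le> (fact 1 * exp (2 * C * (1 + norm z))) / 1 ^ 1"
  proof (rule Cauchy_inequality)
    fix w assume "norm (z - w) = 1"
    hence "norm w \<le> 1 + norm z" by (metis add.commute norm_minus_commute norm_triangle_sub)
    also have "1 + norm z \<le> 1 + 2 * norm z" by simp
    finally have "1 + norm w \<le> 2 * (1 + norm z)" by simp
    hence "C * (1 + norm w) \<le> C * (2 * (1 + norm z))" using C(2) by (rule mult_left_mono)
    thus "norm (g w) \<le> exp (2 * C * (1 + norm z))" using C(1)[of w]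
      by (metis (no_types, lifting) exp_le_cancel_iff mult.assoc mult.commute order_trans)
  qed (use hol in \<open>auto intro: holomorphic_on_subset holomorphic_on_imp_continuous_on\<close>)
  thus ?thesis by simp
qed

section \<open>Meromorphic functions in charts of the sphere\<close>

lemma doubling:
  fixes M :: "'a::banach \<Rightarrow> real"
  assumes locb: "\<And>z. \<exists>d>0. \<exists>B. \<forall>w\<in>ball z d. M w \<le> B"
    and unb: "\<And>B. \<exists>z. M z > B" and k: "k > 0"
  shows "\<exists>z. M z > B \<and> (\<forall>w\<in>ball z (k / M z). M w \<le> 2 * M z)"
proof (rule ccontr)
  define b where "b = max B 1"
  assume "\<not> ?thesis"
  \<comment> \<open>If no point is suitable, each point has a close neighbour where \<open>M\<close>
    more than doubles. Iterating gives steps dominated by a geometric series, so the points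
    converge, and \<open>M\<close> is unbounded near the limit. The maximum with 1 in
    \<open>b\<close> yields \<open>M (x n) \<ge> 2 ^ n\<close>.\<close>
  hence step: "\<exists>w. dist z w < k / M z \<and> M w > 2 * M z" if "M z > b" for z
    using that by (force simp: b_def not_le)
  obtain z0 where z0: "M z0 > b" using unb by blast
  have "\<exists>x. \<forall>n. M (x n) > b \<and> (dist (x n) (x (Suc n)) < k / M (x n) \<and> M (x (Suc n)) > 2 * M (x n))"
  proof (rule dependent_nat_choice)
    show "\<exists>x. b < M x" using z0 by blast
    fix x and n :: nat assume x: "b < M x"
    then obtain w where "dist x w < k / M x" "M w > 2 * M x" using step by blast
    with x show "\<exists>y. b < M y \<and> (dist x y < k / M x \<and> 2 * M x < M y)"
      by (intro exI[of _ w]) (auto simp: b_def)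
  qed
  then obtain x where x: "\<And>n. M (x n) > b" "\<And>n. dist (x n) (x (Suc n)) < k / M (x n)"
    "\<And>n. M (x (Suc n)) > 2 * M (x n)" by blast
  have big: "M (x n) \<ge> 2 ^ n" for n
  proof (induction n)
    case 0 show ?case using x(1)[of 0] by (simp add: b_def)
  next
    case (Suc n) thus ?case using x(3)[of n] by simp
  qed
  have nle: "norm (x (Suc n) - x n) \<le> k * (1/2) ^ n" for n
  proof -
    have "k / M (x n) \<le> k / 2 ^ n" using big[of n] k x(1)[of n]
      by (intro divide_left_mono) (auto simp: b_def)
    thus ?thesis using x(2)[of n] by (simp add: dist_norm norm_minus_commute power_divide)
  qed
  have "summable (\<lambda>n. k * (1/2::real) ^ n)" by (intro summable_mult summable_geometric) auto
  hence "summable (\<lambda>n. x (Suc n) - x n)" by (rule summable_comparison_test'[where N = 0]) (rule nle)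
  hence "convergent (\<lambda>n. \<Sum>i<n. x (Suc i) - x i)" by (simp add: summable_iff_convergent)
  then obtain l where "(\<lambda>n. x n - x 0) \<longlonglongrightarrow> l" by (auto simp: sum_lessThan_telescope convergent_def)
  from tendsto_add[OF this tendsto_const[of "x 0"]] have lim: "x \<longlonglongrightarrow> l + x 0" by simp
  obtain d C where d: "d > 0" "\<And>w. w \<in> ball (l + x 0) d \<Longrightarrow> M w \<le> C" using locb by metis
  have "\<forall>\<^sub>F n in sequentially. M (x n) \<le> C"
    using tendstoD[OF lim d(1)] by eventually_elim (auto simp: dist_commute intro!: d)
  moreover have "\<forall>\<^sub>F n in sequentially. norm ((2::real) ^ n) > C"
    using filterlim_at_infinity_imp_norm_at_top[OF filterlim_realpow_sequentially_gt1[of "2::real"]]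
    unfolding filterlim_at_top_dense by simp
  hence "\<forall>\<^sub>F n in sequentially. (2::real) ^ n > C" by simp
  ultimately have "\<forall>\<^sub>F n::nat in sequentially. False"
    by eventually_elim (use big in \<open>meson linorder_not_less order_trans\<close>)
  thus False by simp
qed

text \<open>Equivalent to being nicely meromorphic on the plane: the library's value \<open>0\<close> at a pole is the
  value of \<open>1/f\<close> there, because \<open>inverse 0 = 0\<close>.\<close>

definition chart_analytic :: "(complex \<Rightarrow> complex) \<Rightarrow> bool" where
  "chart_analytic f \<longleftrightarrow> (\<forall>z. f analytic_on {z} \<or> (\<lambda>w. inverse (f w)) analytic_on {z})"

lemma chart_analytic_inverse: "chart_analytic f \<Longrightarrow> chart_analytic (\<lambda>w. inverse (f w))"
  unfolding chart_analytic_def by auto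

lemma eventually_eq_imp_analytic:
  assumes "\<forall>\<^sub>F w in nhds z. f w = g w" "g analytic_on {z}"
  shows "f analytic_on {z}"
  using assms analytic_at_cong by metis

lemma eventually_nhds_analytic:
  "f analytic_on {z} \<Longrightarrow> \<forall>\<^sub>F w in nhds z. f analytic_on {w}" for f :: "complex \<Rightarrow> complex"
  unfolding eventually_nhds analytic_on_def by (metis analytic_at analytic_on_def insertI1 singletonD)

lemma eventually_at_analytic:
  "f analytic_on {z} \<Longrightarrow> \<forall>\<^sub>F w in at z. f analytic_on {w}" for f :: "complex \<Rightarrow> complex"
  using eventually_nhds_analytic eventually_nhds_conv_at by blast

lemma inverse_analytic: "f analytic_on {z} \<Longrightarrow> f z \<noteq> 0 \<Longrightarrow> (\<lambda>w. inverse (f w)) analytic_on {z}"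
  by (intro analytic_on_inverse) auto

lemma zero_free_or_zero:
  fixes h :: "complex \<Rightarrow> complex"
  assumes "h analytic_on {z}"
  shows "(\<forall>\<^sub>F w in nhds z. h w = 0) \<or> (\<forall>\<^sub>F w in at z. h w \<noteq> 0)"
proof (cases "\<forall>\<^sub>F w in at z. h w \<noteq> 0")
  case False
  hence fr: "\<exists>\<^sub>F w in at z. h w = 0" by (simp add: frequently_def)
  obtain r where r: "r > 0" "h holomorphic_on ball z r" using assms by (meson analytic_at_ball)
  have lp: "z islimpt {w \<in> ball z r. h w = 0}"
    unfolding islimpt_conv_frequently_at
    by (rule frequently_rev_mp[OF fr], rule eventually_mono[OF eventually_at_in_open'[of "ball z r" z]])
      (use r(1) in auto)
  have "h w = 0" if "w \<in> ball z r" for w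
    by (rule analytic_continuation[OF r(2) _ _ _ _ lp _ that]) (use r(1) in auto)
  moreover have "\<forall>\<^sub>F w in nhds z. w \<in> ball z r"
    using r(1) by (intro eventually_nhds_in_open) auto
  ultimately show ?thesis by (auto elim: eventually_mono)
qed auto

text \<open>Where \<open>f\<close> is not analytic, \<open>1/f\<close> is analytic and must vanish,
  since otherwise inverting again would make \<open>f\<close> analytic. The zero is isolated: if
  \<open>1/f\<close> were 0 on a neighbourhood, so would be \<open>f\<close>, by
  \<open>inverse 0 = 0\<close>.\<close>

lemma chart_analytic_pole:
  assumes f: "chart_analytic f" and na: "\<not> f analytic_on {z}"
  shows "(\<lambda>w. inverse (f w)) analytic_on {z}" "f z = 0" "\<forall>\<^sub>F w in at z. f w \<noteq> 0 \<and> f analytic_on {w}"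
    "is_pole f z"
proof -
  show h: "(\<lambda>w. inverse (f w)) analytic_on {z}" using f na by (auto simp: chart_analytic_def)
  show f0: "f z = 0" using inverse_analytic[OF h] na by auto
  have "\<not> (\<forall>\<^sub>F w in nhds z. inverse (f w) = 0)"
  proof
    assume "\<forall>\<^sub>F w in nhds z. inverse (f w) = 0"
    hence "\<forall>\<^sub>F w in nhds z. f w = 0" by eventually_elim auto
    hence "f analytic_on {z}" by (rule eventually_eq_imp_analytic) auto
    thus False using na by blast
  qed
  hence ev: "\<forall>\<^sub>F w in at z. f w \<noteq> 0" using zero_free_or_zero[OF h] by (auto elim: eventually_mono)
  have evh: "\<forall>\<^sub>F w in at z. (\<lambda>w. inverse (f w)) analytic_on {w}"
    using h by (rule eventually_at_analytic)
  show "\<forall>\<^sub>F w in at z. f w \<noteq> 0 \<and> f analytic_on {w}"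
    using ev evh by eventually_elim (use inverse_analytic[of "\<lambda>w. inverse (f w)"] in auto)
  have "((\<lambda>w. inverse (f w)) \<longlongrightarrow> 0) (at z)"
    using analytic_at_imp_isCont[OF h] f0 by (simp add: isCont_def)
  hence "filterlim (\<lambda>w. inverse (f w)) (at 0) (at z)" using ev by (auto simp: filterlim_at)
  thus "is_pole f z" unfolding is_pole_def by (simp add: filterlim_inverse_at_iff)
qed

lemma chart_analytic_is_pole_iff: "chart_analytic f \<Longrightarrow> is_pole f z \<longleftrightarrow> \<not> f analytic_on {z}"
  using chart_analytic_pole(4) analytic_at_imp_no_pole by blast

text \<open>At a pole the limit 0 of \<open>1/f\<close> agrees with the inverse of the prescribed
  value 0, so \<open>1/f\<close> is continuous and meromorphic, hence analytic. Conversely, where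
  \<open>f\<close> is not analytic it is the inverse of an analytic function.\<close>

lemma nicely_meromorphic_iff_chart_analytic: "f nicely_meromorphic_on UNIV \<longleftrightarrow> chart_analytic f"
proof
  assume f: "f nicely_meromorphic_on UNIV"
  show "chart_analytic f" unfolding chart_analytic_def
  proof
    fix z
    show "f analytic_on {z} \<or> (\<lambda>w. inverse (f w)) analytic_on {z}"
    proof (cases "is_pole f z")
      case False thus ?thesis using nicely_meromorphic_on_imp_analytic_at[OF f] by simp
    next
      case True
      hence "\<not> f \<midarrow>z\<rightarrow> f z" unfolding is_pole_def
        using not_tendsto_and_filterlim_at_infinity[OF at_neq_bot] by blast
      hence f0: "f z = 0" and m: "f meromorphic_on UNIV" using f by (auto simp: nicely_meromorphic_on_def)
      have "((\<lambda>w. inverse (f w)) \<longlongrightarrow> 0) (at z)"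
        using True unfolding is_pole_def by (rule filterlim_compose[OF tendsto_inverse_0])
      hence "isCont (\<lambda>w. inverse (f w)) z" by (simp add: isCont_def f0)
      moreover have "(\<lambda>w. inverse (f w)) meromorphic_on {z}"
        using m by (intro meromorphic_intros) (auto intro: meromorphic_on_subset)
      ultimately show ?thesis using meromorphic_at_isCont_imp_analytic by blast
    qed
  qed
next
  assume f: "chart_analytic f"
  have "f meromorphic_on {z} \<and> (is_pole f z \<and> f z = 0 \<or> f \<midarrow>z\<rightarrow> f z)" for z
  proof (cases "f analytic_on {z}")
    case True thus ?thesis
      using analytic_at_imp_isCont analytic_on_imp_meromorphic_on isCont_def by blast
  next
    case False
    have "(\<lambda>w. inverse (inverse (f w))) meromorphic_on {z}"
      using chart_analytic_pole(1)[OF f False] by (intro meromorphic_on_inverse analytic_on_imp_meromorphic_on)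
    thus ?thesis using chart_analytic_pole[OF f False] by simp
  qed
  thus "f nicely_meromorphic_on UNIV"
    unfolding nicely_meromorphic_on_def using meromorphic_on_meromorphic_at by blast
qed

lemma to_sphere_chart_analytic:
  "chart_analytic f \<Longrightarrow> to_sphere f z = (if f analytic_on {z} then Fin (f z) else Infty)"
  by (simp add: to_sphere_def chart_analytic_is_pole_iff)

section \<open>Inversion and the chordal distance on the sphere\<close>

fun sphere_inv :: "riemann_sphere \<Rightarrow> riemann_sphere" where
  "sphere_inv (Fin z) = (if z = 0 then Infty else Fin (inverse z))"
| "sphere_inv Infty = Fin 0"

lemma sphere_inv_inv [simp]: "sphere_inv (sphere_inv p) = p"
  by (cases p) auto

text \<open>Inversion is the half-turn of the unit sphere about the real axis. It is therefore an
  isometry, and the charts at 0 and at infinity can be exchanged without changing any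
  estimate.\<close>

lemma stereo_sphere_inv: "stereo (sphere_inv p) = (cnj (fst (stereo p)), - snd (stereo p))"
proof (cases p)
  case (Fin z)
  show ?thesis
  proof (cases "z = 0")
    case False
    define t where "t = (norm z)\<^sup>2"
    have t: "t > 0" using False by (simp add: t_def)
    have iz: "inverse z = (1 / t) *\<^sub>R cnj z"
      using False complex_norm_square[of z] by (simp add: t_def scaleR_conv_of_real field_simps)
    have n: "(norm (inverse z))\<^sup>2 = 1 / t" by (simp add: t_def norm_inverse power_inverse inverse_eq_divide[symmetric])
    have "stereo (Fin (inverse z)) = ((2 / (1 + 1 / t)) *\<^sub>R inverse z, (1 / t - 1) / (1 + 1 / t))"
      by (simp only: stereo.simps n)
    also have "\<dots> = ((2 / (1 + t)) *\<^sub>R cnj z, - ((t - 1) / (1 + t)))"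
      unfolding iz using t by (auto simp: divide_simps)
    finally show ?thesis using False by (simp add: Fin t_def del: stereo.simps(1)) (simp add: scaleR_conv_of_real)
  qed (simp add: Fin)
qed simp

lemma norm_stereo_sphere_inv:
  "norm (stereo (sphere_inv p) - stereo (sphere_inv q)) = norm (stereo p - stereo q)"
proof -
  obtain x t y s where p: "stereo p = (x, t)" and q: "stereo q = (y, s)" by (meson surj_pair)
  have "stereo (sphere_inv p) - stereo (sphere_inv q) = (cnj (x - y), - (t - s))"
    by (simp add: stereo_sphere_inv p q)
  also have "norm \<dots> = norm (x - y, t - s)" unfolding norm_Pair complex_mod_cnj norm_minus_cancel ..
  finally show ?thesis by (simp add: p q)
qed

text \<open>The classical formula for the chordal distance. Once squared and expressed by
  \<open>s\<close> and \<open>t\<close>, it is a polynomial identity in the real and imaginary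
  parts.\<close>

lemma norm_stereo_diff:
  "norm (stereo (Fin z) - stereo (Fin w)) = 2 * norm (z - w) / (sqrt (1 + (norm z)\<^sup>2) * sqrt (1 + (norm w)\<^sup>2))"
proof -
  define s t where "s = (norm z)\<^sup>2" and "t = (norm w)\<^sup>2"
  have st: "1 + s > 0" "1 + t > 0" by (auto simp: s_def t_def add_pos_nonneg)
  have s2: "s = (Re z)\<^sup>2 + (Im z)\<^sup>2" and t2: "t = (Re w)\<^sup>2 + (Im w)\<^sup>2" by (simp_all add: s_def t_def cmod_power2)
  have "(norm (stereo (Fin z) - stereo (Fin w)))\<^sup>2
      = (norm ((2 / (1 + s)) *\<^sub>R z - (2 / (1 + t)) *\<^sub>R w))\<^sup>2 + ((s - 1) / (1 + s) - (t - 1) / (1 + t))\<^sup>2"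
    by (simp add: norm_prod_def s_def t_def)
  also have "\<dots> = (2 / (1 + s) * Re z - 2 / (1 + t) * Re w)\<^sup>2 + (2 / (1 + s) * Im z - 2 / (1 + t) * Im w)\<^sup>2
       + ((s - 1) / (1 + s) - (t - 1) / (1 + t))\<^sup>2" by (simp add: cmod_power2)
  also have "\<dots> = 4 * ((Re z - Re w)\<^sup>2 + (Im z - Im w)\<^sup>2) / ((1 + s) * (1 + t))"
  proof -
    have e1: "2 / (1 + s) * a - 2 / (1 + t) * b = 2 * (a * (1 + t) - b * (1 + s)) / ((1 + s) * (1 + t))" for a b
      using st by (simp add: field_simps)
    have e2: "(s - 1) / (1 + s) - (t - 1) / (1 + t) = 2 * (s - t) / ((1 + s) * (1 + t))"
      using st by (simp add: field_simps)
    have "(2 * (Re z * (1 + t) - Re w * (1 + s)))\<^sup>2 + (2 * (Im z * (1 + t) - Im w * (1 + s)))\<^sup>2 + (2 * (s - t))\<^sup>2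
       = 4 * ((Re z - Re w)\<^sup>2 + (Im z - Im w)\<^sup>2) * ((1 + s) * (1 + t))"
      unfolding s2 t2 by algebra
    thus ?thesis unfolding e1 e2 power_divide add_divide_distrib[symmetric]
      using st by (simp add: power2_eq_square)
  qed
  also have "\<dots> = (2 * norm (z - w) / (sqrt (1 + s) * sqrt (1 + t)))\<^sup>2"
    using st by (simp add: power_divide power_mult_distrib cmod_power2)
  finally show ?thesis unfolding s_def t_def by (rule power2_eq_imp_eq) (auto intro!: divide_nonneg_nonneg)
qed

lemma norm_stereo_diff_Infty: "norm (stereo (Fin z) - stereo Infty) = 2 / sqrt (1 + (norm z)\<^sup>2)"
proof -
  define t where "t = (norm z)\<^sup>2"
  have t: "1 + t > 0" by (simp add: t_def add_pos_nonneg)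
  have "(norm (stereo (Fin z) - stereo Infty))\<^sup>2 = (2 / (1 + t))\<^sup>2 * t + ((t - 1) / (1 + t) - 1)\<^sup>2"
    by (simp add: norm_prod_def t_def power_mult_distrib power_divide)
  also have "(t - 1) / (1 + t) - 1 = - 2 / (1 + t)" using t by (simp add: field_simps)
  also have "(2 / (1 + t))\<^sup>2 * t + (- 2 / (1 + t))\<^sup>2 = (4 * (1 + t)) / ((1 + t) * (1 + t))"
    by (simp add: power_divide power2_eq_square add_divide_distrib algebra_simps)
  also have "\<dots> = 4 / (1 + t)" using t by (simp only: mult_divide_mult_cancel_right)
  also have "\<dots> = (2 / sqrt (1 + t))\<^sup>2" using t by (simp add: power_divide)
  finally show ?thesis unfolding t_def by (rule power2_eq_imp_eq) (auto intro!: divide_nonneg_nonneg)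
qed

lemma stereo_surj:
  assumes "norm q = 1"
  obtains p where "stereo p = q"
proof -
  obtain x t where q: "q = (x, t)" by (cases q)
  have xt: "(norm x)\<^sup>2 + t\<^sup>2 = 1" using assms by (simp add: q norm_prod_def)
  show thesis
  proof (cases "t = 1")
    case True
    thus thesis using that[of Infty] xt by (simp add: q)
  next
    case False
    have "t\<^sup>2 \<le> 1" using xt zero_le_power2[of "norm x"] by linarith
    hence "t < 1" using False by (simp add: abs_square_le_1 abs_le_iff)
    \<comment> \<open>Stereographic projection of \<open>(x, t)\<close> from the north pole.\<close>
    define z where "z = (1 / (1 - t)) *\<^sub>R x"
    have "(norm z)\<^sup>2 = (1 - t\<^sup>2) / (1 - t)\<^sup>2" using xt by (simp add: z_def power_mult_distrib power_divide)
    also have "1 - t\<^sup>2 = (1 - t) * (1 + t)" by (simp add: power2_eq_square algebra_simps)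
    finally have n: "(norm z)\<^sup>2 = (1 + t) / (1 - t)" using \<open>t < 1\<close> by (simp add: power2_eq_square)
    have "1 + (norm z)\<^sup>2 = 2 / (1 - t)" "(norm z)\<^sup>2 - 1 = 2 * t / (1 - t)"
      unfolding n using \<open>t < 1\<close> by (simp_all add: field_simps)
    hence "stereo (Fin z) = q" using \<open>t < 1\<close> by (simp add: q z_def)
    thus thesis by (rule that)
  qed
qed

text \<open>The value 0 has to be excluded: if \<open>f\<close> vanishes identically near
  \<open>z\<close>, so does its pointwise inverse, whereas \<open>sphere_inv\<close> would give
  infinity.\<close>

lemma to_sphere_inverse:
  assumes f: "chart_analytic f" and nz: "to_sphere f z \<noteq> Fin 0"
  shows "to_sphere (\<lambda>w. inverse (f w)) z = sphere_inv (to_sphere f z)"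
proof (cases "f analytic_on {z}")
  case True
  hence "f z \<noteq> 0" using nz f by (auto simp: to_sphere_chart_analytic)
  thus ?thesis using True inverse_analytic[OF True] f
    by (simp add: to_sphere_chart_analytic chart_analytic_inverse)
next
  case False
  thus ?thesis using chart_analytic_pole[OF f False] f
    by (simp add: to_sphere_chart_analytic chart_analytic_inverse)
qed

text \<open>Local bounds at single points add up along the segment from \<open>z\<close> to
  \<open>w\<close>, by bisection; no differentiability of \<open>T\<close> is involved. Finally
  \<open>e\<close> tends to 0.\<close>

lemma locally_lipschitz_imp_lipschitz:
  fixes T :: "'a::real_normed_vector \<Rightarrow> 'b::real_normed_vector"
  assumes S: "convex S" and K: "K \<ge> 0"
    and loc: "\<And>z e. z \<in> S \<Longrightarrow> e > 0 \<Longrightarrow> \<forall>\<^sub>F w in at z. norm (T w - T z) \<le> (K + e) * norm (w - z)"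
    and zw: "z \<in> S" "w \<in> S"
  shows "norm (T w - T z) \<le> K * norm (w - z)"
proof (cases "w = z")
  case False
  have le: "norm (T w - T z) \<le> (K + e) * norm (w - z)" if e: "e > 0" for e
  proof -
    define \<gamma> where "\<gamma> = (\<lambda>t::real. z + t *\<^sub>R (w - z))"
    have diff: "norm (\<gamma> t - \<gamma> s) = \<bar>t - s\<bar> * norm (w - z)" for s t
      by (simp add: \<gamma>_def flip: scaleR_left_diff_distrib)
    have "norm (T (\<gamma> 1) - T (\<gamma> 0)) \<le> (K + e) * ((1 - 0) * norm (w - z))"
    \<comment> \<open>The property is additive over adjacent intervals and holds for every short
      interval containing \<open>x\<close>: both ends are compared with \<open>x\<close>, so the
      bound at the single point \<open>x\<close> suffices.\<close>
    proof (rule Bolzano[where P = "\<lambda>s t. norm (T (\<gamma> t) - T (\<gamma> s)) \<le> (K + e) * ((t - s) * norm (w - z))"])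
      fix a b c :: real
      assume "norm (T (\<gamma> b) - T (\<gamma> a)) \<le> (K + e) * ((b - a) * norm (w - z))"
        "norm (T (\<gamma> c) - T (\<gamma> b)) \<le> (K + e) * ((c - b) * norm (w - z))"
      from norm_triangle_mono[OF this] show "norm (T (\<gamma> c) - T (\<gamma> a)) \<le> (K + e) * ((c - a) * norm (w - z))"
        by (simp add: algebra_simps)
    next
      fix x :: real assume x: "0 \<le> x" "x \<le> 1"
      have "\<gamma> x = (1 - x) *\<^sub>R z + x *\<^sub>R w" by (simp add: \<gamma>_def algebra_simps)
      hence "\<gamma> x \<in> S" using S zw x by (simp add: convexD)
      from loc[OF this e] obtain d where d: "d > 0"
        "\<And>y. dist y (\<gamma> x) < d \<Longrightarrow> norm (T y - T (\<gamma> x)) \<le> (K + e) * norm (y - \<gamma> x)"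
        unfolding eventually_at by (metis UNIV_I diff_self norm_zero mult_zero_right order_refl)
      show "\<exists>d>0. \<forall>a b. a \<le> x \<and> x \<le> b \<and> b - a < d \<longrightarrow> norm (T (\<gamma> b) - T (\<gamma> a)) \<le> (K + e) * ((b - a) * norm (w - z))"
      proof (intro exI[of _ "d / norm (w - z)"] conjI allI impI)
        show "d / norm (w - z) > 0" using d False by simp
        fix a b assume ab: "a \<le> x \<and> x \<le> b \<and> b - a < d / norm (w - z)"
        hence "(b - a) * norm (w - z) < d" using False by (simp add: pos_less_divide_eq)
        moreover have "(x - a) * norm (w - z) \<le> (b - a) * norm (w - z)" "(b - x) * norm (w - z) \<le> (b - a) * norm (w - z)"
          using ab by (auto intro!: mult_right_mono)
        ultimately have "dist (\<gamma> a) (\<gamma> x) < d" "dist (\<gamma> b) (\<gamma> x) < d"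
          using ab by (auto simp: dist_norm diff abs_minus_commute)
        from this[THEN d(2)] have "norm (T (\<gamma> x) - T (\<gamma> a)) \<le> (K + e) * ((x - a) * norm (w - z))"
          "norm (T (\<gamma> b) - T (\<gamma> x)) \<le> (K + e) * ((b - x) * norm (w - z))"
          using ab by (auto simp: diff norm_minus_commute)
        from norm_triangle_mono[OF this] show "norm (T (\<gamma> b) - T (\<gamma> a)) \<le> (K + e) * ((b - a) * norm (w - z))"
          by (simp add: algebra_simps)
      qed
    qed simp
    thus ?thesis by (simp add: \<gamma>_def)
  qed
  show ?thesis
  proof (rule field_le_epsilon)
    fix e :: real assume "e > 0"
    thus "norm (T w - T z) \<le> K * norm (w - z) + e"
      using le[of "e / norm (w - z)"] False by (simp add: distrib_right)
  qed
qed simp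

section \<open>Equicontinuity and normality on the sphere\<close>

lemma deriv_inverse_analytic:
  assumes "f analytic_on {z}" "f z \<noteq> 0"
  shows "deriv (\<lambda>w. inverse (f w)) z = - deriv f z / (f z)\<^sup>2"
proof -
  have "(f has_field_derivative deriv f z) (at z)"
    using analytic_on_imp_differentiable_at[OF assms(1)] field_differentiable_derivI by blast
  from DERIV_inverse_fun[OF this assms(2)] show ?thesis
    by (intro DERIV_imp_deriv) (simp add: field_simps power2_eq_square)
qed

text \<open>The denominator is cleared and poles are left out, because \<open>deriv f\<close> has no
  meaning there. In the chart \<open>1/f\<close>, which has the same spherical derivative, the bound
  extends to them by continuity.\<close>

definition spherical_deriv_le :: "(complex \<Rightarrow> complex) \<Rightarrow> real \<Rightarrow> complex set \<Rightarrow> bool" where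
  "spherical_deriv_le f C S \<longleftrightarrow>
     (\<forall>z\<in>S. f analytic_on {z} \<longrightarrow> norm (deriv f z) \<le> C * (1 + (norm (f z))\<^sup>2))"

lemma spherical_deriv_le_inverse_pole:
  assumes f: "chart_analytic f" and S: "open S" "z \<in> S" and C: "spherical_deriv_le f C S"
    and na: "\<not> f analytic_on {z}"
  shows "norm (deriv (\<lambda>w. inverse (f w)) z) \<le> C * (1 + (norm (inverse (f z)))\<^sup>2)"
proof -
  let ?h = "\<lambda>w. inverse (f w)"
  note h = chart_analytic_pole[OF f na]
  have c1: "(deriv ?h \<longlongrightarrow> deriv ?h z) (at z)" "(?h \<longlongrightarrow> ?h z) (at z)"
    using analytic_at_imp_isCont[OF h(1)] analytic_at_imp_isCont[OF analytic_deriv[OF h(1)]]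
    by (auto simp: isCont_def)
  have ev: "\<forall>\<^sub>F w in at z. w \<in> S" using S by (simp add: eventually_at_in_open')
  have "\<forall>\<^sub>F w in at z. norm (deriv ?h w) \<le> C * (1 + (norm (?h w))\<^sup>2)"
    using h(3) ev
  proof eventually_elim
    case (elim w)
    hence "norm (deriv f w) \<le> C * (1 + (norm (f w))\<^sup>2)" using C by (auto simp: spherical_deriv_le_def)
    moreover have "(norm (f w))\<^sup>2 > 0" using elim by simp
    moreover have "deriv ?h w = - deriv f w / (f w)\<^sup>2" using elim by (intro deriv_inverse_analytic) auto
    hence "norm (deriv ?h w) = norm (deriv f w) / (norm (f w))\<^sup>2" by (simp only: norm_divide norm_minus_cancel norm_power)
    moreover have "C * (1 + (norm (?h w))\<^sup>2) = C * (1 + (norm (f w))\<^sup>2) / (norm (f w))\<^sup>2"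
    proof -
      have "t * (1 + inverse s) = t * (1 + s) / s" if "s \<noteq> 0" for s t :: real using that by (simp add: field_simps)
      thus ?thesis using elim by (simp only: norm_inverse power_inverse) simp
    qed
    ultimately show ?case by (simp add: divide_right_mono)
  qed
  thus ?thesis
    by (intro tendsto_le[OF _ tendsto_mult[OF tendsto_const tendsto_add[OF tendsto_const tendsto_power[OF tendsto_norm[OF c1(2)]]]]
          tendsto_norm[OF c1(1)]]) auto
qed

text \<open>The length element of the chordal distance is \<open>2 |dz| / (1 + |z|^2)\<close>, twice
  that of the spherical metric; hence \<open>2 * C\<close>. \<open>Q\<close> is the chordal
  difference quotient.\<close>

lemma stereo_local_bound:
  assumes f: "chart_analytic f" and an: "f analytic_on {z}" and C: "norm (deriv f z) \<le> C * (1 + (norm (f z))\<^sup>2)"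
    and e: "e > 0"
  shows "\<forall>\<^sub>F w in at z. norm (stereo (to_sphere f w) - stereo (to_sphere f z)) \<le> (2 * C + e) * norm (w - z)"
proof -
  define Q where "Q = (\<lambda>w. 2 * norm ((f w - f z) / (w - z)) / (sqrt (1 + (norm (f w))\<^sup>2) * sqrt (1 + (norm (f z))\<^sup>2)))"
  have pos: "1 + (norm (f w))\<^sup>2 > 0" for w by (simp add: add_pos_nonneg)
  have "(f has_field_derivative deriv f z) (at z)"
    using analytic_on_imp_differentiable_at[OF an] field_differentiable_derivI by blast
  hence l1: "((\<lambda>w. (f w - f z) / (w - z)) \<longlongrightarrow> deriv f z) (at z)" by (simp add: has_field_derivative_iff)
  have l2: "(f \<longlongrightarrow> f z) (at z)" using analytic_at_imp_isCont[OF an] by (simp add: isCont_def)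
  have "(Q \<longlongrightarrow> 2 * norm (deriv f z) / (sqrt (1 + (norm (f z))\<^sup>2) * sqrt (1 + (norm (f z))\<^sup>2))) (at z)"
    unfolding Q_def using pos[of z] by (intro tendsto_intros l1 l2) auto
  moreover have "2 * norm (deriv f z) / (sqrt (1 + (norm (f z))\<^sup>2) * sqrt (1 + (norm (f z))\<^sup>2)) \<le> 2 * C"
    using C pos[of z] by (simp add: divide_le_eq)
  hence "2 * norm (deriv f z) / (sqrt (1 + (norm (f z))\<^sup>2) * sqrt (1 + (norm (f z))\<^sup>2)) < 2 * C + e" using e by linarith
  ultimately have "\<forall>\<^sub>F w in at z. Q w < 2 * C + e" by (rule order_tendstoD(2))
  moreover have "\<forall>\<^sub>F w in at z. w \<noteq> z" by (simp add: eventually_at_filter)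
  moreover note eventually_at_analytic[OF an]
  ultimately show ?thesis
  proof eventually_elim
    case (elim w)
    have "norm (stereo (to_sphere f w) - stereo (to_sphere f z)) = Q w * norm (w - z)"
      using elim an f by (simp add: to_sphere_chart_analytic norm_stereo_diff Q_def norm_divide del: stereo.simps)
    also have "\<dots> \<le> (2 * C + e) * norm (w - z)" using elim by (intro mult_right_mono) auto
    finally show ?case .
  qed
qed

lemma to_sphere_inverse_near_pole:
  assumes f: "chart_analytic f" and na: "\<not> f analytic_on {z}"
  shows "\<forall>\<^sub>F w in nhds z. to_sphere (\<lambda>w. inverse (f w)) w = sphere_inv (to_sphere f w)"
proof -
  have "\<forall>\<^sub>F w in at z. to_sphere f w \<noteq> Fin 0"
    using chart_analytic_pole(3)[OF f na] by eventually_elim (simp add: to_sphere_chart_analytic f)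
  moreover have "to_sphere f z \<noteq> Fin 0" using na by (simp add: to_sphere_chart_analytic f)
  ultimately have "\<forall>\<^sub>F w in nhds z. to_sphere f w \<noteq> Fin 0" by (simp add: eventually_nhds_conv_at)
  thus ?thesis by eventually_elim (rule to_sphere_inverse[OF f])
qed

lemma stereo_local_bound_pole:
  assumes f: "chart_analytic f" and na: "\<not> f analytic_on {z}"
    and C: "norm (deriv (\<lambda>w. inverse (f w)) z) \<le> C * (1 + (norm (inverse (f z)))\<^sup>2)" and e: "e > 0"
  shows "\<forall>\<^sub>F w in at z. norm (stereo (to_sphere f w) - stereo (to_sphere f z)) \<le> (2 * C + e) * norm (w - z)"
proof -
  note eq = to_sphere_inverse_near_pole[OF f na]
  have eqz: "to_sphere (\<lambda>w. inverse (f w)) z = sphere_inv (to_sphere f z)" using eq by (rule eventually_nhds_x_imp_x)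
  show ?thesis
    using stereo_local_bound[OF chart_analytic_inverse[OF f] chart_analytic_pole(1)[OF f na] C e]
      eventually_nhds_conv_at[THEN iffD1, OF eq, THEN conjunct1]
    by eventually_elim (simp add: eqz norm_stereo_sphere_inv)
qed

lemma spherical_lipschitz:
  assumes f: "chart_analytic f" and S: "open S" "convex S" and C: "spherical_deriv_le f C S" "C \<ge> 0"
    and zw: "z \<in> S" "w \<in> S"
  shows "norm (stereo (to_sphere f w) - stereo (to_sphere f z)) \<le> 2 * C * norm (w - z)"
proof (rule locally_lipschitz_imp_lipschitz[OF S(2) _ _ zw, where T = "\<lambda>w. stereo (to_sphere f w)"])
  fix z and e :: real assume z: "z \<in> S" and e: "e > 0"
  show "\<forall>\<^sub>F w in at z. norm (stereo (to_sphere f w) - stereo (to_sphere f z)) \<le> (2 * C + e) * norm (w - z)"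
  proof (cases "f analytic_on {z}")
    case True
    thus ?thesis using C z by (intro stereo_local_bound f e) (auto simp: spherical_deriv_le_def)
  next
    case False
    show ?thesis by (intro stereo_local_bound_pole f False e spherical_deriv_le_inverse_pole[OF f S(1) z C(1)])
  qed
qed (use C in auto)

lemma isCont_stereo_to_sphere:
  assumes f: "chart_analytic f"
  shows "isCont (\<lambda>w. stereo (to_sphere f w)) z"
proof -
  \<comment> \<open>At one point the norm of the derivative itself serves as the constant.\<close>
  have ge1: "x \<le> x * (1 + y\<^sup>2)" if "x \<ge> 0" for x y :: real using that by (simp add: distrib_left)
  obtain K where K: "\<forall>\<^sub>F w in at z. norm (stereo (to_sphere f w) - stereo (to_sphere f z)) \<le> K * norm (w - z)"
    using stereo_local_bound[OF f _ ge1, of z 1] stereo_local_bound_pole[OF f _ ge1, of z 1] by (metis norm_ge_zero zero_less_one)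
  have "((\<lambda>w. K * norm (w - z)) \<longlongrightarrow> 0) (at z)" by (auto intro!: tendsto_eq_intros)
  hence "((\<lambda>w. stereo (to_sphere f w) - stereo (to_sphere f z)) \<longlongrightarrow> 0) (at z)"
    by (rule Lim_null_comparison[OF K])
  thus ?thesis by (simp add: isCont_def LIM_zero_iff)
qed

text \<open>Rescaled functions are controlled only on discs that grow with \<open>n\<close>, so the
  bound is assumed eventually for each radius. It makes the maps into the unit sphere uniformly
  Lipschitz there, and a diagonal sequence serves all radii at once.\<close>

lemma spherical_arzela_ascoli:
  assumes F: "\<And>n. chart_analytic (F n)" and C: "C \<ge> 0"
    and bd: "\<And>R. \<forall>\<^sub>F n in sequentially. spherical_deriv_le (F n) C (ball 0 R)"
  obtains r p where "strict_mono (r :: nat \<Rightarrow> nat)"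
    "\<And>R. uniform_limit (ball 0 R) (\<lambda>n z. stereo (to_sphere (F (r n)) z)) (\<lambda>z. stereo (p z)) sequentially"
    "\<And>z w. norm (stereo (p z) - stereo (p w)) \<le> 2 * C * norm (z - w)"
proof -
  define T where "T = (\<lambda>n z. stereo (to_sphere (F n) z))"
  have lip: "\<forall>\<^sub>F n in sequentially. \<forall>z\<in>ball 0 R. \<forall>w\<in>ball 0 R. norm (T n z - T n w) \<le> 2 * C * norm (z - w)" for R
    using bd[of R] by eventually_elim (auto simp: T_def intro!: spherical_lipschitz[OF F open_ball convex_ball _ C])
  have equi: "\<exists>d>0. \<forall>n y. norm (x - y) < d \<longrightarrow> norm (T n x - T n y) < e" if e: "e > 0" for x e
  proof -
    \<comment> \<open>Equicontinuity must cover every index: from \<open>N\<close> on the Lipschitz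
      bound applies, and the finitely many earlier maps are each continuous.\<close>
    obtain N where N: "\<And>n z w. n \<ge> N \<Longrightarrow> z \<in> ball 0 (norm x + 1) \<Longrightarrow> w \<in> ball 0 (norm x + 1)
        \<Longrightarrow> norm (T n z - T n w) \<le> 2 * C * norm (z - w)"
      using lip[of "norm x + 1"] unfolding eventually_sequentially by blast
    have "\<forall>\<^sub>F y in nhds x. dist (T n y) (T n x) < e" for n
      using isCont_stereo_to_sphere[OF F[of n], of x] e
      unfolding T_def isCont_def tendsto_iff by (auto simp: eventually_nhds_conv_at)
    hence "\<forall>\<^sub>F y in nhds x. \<forall>n\<in>{..<N}. dist (T n y) (T n x) < e"
      by (intro eventually_ball_finite) auto
    then obtain d where d: "d > 0" "\<And>y n. dist y x < d \<Longrightarrow> n < N \<Longrightarrow> dist (T n y) (T n x) < e"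
      unfolding eventually_nhds_metric by auto
    define d' where "d' = min d (min 1 (e / (2 * C + 1)))"
    have d'0: "d' > 0" using d e C by (auto simp: d'_def)
    have "norm (T n x - T n y) < e" if y: "norm (x - y) < d'" for n y
    proof (cases "n < N")
      case True
      thus ?thesis using d(2)[of y n] y by (simp add: d'_def dist_norm norm_minus_commute)
    next
      case False
      have "norm y \<le> norm x + norm (x - y)" by (metis norm_minus_commute norm_triangle_sub)
      hence "norm (T n x - T n y) \<le> 2 * C * norm (x - y)" using False y by (intro N) (auto simp: d'_def)
      also have "\<dots> \<le> (2 * C + 1) * norm (x - y)" by (intro mult_right_mono) auto
      also have "\<dots> < (2 * C + 1) * (e / (2 * C + 1))" using y C by (intro mult_strict_left_mono) (auto simp: d'_def)
      also have "\<dots> = e" using C by simp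
      finally show ?thesis .
    qed
    thus ?thesis using d'0 by blast
  qed
  define P where "P = (\<lambda>(i::nat) r. \<exists>g. uniform_limit (cball (0::complex) (real i)) (\<lambda>n. T (r n)) g sequentially)"
  obtain k where k: "strict_mono (k :: nat \<Rightarrow> nat)" "\<And>i. P i (id \<circ> k)"
  proof (rule subsequence_diagonalization_lemma[of P id])
    fix i :: nat and r :: "nat \<Rightarrow> nat"
    obtain g k where "strict_mono (k :: nat \<Rightarrow> nat)"
      "\<And>e. 0 < e \<Longrightarrow> \<exists>N. \<forall>n x. n \<ge> N \<and> x \<in> cball 0 (real i) \<longrightarrow> norm (T (r (k n)) x - g x) < e"
    proof (rule Arzela_Ascoli[of "cball 0 (real i)" "\<lambda>n. T (r n)" 1])
      show "\<exists>d>0. \<forall>n y. y \<in> cball 0 (real i) \<and> norm (x - y) < d \<longrightarrow> norm (T (r n) x - T (r n) y) < e"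
        if "0 < e" for x e using equi[OF that] by blast
    qed (auto simp: T_def norm_stereo)
    thus "\<exists>k. strict_mono k \<and> P i (r \<circ> k)"
      unfolding P_def uniform_limit_sequentially_iff o_def dist_norm by blast
  next
    fix i N and r k1 k2 :: "nat \<Rightarrow> nat"
    assume "P i (r \<circ> k1)" and k2: "\<And>j. N \<le> j \<Longrightarrow> \<exists>j'. j \<le> j' \<and> k2 j = k1 j'"
    then obtain g where g: "\<And>e. e > 0 \<Longrightarrow> \<exists>M. \<forall>n\<ge>M. \<forall>x\<in>cball 0 (real i). dist (T (r (k1 n)) x) (g x) < e"
      unfolding P_def uniform_limit_sequentially_iff by auto
    have "\<exists>M. \<forall>n\<ge>M. \<forall>x\<in>cball 0 (real i). dist (T (r (k2 n)) x) (g x) < e" if "e > 0" for e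
    proof -
      obtain M where M: "\<forall>n\<ge>M. \<forall>x\<in>cball 0 (real i). dist (T (r (k1 n)) x) (g x) < e" using g[OF \<open>e > 0\<close>] by blast
      have "\<forall>x\<in>cball 0 (real i). dist (T (r (k2 n)) x) (g x) < e" if "n \<ge> max M N" for n
        using k2[of n] M that by (metis max.bounded_iff order_trans)
      thus ?thesis by blast
    qed
    thus "P i (r \<circ> k2)" unfolding P_def uniform_limit_sequentially_iff by auto
  qed blast
  define g where "g = (\<lambda>z. lim (\<lambda>n. T (k n) z))"
  have ul: "uniform_limit (cball 0 (real i)) (\<lambda>n. T (k n)) g sequentially" for i
  proof -
    obtain gi where gi: "uniform_limit (cball 0 (real i)) (\<lambda>n. T (k n)) gi sequentially"
      using k(2)[of i] by (auto simp: P_def)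
    have "gi z = g z" if "z \<in> cball 0 (real i)" for z
      using tendsto_uniform_limitI[OF gi that] by (simp add: g_def limI)
    thus ?thesis using gi by (metis (mono_tags, lifting) uniform_limit_cong')
  qed
  have ulb: "uniform_limit (ball 0 R) (\<lambda>n. T (k n)) g sequentially" for R
  proof -
    have "ball 0 R \<subseteq> cball (0::complex) (real (nat \<lceil>R\<rceil>))" by (auto, linarith)
    thus ?thesis using ul uniform_limit_on_subset by blast
  qed
  have lim: "(\<lambda>n. T (k n) z) \<longlonglongrightarrow> g z" for z
    by (rule tendsto_uniform_limitI[OF ulb[of "norm z + 1"]]) auto
  \<comment> \<open>The limit stays on the unit sphere, hence in the range of
    \<open>stereo\<close>.\<close>
  have "norm (g z) = 1" for z
    using tendsto_norm[OF lim[of z]] by (simp add: T_def norm_stereo LIMSEQ_const_iff)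
  hence "\<exists>q. stereo q = g z" for z by (metis stereo_surj)
  then obtain p where p: "\<And>z. stereo (p z) = g z" by metis
  show thesis
  proof (rule that[OF k(1)])
    show "uniform_limit (ball 0 R) (\<lambda>n z. stereo (to_sphere (F (k n)) z)) (\<lambda>z. stereo (p z)) sequentially" for R
      using ulb[of R] by (simp add: p T_def)
    fix z w
    have "\<forall>\<^sub>F n in sequentially. norm (T n z - T n w) \<le> 2 * C * norm (z - w)"
      using lip[of "norm z + norm w + 1"] by eventually_elim (auto simp: add_strict_increasing2 intro: le_less_trans)
    hence "\<forall>\<^sub>F n in sequentially. norm (T (k n) z - T (k n) w) \<le> 2 * C * norm (z - w)"
      using eventually_subseq[OF k(1)] by blast
    thus "norm (stereo (p z) - stereo (p w)) \<le> 2 * C * norm (z - w)"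
      unfolding p by (rule tendsto_upperbound[OF tendsto_norm[OF tendsto_diff[OF lim lim]]]) auto
  qed
qed

text \<open>Away from infinity the chordal and the Euclidean distance are comparable, so near a
  finite value of the limit, chordal convergence becomes ordinary uniform convergence of functions
  that are eventually analytic.\<close>

lemma chart_limit_finite:
  assumes F: "\<And>n. chart_analytic (F n)" and d: "d > 0"
    and ul: "uniform_limit (ball z d) (\<lambda>n w. stereo (to_sphere (F n) w)) (\<lambda>w. stereo (p w)) sequentially"
    and cont: "isCont (\<lambda>w. stereo (p w)) z" and pz: "p z = Fin c"
  obtains \<delta> u where "\<delta> > 0" "\<delta> \<le> d" "u holomorphic_on ball z \<delta>"
    "\<forall>\<^sub>F n in sequentially. F n analytic_on ball z \<delta>"
    "uniform_limit (ball z \<delta>) F u sequentially" "\<And>w. w \<in> ball z \<delta> \<Longrightarrow> p w = Fin (u w)"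
proof -
  define I where "I = stereo Infty"
  \<comment> \<open>\<open>p z\<close> is at distance \<open>2 * \<kappa>\<close> from infinity.
    Moving to \<open>p w\<close> costs at most \<open>\<kappa> / 2\<close>, and so does passing to
    \<open>F n w\<close>. A distance of at least \<open>\<kappa>\<close> remains, which bounds the
    modulus by \<open>2 / \<kappa>\<close>.\<close>
  define \<kappa> where "\<kappa> = norm (stereo (Fin c) - I) / 2"
  have sq: "sqrt (1 + (norm x)\<^sup>2) > 0" for x :: complex by (simp add: add_pos_nonneg)
  have \<kappa>: "\<kappa> > 0" using sq[of c] by (simp add: \<kappa>_def I_def norm_stereo_diff_Infty del: stereo.simps)
  define B where "B = 2 / \<kappa>"
  have B: "B > 0" using \<kappa> by (simp add: B_def)
  have far: "\<exists>x. q = Fin x \<and> sqrt (1 + (norm x)\<^sup>2) \<le> B" if "norm (stereo q - I) \<ge> \<kappa>" for q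
  proof (cases q)
    case (Fin x)
    have "\<kappa> \<le> 2 / sqrt (1 + (norm x)\<^sup>2)" using that by (simp add: Fin I_def norm_stereo_diff_Infty del: stereo.simps)
    thus ?thesis using sq[of x] \<kappa> Fin by (simp add: B_def field_simps)
  next
    case Infty
    thus ?thesis using that \<kappa> by (simp add: I_def)
  qed
  have "\<forall>\<^sub>F w in at z. dist (stereo (p w)) (stereo (p z)) < \<kappa> / 2"
    using cont \<kappa> unfolding isCont_def tendsto_iff by (metis half_gt_zero)
  then obtain d1 where d1: "d1 > 0" "\<And>w. dist w z < d1 \<Longrightarrow> dist (stereo (p w)) (stereo (p z)) < \<kappa> / 2"
    unfolding eventually_at using \<kappa> by (metis UNIV_I dist_self half_gt_zero)
  define \<rho> where "\<rho> = min d d1"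
  have \<rho>: "\<rho> > 0" "\<rho> \<le> d" "\<rho> \<le> d1" using d d1 by (auto simp: \<rho>_def)
  have pfar: "norm (stereo (p w) - I) \<ge> 3 / 2 * \<kappa>" if "w \<in> ball z \<rho>" for w
  proof -
    have "norm (stereo (p z) - I) \<le> norm (stereo (p z) - stereo (p w)) + norm (stereo (p w) - I)"
      by (rule norm_diff_triangle_le[OF order_refl order_refl])
    thus ?thesis using d1(2)[of w] that \<rho> by (simp add: pz \<kappa>_def dist_norm norm_minus_commute del: stereo.simps)
  qed
  define u where "u = (\<lambda>w. case p w of Fin x \<Rightarrow> x | Infty \<Rightarrow> 0)"
  have pu: "p w = Fin (u w)" "sqrt (1 + (norm (u w))\<^sup>2) \<le> B" if "w \<in> ball z \<rho>" for w
    using far[of "p w"] pfar[OF that] \<kappa> by (auto simp: u_def)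
  have ulr: "uniform_limit (ball z \<rho>) (\<lambda>n w. stereo (to_sphere (F n) w)) (\<lambda>w. stereo (p w)) sequentially"
    using \<rho> by (intro uniform_limit_on_subset[OF ul]) auto
  have evF: "\<forall>\<^sub>F n in sequentially. \<forall>w\<in>ball z \<rho>. F n analytic_on {w} \<and> sqrt (1 + (norm (F n w))\<^sup>2) \<le> B"
    using uniform_limitD[OF ulr half_gt_zero[OF \<kappa>]]
  proof eventually_elim
    case (elim n)
    show ?case
    proof
      fix w assume w: "w \<in> ball z \<rho>"
      have "norm (stereo (p w) - I) \<le> norm (stereo (p w) - stereo (to_sphere (F n) w)) + norm (stereo (to_sphere (F n) w) - I)"
        by (rule norm_diff_triangle_le[OF order_refl order_refl])
      hence "norm (stereo (to_sphere (F n) w) - I) \<ge> \<kappa>"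
        using elim[rule_format, OF w] pfar[OF w]
        by (simp only: dist_norm norm_minus_commute[of "stereo (p w)" "stereo (to_sphere (F n) w)"])
      from far[OF this] show "F n analytic_on {w} \<and> sqrt (1 + (norm (F n w))\<^sup>2) \<le> B"
        by (auto simp: to_sphere_chart_analytic F split: if_splits)
    qed
  qed
  have ulF: "uniform_limit (ball z \<rho>) F u sequentially"
  proof (rule uniform_limitI)
    fix e :: real assume e: "e > 0"
    hence "2 * e / B\<^sup>2 > 0" using B by simp
    from uniform_limitD[OF ulr this] evF
    show "\<forall>\<^sub>F n in sequentially. \<forall>w\<in>ball z \<rho>. dist (F n w) (u w) < e"
    proof eventually_elim
      case (elim n)
      show ?case
      proof
        fix w assume w: "w \<in> ball z \<rho>"
        let ?s = "sqrt (1 + (norm (F n w))\<^sup>2) * sqrt (1 + (norm (u w))\<^sup>2)"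
        have s: "?s > 0" "?s \<le> B * B" using sq elim(2) w pu(2)[OF w] B by (auto intro!: mult_mono)
        have "2 * norm (F n w - u w) / ?s < 2 * e / B\<^sup>2"
          using elim(1)[rule_format, OF w] elim(2)[rule_format, OF w] pu(1)[OF w]
          by (simp add: to_sphere_chart_analytic F dist_norm norm_stereo_diff del: stereo.simps)
        hence "norm (F n w - u w) < e / B\<^sup>2 * ?s"
          unfolding pos_divide_less_eq[OF s(1)] by (simp only: times_divide_eq_left times_divide_eq_right mult.assoc)
        also have "\<dots> \<le> e / B\<^sup>2 * (B * B)" using s e B by (intro mult_left_mono) auto
        also have "\<dots> = e" using B by (simp add: power2_eq_square)
        finally show "dist (F n w) (u w) < e" by (simp add: dist_norm)
      qed
    qed
  qed
  have evA: "\<forall>\<^sub>F n in sequentially. F n analytic_on ball z \<rho>"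
    using evF by eventually_elim (use analytic_on_analytic_at in blast)
  \<comment> \<open>The smaller radius provides continuity up to the closed disc for the theorem on
    uniform limits.\<close>
  define \<delta> where "\<delta> = \<rho> / 2"
  have sub: "cball z \<delta> \<subseteq> ball z \<rho>" "ball z \<delta> \<subseteq> ball z \<rho>" using \<rho> by (auto simp: \<delta>_def)
  have evh: "\<forall>\<^sub>F n in sequentially. continuous_on (cball z \<delta>) (F n) \<and> F n holomorphic_on ball z \<delta>"
    using evA
  proof eventually_elim
    case (elim n)
    hence "F n holomorphic_on ball z \<rho>" by (rule analytic_imp_holomorphic)
    thus ?case using sub holomorphic_on_subset holomorphic_on_imp_continuous_on by meson
  qed
  obtain "continuous_on (cball z \<delta>) u" "u holomorphic_on ball z \<delta>"
    by (rule holomorphic_uniform_limit[OF evh uniform_limit_on_subset[OF ulF sub(1)]]) auto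
  moreover have "\<forall>\<^sub>F n in sequentially. F n analytic_on ball z \<delta>"
    using evA by eventually_elim (use sub analytic_on_subset in blast)
  ultimately show thesis
    using \<rho> sub pu(1) by (intro that[of \<delta> u] uniform_limit_on_subset[OF ulF]) (auto simp: \<delta>_def)
qed

text \<open>Inversion reduces this to the finite chart, once zeros of \<open>F n\<close> have been
  excluded near \<open>z\<close>.\<close>

lemma chart_limit_Infty:
  assumes F: "\<And>n. chart_analytic (F n)" and d: "d > 0"
    and ul: "uniform_limit (ball z d) (\<lambda>n w. stereo (to_sphere (F n) w)) (\<lambda>w. stereo (p w)) sequentially"
    and cont: "isCont (\<lambda>w. stereo (p w)) z" and pz: "p z = Infty"
  obtains \<delta> v where "\<delta> > 0" "\<delta> \<le> d" "v holomorphic_on ball z \<delta>"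
    "\<forall>\<^sub>F n in sequentially. (\<lambda>w. inverse (F n w)) analytic_on ball z \<delta> \<and>
        (\<forall>w\<in>ball z \<delta>. F n analytic_on {w} \<longrightarrow> F n w \<noteq> 0)"
    "uniform_limit (ball z \<delta>) (\<lambda>n w. inverse (F n w)) v sequentially"
    "\<And>w. w \<in> ball z \<delta> \<Longrightarrow> p w = sphere_inv (Fin (v w))"
proof -
  have "\<forall>\<^sub>F w in at z. dist (stereo (p w)) (stereo (p z)) < 1"
    using cont unfolding isCont_def tendsto_iff by (metis zero_less_one)
  then obtain d1 where d1: "d1 > 0" "\<And>w. dist w z < d1 \<Longrightarrow> dist (stereo (p w)) (stereo (p z)) < 1"
    unfolding eventually_at by (metis UNIV_I dist_self zero_less_one)
  define \<rho> where "\<rho> = min d d1"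
  have \<rho>: "\<rho> > 0" "\<rho> \<le> d" "\<rho> \<le> d1" using d d1 by (auto simp: \<rho>_def)
  have ulr: "uniform_limit (ball z \<rho>) (\<lambda>n w. stereo (to_sphere (F n) w)) (\<lambda>w. stereo (p w)) sequentially"
    using \<rho> by (intro uniform_limit_on_subset[OF ul]) auto
  \<comment> \<open>0 and infinity are antipodal, at the greatest possible distance 2. Staying
    within less than 2 of infinity therefore excludes the value 0.\<close>
  have "norm (stereo (Fin 0) - stereo Infty) = 2" unfolding norm_stereo_diff_Infty by simp
  have ev0: "\<forall>\<^sub>F n in sequentially. \<forall>w\<in>ball z \<rho>. to_sphere (F n) w \<noteq> Fin 0"
    using uniform_limitD[OF ulr zero_less_one]
  proof eventually_elim
    case (elim n)
    have "dist (stereo (to_sphere (F n) w)) (stereo Infty) < 2" if "w \<in> ball z \<rho>" for w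
      using elim[rule_format, OF that] d1(2)[of w] that \<rho> dist_triangle[of "stereo (to_sphere (F n) w)" "stereo Infty" "stereo (p w)"]
      by (simp add: pz dist_commute del: stereo.simps)
    thus ?case using \<open>norm _ = 2\<close> by (metis dist_norm less_irrefl)
  qed
  define G where "G = (\<lambda>n w. inverse (F n w))"
  have G: "chart_analytic (G n)" for n using chart_analytic_inverse[OF F] by (simp add: G_def)
  have ulG: "uniform_limit (ball z \<rho>) (\<lambda>n w. stereo (to_sphere (G n) w)) (\<lambda>w. stereo (sphere_inv (p w))) sequentially"
  proof (rule uniform_limitI)
    fix e :: real assume "e > 0"
    from uniform_limitD[OF ulr this] ev0
    show "\<forall>\<^sub>F n in sequentially. \<forall>w\<in>ball z \<rho>. dist (stereo (to_sphere (G n) w)) (stereo (sphere_inv (p w))) < e"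
      by eventually_elim (auto simp: G_def to_sphere_inverse[OF F] dist_norm norm_stereo_sphere_inv)
  qed
  have contG: "isCont (\<lambda>w. stereo (sphere_inv (p w))) z"
    using cont unfolding isCont_def tendsto_iff dist_norm norm_stereo_sphere_inv .
  obtain \<delta> v where v: "\<delta> > 0" "\<delta> \<le> \<rho>" "v holomorphic_on ball z \<delta>"
    "\<forall>\<^sub>F n in sequentially. G n analytic_on ball z \<delta>"
    "uniform_limit (ball z \<delta>) G v sequentially" "\<And>w. w \<in> ball z \<delta> \<Longrightarrow> sphere_inv (p w) = Fin (v w)"
    by (rule chart_limit_finite[OF G \<rho>(1) ulG contG]) (auto simp: pz)
  show thesis
  proof (rule that[OF v(1) order_trans[OF v(2) \<rho>(2)] v(3)])
    show "\<forall>\<^sub>F n in sequentially. (\<lambda>w. inverse (F n w)) analytic_on ball z \<delta> \<and>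
        (\<forall>w\<in>ball z \<delta>. F n analytic_on {w} \<longrightarrow> F n w \<noteq> 0)"
      using v(4) ev0
    proof eventually_elim
      case (elim n)
      have "F n w \<noteq> 0" if "w \<in> ball z \<delta>" "F n analytic_on {w}" for w
        using elim(2)[rule_format, of w] that v(2) by (simp add: to_sphere_chart_analytic[OF F])
      thus ?case using elim(1) by (auto simp: G_def)
    qed
    show "uniform_limit (ball z \<delta>) (\<lambda>n w. inverse (F n w)) v sequentially" using v(5) by (simp add: G_def)
    show "p w = sphere_inv (Fin (v w))" if "w \<in> ball z \<delta>" for w
      using v(6)[OF that] by (metis sphere_inv_inv)
  qed
qed

section \<open>Properties inherited by spherical limits\<close>

text \<open>Hurwitz's theorem read backwards: a limit of zero-free functions that has a zero is
  constant, hence 0. The shift by \<open>N\<close> in the proof discards the indices at which the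
  functions may still have zeros.\<close>

lemma Hurwitz_ball:
  assumes ev: "\<forall>\<^sub>F n in sequentially. H n holomorphic_on ball z \<delta> \<and> (\<forall>w\<in>ball z \<delta>. H n w \<noteq> 0)"
    and u: "u holomorphic_on ball z \<delta>" and ul: "uniform_limit (ball z \<delta>) H u sequentially"
    and w: "w \<in> ball z \<delta>" "u w = 0" and x: "x \<in> ball z \<delta>"
  shows "u x = 0"
proof (cases "u constant_on ball z \<delta>")
  case True
  thus ?thesis using w x by (auto simp: constant_on_def)
next
  case False
  obtain N where N: "\<And>n. n \<ge> N \<Longrightarrow> H n holomorphic_on ball z \<delta>" "\<And>n w. n \<ge> N \<Longrightarrow> w \<in> ball z \<delta> \<Longrightarrow> H n w \<noteq> 0"
    using ev unfolding eventually_sequentially by blast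
  have "u w \<noteq> 0"
  proof (rule Hurwitz_no_zeros[of "ball z \<delta>" "\<lambda>n. H (n + N)" u])
    fix K assume "K \<subseteq> ball z \<delta>"
    hence "uniform_limit K H u sequentially" by (rule uniform_limit_on_subset[OF ul])
    thus "uniform_limit K (\<lambda>n. H (n + N)) u sequentially"
      by (rule filterlim_compose[OF _ filterlim_add_const_nat_at_top])
  qed (use N u False w in auto)
  thus ?thesis using w by blast
qed

lemma uniform_limit_deriv_ball:
  fixes u :: "complex \<Rightarrow> complex"
  assumes ev: "\<forall>\<^sub>F n in sequentially. H n holomorphic_on ball z \<delta>"
    and u: "u holomorphic_on ball z \<delta>" and ul: "uniform_limit (ball z \<delta>) H u sequentially"
  shows "uniform_limit (ball z (\<delta> / 2)) (\<lambda>n. deriv (H n)) (deriv u) sequentially"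
proof (cases "\<delta> > 0")
  case True
  show ?thesis
  proof (rule uniform_limitI)
    fix e :: real assume e: "e > 0"
    \<comment> \<open>Cauchy's estimate on circles of radius \<open>\<delta> / 4\<close> turns this
      tolerance into \<open>e / 2\<close>.\<close>
    hence "e * (\<delta> / 8) > 0" using True by simp
    from uniform_limitD[OF ul this] ev
    show "\<forall>\<^sub>F n in sequentially. \<forall>w\<in>ball z (\<delta> / 2). dist (deriv (H n) w) (deriv u w) < e"
    proof eventually_elim
      case (elim n)
      show ?case
      proof
        fix w assume w: "w \<in> ball z (\<delta> / 2)"
        have sub: "cball w (\<delta> / 4) \<subseteq> ball z \<delta>"
        proof
          fix x assume "x \<in> cball w (\<delta> / 4)"
          thus "x \<in> ball z \<delta>" using w dist_triangle[of z x w] True by simp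
        qed
        have sub': "ball w (\<delta> / 4) \<subseteq> ball z \<delta>" using sub ball_subset_cball by blast
        have hol: "(\<lambda>x. H n x - u x) holomorphic_on ball z \<delta>" using elim u by (intro holomorphic_intros) auto
        have "norm ((deriv ^^ 1) (\<lambda>x. H n x - u x) w) \<le> fact 1 * (e * (\<delta> / 8)) / (\<delta> / 4) ^ 1"
        proof (rule Cauchy_inequality)
          fix x assume "norm (w - x) = \<delta> / 4"
          hence "x \<in> ball z \<delta>" using sub by (auto simp: dist_norm)
          thus "norm (H n x - u x) \<le> e * (\<delta> / 8)" using elim by (force simp: dist_norm)
        qed (use hol sub sub' True in \<open>auto intro: holomorphic_on_subset intro!: holomorphic_on_imp_continuous_on\<close>)
        hence "norm (deriv (\<lambda>x. H n x - u x) w) < e" using True e by simp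
        moreover have "w \<in> ball z \<delta>" using w True by auto
        hence "H n field_differentiable at w" "u field_differentiable at w"
          using elim(2) u by (auto intro: holomorphic_on_imp_differentiable_at)
        ultimately show "dist (deriv (H n) w) (deriv u w) < e" by (simp add: dist_norm)
      qed
    qed
  qed
qed (simp add: ball_empty)

lemma eventually_nhds_nonzero:
  fixes f :: "complex \<Rightarrow> complex"
  shows "isCont f x \<Longrightarrow> f x \<noteq> 0 \<Longrightarrow> \<forall>\<^sub>F y in nhds x. f y \<noteq> 0"
  unfolding isCont_def eventually_nhds_conv_at using tendsto_imp_eventually_ne by blast

text \<open>The quotient extends holomorphically over the simple zeros of the denominator.\<close>

lemma maximum_modulus_quotient:
  assumes num: "num holomorphic_on S" and den: "den holomorphic_on S" and S: "open S" "cball z s \<subseteq> S"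
    and zeros: "\<And>w. w \<in> S \<Longrightarrow> den w = 0 \<Longrightarrow> num w = 0 \<and> deriv den w \<noteq> 0"
    and bd: "\<And>w. norm (w - z) = s \<Longrightarrow> norm (num w) \<le> B * norm (den w) \<and> den w \<noteq> 0"
    and w: "w \<in> ball z s"
  shows "norm (num w) \<le> B * norm (den w)"
proof -
  define q where "q = (\<lambda>w. if den w = 0 then deriv num w / deriv den w else num w / den w)"
  have an: "q analytic_on {x}" if x: "x \<in> S" for x
  proof (cases "den x = 0")
    case False
    have "isCont den x" using den x S(1) by (meson continuous_on_eq_continuous_at holomorphic_on_imp_continuous_on)
    hence "\<forall>\<^sub>F y in nhds x. den y \<noteq> 0" using False by (rule eventually_nhds_nonzero)
    hence "\<forall>\<^sub>F y in nhds x. q y = num y / den y" by eventually_elim (simp add: q_def)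
    moreover have "(\<lambda>y. num y / den y) analytic_on {x}"
      using num den x S(1) False by (intro analytic_on_divide) (auto simp: analytic_at)
    ultimately show ?thesis using analytic_at_cong by metis
  next
    case True
    note zx = zeros[OF x True]
    \<comment> \<open>At a common zero both functions are divided by \<open>y - x\<close>. The
      divided differences extend holomorphically, and that of \<open>den\<close> takes the value
      \<open>deriv den x \<noteq> 0\<close>.\<close>
    define n1 where "n1 = (\<lambda>y. if y = x then deriv num x else (num y - num x) / (y - x))"
    define d1 where "d1 = (\<lambda>y. if y = x then deriv den x else (den y - den x) / (y - x))"
    have hol: "n1 holomorphic_on S" "d1 holomorphic_on S" unfolding n1_def d1_def
      using x S(1) num den by (auto intro!: pole_lemma simp: interior_open)
    have d1x: "d1 x \<noteq> 0" using zx by (simp add: d1_def)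
    have "isCont d1 x" using hol(2) x S(1) by (meson continuous_on_eq_continuous_at holomorphic_on_imp_continuous_on)
    hence "\<forall>\<^sub>F y in nhds x. d1 y \<noteq> 0" using d1x by (rule eventually_nhds_nonzero)
    hence "\<forall>\<^sub>F y in nhds x. q y = n1 y / d1 y"
      by eventually_elim (use zx True in \<open>auto simp: q_def n1_def d1_def\<close>)
    moreover have "(\<lambda>y. n1 y / d1 y) analytic_on {x}"
      using hol x S(1) d1x by (intro analytic_on_divide) (auto simp: analytic_at)
    ultimately show ?thesis using analytic_at_cong by metis
  qed
  hence "q analytic_on S" using analytic_on_analytic_at by blast
  hence hq: "q holomorphic_on S" by (rule analytic_imp_holomorphic)
  have s: "s > 0" using w by (metis ball_empty empty_iff not_le)
  have "norm (q w) \<le> B"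
  proof (rule maximum_modulus_frontier[of q "ball z s"])
    show "q holomorphic_on interior (ball z s)"
      by (rule holomorphic_on_subset[OF hq]) (use S(2) in auto)
    show "continuous_on (closure (ball z s)) q"
      using hq S(2) s by (auto intro: holomorphic_on_subset holomorphic_on_imp_continuous_on)
    fix x assume "x \<in> frontier (ball z s)"
    hence "norm (x - z) = s" using s by (simp add: dist_norm norm_minus_commute)
    from bd[OF this] show "norm (q x) \<le> B" by (simp add: q_def norm_divide divide_le_eq)
  qed (use w in auto)
  moreover have "w \<in> S" using w S(2) by auto
  ultimately show ?thesis using zeros[of w] by (cases "den w = 0") (auto simp: q_def norm_divide divide_le_eq)
qed

text \<open>A Gronwall argument: on a disc with \<open>\<rho> * |B| \<le> 1/2\<close> the mean value
  inequality bounds the maximum of \<open>|v|\<close> by half of itself.\<close>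

lemma deriv_le_imp_zero:
  fixes v :: "complex \<Rightarrow> complex"
  assumes v: "v holomorphic_on ball z s" and s: "s > 0" and z: "v z = 0"
    and bd: "\<And>w. w \<in> ball z s \<Longrightarrow> norm (deriv v w) \<le> B * norm (v w)"
  shows "\<forall>\<^sub>F w in nhds z. v w = 0"
proof -
  define \<rho> where "\<rho> = min (s / 2) (1 / (2 * (\<bar>B\<bar> + 1)))"
  have \<rho>: "\<rho> > 0" "\<rho> < s" "\<rho> * \<bar>B\<bar> \<le> 1 / 2"
  proof -
    show "\<rho> > 0" "\<rho> < s" using s by (auto simp: \<rho>_def)
    have "\<rho> * \<bar>B\<bar> \<le> 1 / (2 * (\<bar>B\<bar> + 1)) * (\<bar>B\<bar> + 1)" by (intro mult_mono) (auto simp: \<rho>_def)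
    also have "\<dots> = 1 / 2" by (simp add: field_simps add_pos_nonneg)
    finally show "\<rho> * \<bar>B\<bar> \<le> 1 / 2" .
  qed
  have sub: "cball z \<rho> \<subseteq> ball z s" using \<rho> by auto
  have "continuous_on (cball z \<rho>) (\<lambda>w. norm (v w))"
    using v sub by (intro continuous_on_norm holomorphic_on_imp_continuous_on) (rule holomorphic_on_subset)
  then obtain w1 where w1: "w1 \<in> cball z \<rho>" "\<And>w. w \<in> cball z \<rho> \<Longrightarrow> norm (v w) \<le> norm (v w1)"
    using continuous_attains_sup[of "cball z \<rho>" "\<lambda>w. norm (v w)"] \<rho>(1) by auto
  have "norm (v w1 - v z) \<le> \<bar>B\<bar> * norm (v w1) * norm (w1 - z)"
  proof (rule field_differentiable_bound[of "cball z \<rho>"])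
    fix w assume w: "w \<in> cball z \<rho>"
    hence ws: "w \<in> ball z s" using sub by blast
    show "(v has_field_derivative deriv v w) (at w within cball z \<rho>)"
      using holomorphic_derivI[OF v open_ball ws] has_field_derivative_at_within by blast
    have "norm (deriv v w) \<le> \<bar>B\<bar> * norm (v w)"
      using bd[OF ws] by (meson abs_ge_self mult_right_mono norm_ge_zero order_trans)
    also have "\<dots> \<le> \<bar>B\<bar> * norm (v w1)" using w1(2)[OF w] by (intro mult_left_mono) auto
    finally show "norm (deriv v w) \<le> \<bar>B\<bar> * norm (v w1)" .
  qed (use w1 \<rho> in auto)
  also have "\<dots> \<le> \<bar>B\<bar> * norm (v w1) * \<rho>"
    using w1(1) by (intro mult_left_mono) (auto simp: dist_norm norm_minus_commute)
  also have "\<dots> = \<rho> * \<bar>B\<bar> * norm (v w1)" by simp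
  also have "\<dots> \<le> 1 / 2 * norm (v w1)" using \<rho>(3) by (intro mult_right_mono) auto
  finally have "norm (v w1) = 0" using z norm_ge_zero[of "v w1"] by simp
  hence "\<And>w. w \<in> ball z \<rho> \<Longrightarrow> v w = 0" using w1(2) by (metis ball_subset_cball norm_le_zero_iff subsetD)
  thus ?thesis using \<rho>(1) eventually_nhds_in_open[of "ball z \<rho>" z] by (auto elim!: eventually_mono)
qed

text \<open>The setting after passing to a subsequence. Continuity of the limit is what puts a whole
  neighbourhood of each point into a single chart.\<close>

locale spherical_limit =
  fixes F :: "nat \<Rightarrow> complex \<Rightarrow> complex" and p :: "complex \<Rightarrow> riemann_sphere"
  assumes chart: "chart_analytic (F n)"
    and ul: "uniform_limit (ball 0 R) (\<lambda>n z. stereo (to_sphere (F n) z)) (\<lambda>z. stereo (p z)) sequentially"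
    and cont: "isCont (\<lambda>w. stereo (p w)) z"
begin

lemma ul_ball: "uniform_limit (ball z 1) (\<lambda>n z. stereo (to_sphere (F n) z)) (\<lambda>z. stereo (p z)) sequentially"
proof (rule uniform_limit_on_subset[OF ul])
  show "ball z 1 \<subseteq> ball 0 (norm z + 1)"
    by (auto simp: dist_norm) (metis add.commute add_less_cancel_left le_less_trans norm_minus_commute norm_triangle_sub)
qed

lemma finite_chart:
  assumes "p z = Fin c"
  obtains \<delta> u where "\<delta> > 0" "u holomorphic_on ball z \<delta>"
    "\<forall>\<^sub>F n in sequentially. F n analytic_on ball z \<delta>"
    "uniform_limit (ball z \<delta>) F u sequentially" "\<And>w. w \<in> ball z \<delta> \<Longrightarrow> p w = Fin (u w)"
  by (rule chart_limit_finite[OF chart zero_less_one ul_ball cont assms]) (rule that)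

lemma infinite_chart:
  assumes "p z = Infty"
  obtains \<delta> v where "\<delta> > 0" "v holomorphic_on ball z \<delta>"
    "\<forall>\<^sub>F n in sequentially. (\<lambda>w. inverse (F n w)) analytic_on ball z \<delta> \<and>
        (\<forall>w\<in>ball z \<delta>. F n analytic_on {w} \<longrightarrow> F n w \<noteq> 0)"
    "uniform_limit (ball z \<delta>) (\<lambda>n w. inverse (F n w)) v sequentially"
    "\<And>w. w \<in> ball z \<delta> \<Longrightarrow> p w = sphere_inv (Fin (v w))"
  by (rule chart_limit_Infty[OF chart zero_less_one ul_ball cont assms]) (rule that)

text \<open>The interior \<open>A\<close> of the set where \<open>p\<close> is infinite is also
  closed, because in the infinite chart the zeros of \<open>v\<close> are isolated unless
  \<open>v\<close> vanishes identically. The plane is connected.\<close>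

lemma isolated_or_all_Infty: "(\<forall>z. p z = Infty) \<or> (\<forall>z. \<forall>\<^sub>F w in at z. p w \<noteq> Infty)"
proof -
  define A where "A = {z. \<forall>\<^sub>F w in nhds z. p w = Infty}"
  have opA: "open A"
  proof (subst open_subopen, intro ballI)
    fix z assume "z \<in> A"
    hence "\<forall>\<^sub>F w in nhds z. w \<in> A" by (simp add: A_def eventually_eventually)
    thus "\<exists>T. open T \<and> z \<in> T \<and> T \<subseteq> A" by (auto simp: eventually_nhds)
  qed
  have notA: "\<forall>\<^sub>F w in at z. p w \<noteq> Infty" if z: "z \<notin> A" for z
  proof (cases "p z")
    case (Fin c)
    obtain \<delta> u where "\<delta> > 0" "\<And>w. w \<in> ball z \<delta> \<Longrightarrow> p w = Fin (u w)"
      by (rule finite_chart[OF Fin]) blast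
    thus ?thesis using eventually_at_in_open'[of "ball z \<delta>" z] by (auto elim!: eventually_mono)
  next
    case Infty
    obtain \<delta> v where v: "\<delta> > 0" "v holomorphic_on ball z \<delta>" "\<And>w. w \<in> ball z \<delta> \<Longrightarrow> p w = sphere_inv (Fin (v w))"
      by (rule infinite_chart[OF Infty]) blast
    have ev: "\<forall>\<^sub>F w in nhds z. w \<in> ball z \<delta>" using v(1) by (intro eventually_nhds_in_open) auto
    have "v analytic_on {z}" using v(1,2) by (meson analytic_at centre_in_ball open_ball)
    moreover have "\<not> (\<forall>\<^sub>F w in nhds z. v w = 0)"
    proof
      assume "\<forall>\<^sub>F w in nhds z. v w = 0"
      with ev have "\<forall>\<^sub>F w in nhds z. p w = Infty" by eventually_elim (simp add: v(3))
      thus False using z by (simp add: A_def)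
    qed
    ultimately have "\<forall>\<^sub>F w in at z. v w \<noteq> 0" using zero_free_or_zero by blast
    moreover have "\<forall>\<^sub>F w in at z. w \<in> ball z \<delta>" using ev by (simp add: eventually_nhds_conv_at)
    ultimately show ?thesis by eventually_elim (simp add: v(3))
  qed
  have "open (- A)"
  proof (subst open_subopen, intro ballI)
    fix z assume z: "z \<in> - A"
    obtain S where S: "open S" "z \<in> S" "\<forall>w\<in>S. w \<noteq> z \<longrightarrow> p w \<noteq> Infty"
      using notA[of z] z unfolding eventually_at_topological by auto
    have "w \<in> - A" if "w \<in> S" for w
      using S(3) that z unfolding A_def by (cases "w = z") (auto dest: eventually_nhds_x_imp_x)
    thus "\<exists>T. open T \<and> z \<in> T \<and> T \<subseteq> - A" using S by blast
  qed
  hence "A = {} \<or> A = UNIV" using opA by (metis UNIV_I clopen closed_def)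
  thus ?thesis
  proof
    assume "A = UNIV"
    hence "p z = Infty" for z using eventually_nhds_x_imp_x[of "\<lambda>w. p w = Infty" z] by (auto simp: A_def)
    thus ?thesis by blast
  qed (use notA in blast)
qed

lemma limit_meromorphic: "meromorphic_function p \<or> p = (\<lambda>_. Infty)"
proof (cases "\<forall>z. p z = Infty")
  case False
  hence iso: "\<forall>\<^sub>F w in at z. p w \<noteq> Infty" for z using isolated_or_all_Infty by blast
  \<comment> \<open>The default 0 at infinite values makes \<open>inverse (G w)\<close> agree with
    the chart function \<open>v\<close>.\<close>
  define G where "G = (\<lambda>z. case p z of Fin x \<Rightarrow> x | Infty \<Rightarrow> 0)"
  have fin: "G analytic_on {z}" if pz: "p z = Fin c" for z c
  proof -
    obtain \<delta> u where u: "\<delta> > 0" "u holomorphic_on ball z \<delta>" "\<And>w. w \<in> ball z \<delta> \<Longrightarrow> p w = Fin (u w)"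
      by (rule finite_chart[OF pz]) blast
    have "\<forall>\<^sub>F w in nhds z. w \<in> ball z \<delta>" using u(1) by (intro eventually_nhds_in_open) auto
    hence "\<forall>\<^sub>F w in nhds z. G w = u w" by eventually_elim (simp add: u(3) G_def)
    moreover have "u analytic_on {z}" using u(1,2) by (meson analytic_at centre_in_ball open_ball)
    ultimately show ?thesis using eventually_eq_imp_analytic by blast
  qed
  have inf: "(\<lambda>w. inverse (G w)) analytic_on {z} \<and> \<not> G analytic_on {z}" if pz: "p z = Infty" for z
  proof -
    obtain \<delta> v where v: "\<delta> > 0" "v holomorphic_on ball z \<delta>" "\<And>w. w \<in> ball z \<delta> \<Longrightarrow> p w = sphere_inv (Fin (v w))"
      by (rule infinite_chart[OF pz]) blast
    have "\<forall>\<^sub>F w in nhds z. w \<in> ball z \<delta>" using v(1) by (intro eventually_nhds_in_open) auto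
    hence ev: "\<forall>\<^sub>F w in nhds z. inverse (G w) = v w" by eventually_elim (auto simp: v(3) G_def)
    have van: "v analytic_on {z}" using v(1,2) by (meson analytic_at centre_in_ball open_ball)
    have vz: "v z = 0" using v(3)[of z] v(1) pz by (auto split: if_splits)
    \<comment> \<open>Near \<open>z\<close> one has \<open>G w * v w = 1\<close>, while
      \<open>v z = 0\<close>.\<close>
    have "\<not> G analytic_on {z}"
    proof
      assume "G analytic_on {z}"
      hence "((\<lambda>w. G w * v w) \<longlongrightarrow> G z * v z) (at z)"
        using analytic_at_imp_isCont[OF van] by (intro tendsto_mult) (auto simp: isCont_def dest: analytic_at_imp_isCont)
      moreover have "\<forall>\<^sub>F w in at z. G w * v w = 1"
      proof -
        have "\<forall>\<^sub>F w in at z. inverse (G w) = v w" using ev by (simp add: eventually_nhds_conv_at)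
        moreover have "\<forall>\<^sub>F w in at z. w \<in> ball z \<delta>" using v(1) by (intro eventually_at_in_open') auto
        ultimately show ?thesis using iso[of z] by eventually_elim (auto simp: v(3) G_def split: if_splits)
      qed
      hence "((\<lambda>w. G w * v w) \<longlongrightarrow> 1) (at z)" by (rule tendsto_eventually)
      ultimately have "G z * v z = 1" using tendsto_unique[OF at_neq_bot] by blast
      thus False using vz by simp
    qed
    thus ?thesis using eventually_eq_imp_analytic[OF ev van] by blast
  qed
  have cG: "chart_analytic G" unfolding chart_analytic_def
  proof
    fix z show "G analytic_on {z} \<or> (\<lambda>w. inverse (G w)) analytic_on {z}" by (cases "p z") (use fin inf in auto)
  qed
  have "G z = c" if "p z = Fin c" for z c using that by (simp add: G_def)
  hence "p z = to_sphere G z" for z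
    by (cases "p z") (use fin[of z] inf[of z] in \<open>auto simp: to_sphere_chart_analytic[OF cG]\<close>)
  hence "p = to_sphere G" by blast
  thus ?thesis using cG unfolding meromorphic_function_def nicely_meromorphic_iff_chart_analytic by blast
qed auto

text \<open>If \<open>p\<close> were infinite everywhere, \<open>1/F n\<close> would tend to 0 near
  0 together with its derivative. But that derivative has modulus
  \<open>|F n'(0)| / |F n(0)|^2\<close>, which stays above \<open>c\<close>.\<close>

lemma nondegenerate_not_Infty:
  assumes c: "c > 0" and nd: "\<And>n. F n analytic_on {0} \<and> norm (deriv (F n) 0) \<ge> c * (1 + (norm (F n 0))\<^sup>2)"
  shows "\<forall>\<^sub>F w in at z. p w \<noteq> Infty"
proof (rule ccontr)
  assume "\<not> ?thesis"
  hence all: "p z = Infty" for z using isolated_or_all_Infty by blast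
  obtain \<delta> v where v: "\<delta> > 0" "v holomorphic_on ball 0 \<delta>"
    "\<forall>\<^sub>F n in sequentially. (\<lambda>w. inverse (F n w)) analytic_on ball 0 \<delta> \<and>
        (\<forall>w\<in>ball 0 \<delta>. F n analytic_on {w} \<longrightarrow> F n w \<noteq> 0)"
    "uniform_limit (ball 0 \<delta>) (\<lambda>n w. inverse (F n w)) v sequentially"
    "\<And>w. w \<in> ball 0 \<delta> \<Longrightarrow> p w = sphere_inv (Fin (v w))"
    by (rule infinite_chart[OF all]) blast
  have v0: "v w = 0" if "w \<in> ball 0 \<delta>" for w using v(5)[OF that] all[of w] by (auto split: if_splits)
  have "deriv v 0 = deriv (\<lambda>_. 0) 0"
    using v(1) v0 by (intro deriv_cong_ev eventually_mono[OF eventually_nhds_in_open[of "ball 0 \<delta>" 0]]) auto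
  hence "(\<lambda>n. deriv (\<lambda>w. inverse (F n w)) 0) \<longlonglongrightarrow> 0"
    using deriv_complex_uniform_limit[OF v(4) _ _ open_ball, of 0] v(1)
      eventually_mono[OF v(3), of "\<lambda>n. (\<lambda>w. inverse (F n w)) holomorphic_on ball 0 \<delta>"]
    by (auto dest: analytic_imp_holomorphic)
  from tendstoD[OF this c] v(3) have "\<forall>\<^sub>F n::nat in sequentially. False"
  proof eventually_elim
    case (elim n)
    hence nz: "F n 0 \<noteq> 0" using nd v(1) by auto
    have "deriv (\<lambda>w. inverse (F n w)) 0 = - deriv (F n) 0 / (F n 0)\<^sup>2"
      using nd nz by (intro deriv_inverse_analytic) auto
    hence "norm (deriv (F n) 0) / (norm (F n 0))\<^sup>2 < c"
      using elim(1) by (simp add: norm_divide norm_power)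
    hence "norm (deriv (F n) 0) < c * (norm (F n 0))\<^sup>2" using nz by (simp add: divide_less_eq)
    thus False using nd[of n] c by (simp add: algebra_simps)
  qed
  thus False by simp
qed

lemma entire_limit:
  assumes fin: "\<And>z. p z \<noteq> Infty"
  obtains G where "G holomorphic_on UNIV" "\<And>z. p z = Fin (G z)"
    "\<And>z. \<exists>\<delta>>0. (\<forall>\<^sub>F n in sequentially. F n analytic_on ball z \<delta>) \<and> uniform_limit (ball z \<delta>) F G sequentially"
proof -
  define G where "G = (\<lambda>z. case p z of Fin x \<Rightarrow> x | Infty \<Rightarrow> 0)"
  have pG: "p z = Fin (G z)" for z using fin[of z] by (cases "p z") (auto simp: G_def)
  have loc: "\<exists>\<delta>>0. (\<forall>\<^sub>F n in sequentially. F n analytic_on ball z \<delta>) \<and> uniform_limit (ball z \<delta>) F G sequentially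
        \<and> G holomorphic_on ball z \<delta>" for z
  proof -
    obtain \<delta> u where u: "\<delta> > 0" "u holomorphic_on ball z \<delta>"
      "\<forall>\<^sub>F n in sequentially. F n analytic_on ball z \<delta>"
      "uniform_limit (ball z \<delta>) F u sequentially" "\<And>w. w \<in> ball z \<delta> \<Longrightarrow> p w = Fin (u w)"
      by (rule finite_chart[OF pG]) blast
    have Gu: "G w = u w" if "w \<in> ball z \<delta>" for w using u(5)[OF that] by (simp add: G_def)
    have "uniform_limit (ball z \<delta>) F G sequentially" using u(4) Gu by (metis (mono_tags, lifting) uniform_limit_cong')
    moreover have "G holomorphic_on ball z \<delta>" using u(2) Gu holomorphic_cong by metis
    ultimately show ?thesis using u by blast
  qed
  have "G holomorphic_on UNIV"
    using loc by (metis analytic_at analytic_imp_holomorphic analytic_on_analytic_at centre_in_ball open_ball)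
  thus thesis using that[of G] pG loc by blast
qed

end

section \<open>Rescaled limits\<close>

text \<open>With \<open>h = 1/g\<close> and \<open>\<epsilon>\<close> the reciprocal of the large shared value, the quotient
  \<open>(h' + b h\<^sup>2) / (h - \<epsilon>)\<close> is holomorphic and bounded on a circle, uniformly in \<open>n\<close>; in the limit this
  bounds \<open>(v' + b v\<^sup>2) / v\<close>, which would have a simple pole at an isolated zero of \<open>v\<close>.\<close>

lemma limit_no_pole:
  assumes h: "\<forall>\<^sub>F n in sequentially. h n holomorphic_on ball z \<delta> \<and> (\<forall>w\<in>ball z \<delta>. h n w = \<epsilon> n \<longrightarrow> deriv (h n) w = - b * (\<epsilon> n)\<^sup>2)"
    and v: "v holomorphic_on ball z \<delta>" and \<delta>: "\<delta> > 0" and ul: "uniform_limit (ball z \<delta>) h v sequentially"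
    and \<epsilon>: "\<forall>\<^sub>F n in sequentially. \<epsilon> n \<noteq> 0" "\<epsilon> \<longlonglongrightarrow> 0" and b: "b \<noteq> 0" and vz: "v z = 0"
  shows "\<forall>\<^sub>F w in nhds z. v w = 0"
proof (rule ccontr)
  assume n0: "\<not> ?thesis"
  have "v analytic_on {z}" using v \<delta> by (meson analytic_at centre_in_ball open_ball)
  hence "\<forall>\<^sub>F w in at z. v w \<noteq> 0" using zero_free_or_zero n0 by blast
  then obtain d where d: "d > 0" "\<And>w. w \<noteq> z \<Longrightarrow> dist w z < d \<Longrightarrow> v w \<noteq> 0"
    unfolding eventually_at by auto
  \<comment> \<open>A circle that carries no zero of \<open>v\<close> and lies where the derivatives
    converge uniformly.\<close>
  define s where "s = min (\<delta> / 4) (d / 2)"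
  have s: "s > 0" "s < \<delta> / 2" "s < d" using \<delta> d(1) by (auto simp: s_def)
  define S where "S = ball z (\<delta> / 2)"
  have S: "open S" "cball z s \<subseteq> S" "S \<subseteq> ball z \<delta>" using s \<delta> by (auto simp: S_def)
  have vS: "v holomorphic_on S" using v S(3) by (rule holomorphic_on_subset)
  have dvS: "deriv v holomorphic_on S" using holomorphic_deriv[OF vS S(1)] .
  have contv: "continuous_on (cball z s) v" "continuous_on (cball z s) (deriv v)"
    using vS dvS S(2) by (auto intro: holomorphic_on_subset intro!: holomorphic_on_imp_continuous_on)
  have cs: "compact (sphere z s)" "sphere z s \<noteq> {}" using s by auto
  have sub: "sphere z s \<subseteq> cball z s" by auto
  obtain w0 where w0: "w0 \<in> sphere z s" "\<And>w. w \<in> sphere z s \<Longrightarrow> norm (v w0) \<le> norm (v w)"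
    using continuous_attains_inf[OF cs, of "\<lambda>w. norm (v w)"] contv(1) sub
    by (metis continuous_on_norm continuous_on_subset)
  \<comment> \<open>On the circle \<open>2 * m \<le> |v|\<close>. Two errors below
    \<open>m / 2\<close>, one from \<open>h n\<close> and one from \<open>\<epsilon> n\<close>,
    leave \<open>|h n - \<epsilon> n| \<ge> m\<close>.\<close>
  define m where "m = norm (v w0) / 2"
  have "w0 \<noteq> z" using w0(1) s(1) by auto
  moreover have "dist w0 z < d" using w0(1) s(3) by (simp add: dist_commute)
  ultimately have m: "m > 0" using d(2) by (simp add: m_def)
  have "continuous_on (cball z s) (\<lambda>w. deriv v w + b * (v w)\<^sup>2)" by (intro continuous_intros contv)
  from compact_imp_bounded[OF compact_continuous_image[OF this compact_cball]]
  obtain B0 where B0: "\<And>w. w \<in> cball z s \<Longrightarrow> norm (deriv v w + b * (v w)\<^sup>2) \<le> B0"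
    by (auto simp only: bounded_iff ball_simps)
  from compact_imp_bounded[OF compact_continuous_image[OF contv(1) compact_cball]]
  obtain V where V: "\<And>w. w \<in> cball z s \<Longrightarrow> norm (v w) \<le> V" by (auto simp only: bounded_iff ball_simps)
  have hol: "\<forall>\<^sub>F n in sequentially. h n holomorphic_on ball z \<delta>" using h by eventually_elim auto
  have uld: "uniform_limit S (\<lambda>n. deriv (h n)) (deriv v) sequentially"
    unfolding S_def by (rule uniform_limit_deriv_ball[OF hol v ul])
  have ulS: "uniform_limit S h v sequentially" by (rule uniform_limit_on_subset[OF ul S(3)])
  have lim: "(\<lambda>n. deriv (h n) w + b * (h n w)\<^sup>2) \<longlonglongrightarrow> deriv v w + b * (v w)\<^sup>2"
    "(\<lambda>n. h n w - \<epsilon> n) \<longlonglongrightarrow> v w - 0" if "w \<in> S" for w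
    by (intro tendsto_intros tendsto_uniform_limitI[OF uld that] tendsto_uniform_limitI[OF ulS that] \<epsilon>(2))+
  have uln: "uniform_limit (cball z s) (\<lambda>n w. deriv (h n) w + b * (h n w)\<^sup>2) (\<lambda>w. deriv v w + b * (v w)\<^sup>2) sequentially"
  proof -
    have bv: "bounded (v ` cball z s)" using V by (auto intro!: boundedI)
    have u1: "uniform_limit (cball z s) h v sequentially" by (rule uniform_limit_on_subset[OF ulS S(2)])
    have bb: "bounded ((\<lambda>w. b) ` cball z s)" by (rule boundedI[of _ "norm b"]) auto
    have "bounded ((\<lambda>w. b * v w) ` cball z s)"
      by (rule boundedI[of _ "norm b * V"]) (auto simp: norm_mult intro!: mult_left_mono V)
    from uniform_lim_mult[OF uniform_lim_mult[OF uniform_limit_const u1 bb bv] u1 this bv]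
    have "uniform_limit (cball z s) (\<lambda>n w. b * h n w * h n w) (\<lambda>w. b * v w * v w) sequentially" .
    from uniform_limit_add[OF uniform_limit_on_subset[OF uld S(2)] this] show ?thesis by (simp add: power2_eq_square mult.assoc)
  qed
  define B where "B = (B0 + 1) / m"
  have evq: "\<forall>\<^sub>F n in sequentially. \<forall>w\<in>ball z s. norm (deriv (h n) w + b * (h n w)\<^sup>2) \<le> B * norm (h n w - \<epsilon> n)"
    using h \<epsilon>(1) uniform_limitD[OF uln zero_less_one] uniform_limitD[OF ulS half_gt_zero[OF m]] tendstoD[OF \<epsilon>(2) half_gt_zero[OF m]]
  proof eventually_elim
    case (elim n)
    have hS: "h n holomorphic_on S" using elim(1) S(3) holomorphic_on_subset by blast
    have dd: "deriv (\<lambda>w. h n w - \<epsilon> n) w = deriv (h n) w" if "w \<in> S" for w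
      using holomorphic_on_imp_differentiable_at[OF hS S(1) that] by simp
    show ?case
    proof
      fix w assume w: "w \<in> ball z s"
      show "norm (deriv (h n) w + b * (h n w)\<^sup>2) \<le> B * norm (h n w - \<epsilon> n)"
      proof (rule maximum_modulus_quotient[OF _ _ S(1,2) _ _ w, where num = "\<lambda>w. deriv (h n) w + b * (h n w)\<^sup>2" and den = "\<lambda>w. h n w - \<epsilon> n"])
        show "(\<lambda>w. deriv (h n) w + b * (h n w)\<^sup>2) holomorphic_on S"
          using holomorphic_deriv[OF hS S(1)] hS S(1) by (intro holomorphic_intros)
        show "(\<lambda>w. h n w - \<epsilon> n) holomorphic_on S" using hS by (intro holomorphic_intros)
      next
        \<comment> \<open>At such a point the numerator is
          \<open>- b * \<epsilon>^2 + b * \<epsilon>^2 = 0\<close> and the denominator has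
          derivative \<open>- b * \<epsilon>^2 \<noteq> 0\<close>. This is where
          \<open>b \<noteq> 0\<close> enters.\<close>
        fix w assume w: "w \<in> S" "h n w - \<epsilon> n = 0"
        hence "deriv (h n) w = - b * (\<epsilon> n)\<^sup>2" using elim(1) S(3) by auto
        thus "deriv (h n) w + b * (h n w)\<^sup>2 = 0 \<and> deriv (\<lambda>w. h n w - \<epsilon> n) w \<noteq> 0"
          using w dd[OF w(1)] b elim(2) by simp
      next
        fix w assume "norm (w - z) = s"
        hence w: "w \<in> sphere z s" "w \<in> cball z s" by (auto simp: dist_norm norm_minus_commute)
        have "norm (v w) \<le> norm (v w - h n w) + norm (h n w - \<epsilon> n) + norm (\<epsilon> n)"
          using norm_triangle_ineq[of "v w - h n w + (h n w - \<epsilon> n)" "\<epsilon> n"] norm_triangle_ineq[of "v w - h n w" "h n w - \<epsilon> n"] by simp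
        moreover have "norm (v w - h n w) < m / 2" using elim(4) w S(2) by (force simp: dist_norm norm_minus_commute)
        moreover have "norm (\<epsilon> n) < m / 2" using elim(5) by simp
        moreover have "2 * m \<le> norm (v w)" using w0(2)[OF w(1)] by (simp add: m_def)
        ultimately have dn: "norm (h n w - \<epsilon> n) \<ge> m" by linarith
        have "norm (deriv (h n) w + b * (h n w)\<^sup>2) \<le> norm (deriv v w + b * (v w)\<^sup>2)
            + norm ((deriv (h n) w + b * (h n w)\<^sup>2) - (deriv v w + b * (v w)\<^sup>2))" by (rule norm_triangle_sub)
        also have "\<dots> \<le> B0 + 1"
          using B0[OF w(2)] elim(3)[rule_format, OF w(2)] unfolding dist_norm by linarith
        also have "\<dots> = B * m" using m by (simp add: B_def)
        also have "\<dots> \<le> B * norm (h n w - \<epsilon> n)"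
          using dn m order_trans[OF norm_ge_zero B0[OF w(2)]] by (intro mult_left_mono) (auto simp: B_def)
        finally show "norm (deriv (h n) w + b * (h n w)\<^sup>2) \<le> B * norm (h n w - \<epsilon> n) \<and> h n w - \<epsilon> n \<noteq> 0"
          using dn m by auto
      qed
    qed
  qed
  \<comment> \<open>In the limit \<open>\<epsilon> n\<close> disappears and
    \<open>v' + b v^2 = O(v)\<close>. As \<open>v\<close> is bounded on the disc,
    \<open>v' = O(v)\<close>.\<close>
  have le: "norm (deriv v w) \<le> (B + norm b * V) * norm (v w)" if w: "w \<in> ball z s" for w
  proof -
    have wS: "w \<in> S" "w \<in> cball z s" using w S(2) by auto
    have "norm (deriv v w + b * (v w)\<^sup>2) \<le> B * norm (v w - 0)"
      by (rule tendsto_le[OF _ tendsto_mult[OF tendsto_const tendsto_norm[OF lim(2)[OF wS(1)]]] tendsto_norm[OF lim(1)[OF wS(1)]]])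
        (use evq w in \<open>auto elim: eventually_mono\<close>)
    moreover have "norm (deriv v w) \<le> norm (deriv v w + b * (v w)\<^sup>2) + norm (b * (v w)\<^sup>2)"
      by (metis add_diff_cancel norm_triangle_ineq4)
    moreover have "norm (b * (v w)\<^sup>2) \<le> norm b * (V * norm (v w))"
      using V[OF wS(2)] by (simp add: norm_mult power2_eq_square mult_left_mono mult_right_mono)
    ultimately show ?thesis by (simp add: algebra_simps)
  qed
  have "v holomorphic_on ball z s" using vS S(2) by (meson ball_subset_cball holomorphic_on_subset)
  from deriv_le_imp_zero[OF this s(1) vz le] n0 show False by blast
qed

lemma exponential_type_omits:
  fixes u :: "complex \<Rightarrow> complex"
  assumes u: "u holomorphic_on UNIV" and C: "\<And>z. norm (u z) \<le> exp (C * (1 + norm z))" "C \<ge> 0"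
    and e: "\<And>z. u z \<noteq> e"
  shows "\<exists>\<alpha> \<beta>. \<forall>z. u z = e + exp (\<alpha> * z + \<beta>)"
proof -
  have "\<exists>\<alpha> \<beta>. \<forall>z. u z - e = exp (\<alpha> * z + \<beta>)"
  proof (rule zero_free_exponential_type[of _ "C + norm e"])
    fix z
    have "norm (u z - e) \<le> exp (C * (1 + norm z)) * 1 + norm e"
      using C(1)[of z] norm_triangle_ineq4[of "u z" e] by linarith
    also have "\<dots> \<le> exp (C * (1 + norm z)) * (1 + norm e)"
      using C(2) mult_right_mono[of 1 "exp (C * (1 + norm z))" "norm e"] by (simp add: distrib_left)
    also have "\<dots> \<le> exp (C * (1 + norm z)) * exp (norm e * (1 + norm z))"
    proof (rule mult_left_mono)
      have "1 + norm e \<le> 1 + norm e * (1 + norm z)" by (simp add: algebra_simps)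
      also have "\<dots> \<le> exp (norm e * (1 + norm z))" by (rule exp_ge_add_one_self)
      finally show "1 + norm e \<le> exp (norm e * (1 + norm z))" .
    qed simp
    finally show "norm (u z - e) \<le> exp ((C + norm e) * (1 + norm z))" by (simp add: distrib_right exp_add)
  qed (use u e C in \<open>auto intro!: holomorphic_intros\<close>)
  thus ?thesis by (metis add.commute diff_add_cancel)
qed

lemma entire_spherical_omits:
  assumes G: "G holomorphic_on UNIV" and K: "\<And>z. norm (deriv G z) \<le> K * (1 + (norm (G z))\<^sup>2)" and e: "\<And>z. G z \<noteq> e"
  shows "\<exists>\<alpha> \<beta>. \<forall>z. G z = e + exp (\<alpha> * z + \<beta>)"
proof -
  obtain C where "C \<ge> 0" "\<And>z. norm (G z) \<le> exp (C * (1 + norm z))"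
    using entire_bounded_spherical_deriv_growth[OF G K] by blast
  thus ?thesis using exponential_type_omits[OF G _ _ e] by blast
qed

lemma entire_spherical_deriv_omits:
  assumes G: "G holomorphic_on UNIV" and K: "\<And>z. norm (deriv G z) \<le> K * (1 + (norm (G z))\<^sup>2)" and e: "\<And>z. deriv G z \<noteq> e"
  shows "\<exists>\<alpha> \<beta>. \<forall>z. deriv G z = e + exp (\<alpha> * z + \<beta>)"
proof -
  obtain C where C: "C \<ge> 0" "\<And>z. norm (G z) \<le> exp (C * (1 + norm z))"
    using entire_bounded_spherical_deriv_growth[OF G K] by blast
  show ?thesis
    by (rule exponential_type_omits[OF holomorphic_deriv[OF G open_UNIV] exponential_type_deriv[OF G C(2,1)] _ e])
      (use C(1) in simp)
qed

context spherical_limit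
begin

lemma limit_derivs:
  assumes G: "G holomorphic_on UNIV"
    and loc: "\<And>z. \<exists>\<delta>>0. (\<forall>\<^sub>F n in sequentially. F n analytic_on ball z \<delta>) \<and> uniform_limit (ball z \<delta>) F G sequentially"
  shows "(\<lambda>n. F n z) \<longlonglongrightarrow> G z" "(\<lambda>n. deriv (F n) z) \<longlonglongrightarrow> deriv G z" "\<forall>\<^sub>F n in sequentially. F n analytic_on {z}"
proof -
  obtain \<delta> where \<delta>: "\<delta> > 0" "\<forall>\<^sub>F n in sequentially. F n analytic_on ball z \<delta>" "uniform_limit (ball z \<delta>) F G sequentially"
    using loc by blast
  show "(\<lambda>n. F n z) \<longlonglongrightarrow> G z" using tendsto_uniform_limitI[OF \<delta>(3)] \<delta>(1) by simp
  show "(\<lambda>n. deriv (F n) z) \<longlonglongrightarrow> deriv G z"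
    by (rule deriv_complex_uniform_limit[OF \<delta>(3) eventually_mono[OF \<delta>(2) analytic_imp_holomorphic]]) (use \<delta>(1) in auto)
  show "\<forall>\<^sub>F n in sequentially. F n analytic_on {z}"
    using \<delta>(2) by eventually_elim (use \<delta>(1) analytic_on_subset in auto)
qed

lemma limit_deriv_upper:
  assumes G: "G holomorphic_on UNIV"
    and loc: "\<And>z. \<exists>\<delta>>0. (\<forall>\<^sub>F n in sequentially. F n analytic_on ball z \<delta>) \<and> uniform_limit (ball z \<delta>) F G sequentially"
    and bd: "\<And>R. \<forall>\<^sub>F n in sequentially. spherical_deriv_le (F n) C (ball 0 R)"
  shows "norm (deriv G z) \<le> C * (1 + (norm (G z))\<^sup>2)"
proof (rule tendsto_le[OF sequentially_bot])
  note lim = limit_derivs[OF G loc, of z]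
  show "(\<lambda>n. norm (deriv (F n) z)) \<longlonglongrightarrow> norm (deriv G z)" by (intro tendsto_norm lim)
  show "(\<lambda>n. C * (1 + (norm (F n z))\<^sup>2)) \<longlonglongrightarrow> C * (1 + (norm (G z))\<^sup>2)" by (intro tendsto_intros lim)
  show "\<forall>\<^sub>F n in sequentially. norm (deriv (F n) z) \<le> C * (1 + (norm (F n z))\<^sup>2)"
    using bd[of "norm z + 1"] lim(3) by eventually_elim (auto simp: spherical_deriv_le_def)
qed

lemma limit_deriv_lower:
  assumes G: "G holomorphic_on UNIV"
    and loc: "\<And>z. \<exists>\<delta>>0. (\<forall>\<^sub>F n in sequentially. F n analytic_on ball z \<delta>) \<and> uniform_limit (ball z \<delta>) F G sequentially"
    and nd: "\<And>n. norm (deriv (F n) 0) \<ge> c * (1 + (norm (F n 0))\<^sup>2)"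
  shows "norm (deriv G 0) \<ge> c * (1 + (norm (G 0))\<^sup>2)"
proof (rule tendsto_le[OF sequentially_bot])
  note lim = limit_derivs[OF G loc, of 0]
  show "(\<lambda>n. norm (deriv (F n) 0)) \<longlonglongrightarrow> norm (deriv G 0)" by (intro tendsto_norm lim)
  show "(\<lambda>n. c * (1 + (norm (F n 0))\<^sup>2)) \<longlonglongrightarrow> c * (1 + (norm (G 0))\<^sup>2)" by (intro tendsto_intros lim)
qed (use nd in auto)

lemma limit_shrink:
  assumes G: "G holomorphic_on UNIV"
    and loc: "\<And>z. \<exists>\<delta>>0. (\<forall>\<^sub>F n in sequentially. F n analytic_on ball z \<delta>) \<and> uniform_limit (ball z \<delta>) F G sequentially"
    and P: "\<forall>\<^sub>F w in nhds z. P w"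
  obtains \<delta> where "\<delta> > 0" "\<And>w. w \<in> ball z \<delta> \<Longrightarrow> P w"
    "\<forall>\<^sub>F n in sequentially. F n holomorphic_on ball z \<delta> \<and> (\<forall>w\<in>ball z \<delta>. F n analytic_on {w})"
    "uniform_limit (ball z \<delta>) F G sequentially" "uniform_limit (ball z \<delta>) (\<lambda>n. deriv (F n)) (deriv G) sequentially"
proof -
  obtain d where d: "d > 0" "\<forall>\<^sub>F n in sequentially. F n analytic_on ball z d" "uniform_limit (ball z d) F G sequentially"
    using loc by blast
  obtain d' where d': "d' > 0" "\<And>w. dist w z < d' \<Longrightarrow> P w" using P unfolding eventually_nhds_metric by blast
  define \<delta> where "\<delta> = min (d / 2) d'"
  have sub: "ball z \<delta> \<subseteq> ball z (d / 2)" "ball z \<delta> \<subseteq> ball z d" using d(1) by (auto simp: \<delta>_def)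
  have "uniform_limit (ball z (d / 2)) (\<lambda>n. deriv (F n)) (deriv G) sequentially"
    by (rule uniform_limit_deriv_ball[OF eventually_mono[OF d(2) analytic_imp_holomorphic] holomorphic_on_subset[OF G] d(3)]) auto
  from uniform_limit_on_subset[OF this sub(1)]
  have "uniform_limit (ball z \<delta>) (\<lambda>n. deriv (F n)) (deriv G) sequentially" .
  moreover have "\<forall>\<^sub>F n in sequentially. F n holomorphic_on ball z \<delta> \<and> (\<forall>w\<in>ball z \<delta>. F n analytic_on {w})"
    using d(2) by eventually_elim (use sub in \<open>auto intro: analytic_imp_holomorphic analytic_on_subset\<close>)
  moreover have "uniform_limit (ball z \<delta>) F G sequentially" by (rule uniform_limit_on_subset[OF d(3) sub(2)])
  ultimately show thesis using d d' by (intro that[of \<delta>]) (auto simp: \<delta>_def dist_commute)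
qed

lemma Hurwitz_deriv:
  assumes G: "G holomorphic_on UNIV" and \<delta>: "\<delta> > 0"
    and ul: "uniform_limit (ball z \<delta>) (\<lambda>n. deriv (F n)) (deriv G) sequentially"
    and ev: "\<forall>\<^sub>F n in sequentially. F n holomorphic_on ball z \<delta> \<and> (\<forall>w\<in>ball z \<delta>. deriv (F n) w \<noteq> e)"
    and z: "deriv G z = e"
  shows "deriv G x = e"
proof -
  have hGe: "(\<lambda>w. deriv G w - e) holomorphic_on A" for A
    by (rule holomorphic_on_subset[OF holomorphic_on_diff[OF holomorphic_deriv[OF G open_UNIV] holomorphic_on_const]]) simp
  have near: "deriv G y - e = 0" if "y \<in> ball z \<delta>" for y
  proof (rule Hurwitz_ball[where H = "\<lambda>n w. deriv (F n) w - e" and u = "\<lambda>w. deriv G w - e" and z = z and \<delta> = \<delta> and w = z])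
    show "\<forall>\<^sub>F n in sequentially. (\<lambda>w. deriv (F n) w - e) holomorphic_on ball z \<delta> \<and> (\<forall>w\<in>ball z \<delta>. deriv (F n) w - e \<noteq> 0)"
      using ev by eventually_elim (auto intro!: holomorphic_intros holomorphic_deriv)
    show "uniform_limit (ball z \<delta>) (\<lambda>n w. deriv (F n) w - e) (\<lambda>w. deriv G w - e) sequentially"
      by (intro uniform_limit_minus ul uniform_limit_const)
  qed (use \<delta> z that hGe in simp_all)
  have "deriv G x - e = 0"
    by (rule analytic_continuation_open[of "ball z \<delta>" UNIV "\<lambda>y. deriv G y - e" "\<lambda>_. 0"])
      (use \<delta> in \<open>simp_all add: hGe near connected_UNIV\<close>)
  thus ?thesis by simp
qed

end

lemma lipschitz_stereo_isCont:
  assumes "\<And>z w. norm (stereo (p z) - stereo (p w)) \<le> K * norm (z - w)"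
  shows "isCont (\<lambda>w. stereo (p w)) (z :: complex)"
proof -
  have "((\<lambda>w. K * norm (w - z)) \<longlongrightarrow> 0) (at z)" by (auto intro!: tendsto_eq_intros)
  hence "((\<lambda>w. stereo (p w) - stereo (p z)) \<longlongrightarrow> 0) (at z)"
    by (rule Lim_null_comparison[rotated]) (use assms in auto)
  thus ?thesis by (simp add: isCont_def LIM_zero_iff)
qed

lemma spherical_limit_exists:
  assumes F: "\<And>n. chart_analytic (F n)" and C: "C \<ge> 0"
    and bd: "\<And>R. \<forall>\<^sub>F n in sequentially. spherical_deriv_le (F n) C (ball 0 R)"
  obtains r p where "strict_mono (r :: nat \<Rightarrow> nat)" "spherical_limit (\<lambda>n. F (r n)) p"
    "\<And>R. \<forall>\<^sub>F n in sequentially. spherical_deriv_le (F (r n)) C (ball 0 R)"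
proof -
  obtain r p where rp: "strict_mono (r :: nat \<Rightarrow> nat)"
    "\<And>R. uniform_limit (ball 0 R) (\<lambda>n z. stereo (to_sphere (F (r n)) z)) (\<lambda>z. stereo (p z)) sequentially"
    "\<And>z w. norm (stereo (p z) - stereo (p w)) \<le> 2 * C * norm (z - w)"
    by (rule spherical_arzela_ascoli[OF F C bd]) blast
  have "spherical_limit (\<lambda>n. F (r n)) p"
    by unfold_locales (rule F, rule rp(2), rule lipschitz_stereo_isCont[OF rp(3)])
  moreover have "\<forall>\<^sub>F n in sequentially. spherical_deriv_le (F (r n)) C (ball 0 R)" for R
    using eventually_subseq[OF rp(1) bd] .
  ultimately show thesis using that rp(1) by blast
qed

lemma constant_deriv_imp_affine:
  assumes "G holomorphic_on UNIV" "\<And>z. deriv G z = c"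
  shows "G z = c * z + G 0"
proof -
  have "((\<lambda>w. G w - c * w) has_field_derivative 0) (at w)" for w
    using holomorphic_derivI[OF assms(1) open_UNIV, of w] assms(2) by (auto intro!: derivative_eq_intros)
  hence "(\<lambda>w. G w - c * w) z = (\<lambda>w. G w - c * w) 0"
    using has_field_derivative_zero_constant[of UNIV "\<lambda>w. G w - c * w"] by (metis UNIV_I convex_UNIV)
  thus ?thesis by (simp add: algebra_simps)
qed

text \<open>In each application of Hurwitz below, a value of \<open>g n\<close> that is needed for a
  given value of the derivative, or conversely, is out of reach near the limit point, so the
  approximants omit a value that the limit takes.\<close>

lemma shared_values_no_rescaled_limit:
  fixes g :: "nat \<Rightarrow> complex \<Rightarrow> complex"
  assumes ca: "\<And>n. chart_analytic (g n)" and C: "C \<ge> 0"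
    and bd: "\<And>R. \<forall>\<^sub>F n in sequentially. spherical_deriv_le (g n) C (ball 0 R)"
    and E: "filterlim E at_infinity sequentially" and ab: "a \<noteq> b" "b \<noteq> 0"
    and sa: "\<And>n z. g n analytic_on {z} \<Longrightarrow> g n z = 0 \<longleftrightarrow> deriv (g n) z = a"
    and sb: "\<And>n z. g n analytic_on {z} \<Longrightarrow> g n z = E n \<longleftrightarrow> deriv (g n) z = b"
    and nd: "\<And>n. g n analytic_on {0} \<and> norm (deriv (g n) 0) \<ge> c * (1 + (norm (g n 0))\<^sup>2)" and c: "c > norm a"
  shows False
proof -
  obtain r p where r: "strict_mono (r :: nat \<Rightarrow> nat)" and sl: "spherical_limit (\<lambda>n. g (r n)) p"
    and bd': "\<And>R. \<forall>\<^sub>F n in sequentially. spherical_deriv_le (g (r n)) C (ball 0 R)"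
    by (rule spherical_limit_exists[OF ca C bd]) blast
  interpret spherical_limit "\<lambda>n. g (r n)" p by (rule sl)
  have c0: "c > 0" using c norm_ge_zero[of a] by linarith
  have E': "filterlim (\<lambda>n. E (r n)) at_infinity sequentially"
    by (rule filterlim_compose[OF E filterlim_subseq[OF r]])
  have Ebig: "\<forall>\<^sub>F n in sequentially. norm (E (r n)) > M" for M
    using filterlim_at_infinity_imp_norm_at_top[OF E'] unfolding filterlim_at_top_dense by simp
  note iso = nondegenerate_not_Infty[OF c0, OF nd]
  have fin: "p z \<noteq> Infty" for z
  proof
    assume pz: "p z = Infty"
    obtain \<delta> v where v: "\<delta> > 0" "v holomorphic_on ball z \<delta>"
      "\<forall>\<^sub>F n in sequentially. (\<lambda>w. inverse (g (r n) w)) analytic_on ball z \<delta> \<and>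
        (\<forall>w\<in>ball z \<delta>. g (r n) analytic_on {w} \<longrightarrow> g (r n) w \<noteq> 0)"
      "uniform_limit (ball z \<delta>) (\<lambda>n w. inverse (g (r n) w)) v sequentially"
      "\<And>w. w \<in> ball z \<delta> \<Longrightarrow> p w = sphere_inv (Fin (v w))"
      by (rule infinite_chart[OF pz]) blast
    define \<epsilon> where "\<epsilon> = (\<lambda>n. inverse (E (r n)))"
    have evE: "\<forall>\<^sub>F n in sequentially. E (r n) \<noteq> 0" using Ebig[of 0] by eventually_elim auto
    have "\<forall>\<^sub>F w in nhds z. v w = 0"
    proof (rule limit_no_pole[OF _ v(2,1,4) _ _ ab(2)])
      show "\<forall>\<^sub>F n in sequentially. (\<lambda>w. inverse (g (r n) w)) holomorphic_on ball z \<delta> \<and>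
         (\<forall>w\<in>ball z \<delta>. inverse (g (r n) w) = \<epsilon> n \<longrightarrow> deriv (\<lambda>w. inverse (g (r n) w)) w = - b * (\<epsilon> n)\<^sup>2)"
        using v(3) evE
      proof eventually_elim
        case (elim n)
        have "deriv (\<lambda>w. inverse (g (r n) w)) w = - b * (\<epsilon> n)\<^sup>2"
          if w: "w \<in> ball z \<delta>" "inverse (g (r n) w) = \<epsilon> n" for w
        proof -
          have gE: "g (r n) w = E (r n)" using w(2) by (simp add: \<epsilon>_def)
          \<comment> \<open>At a pole the value would be 0, but \<open>E (r n)\<close> is not
            0.\<close>
          hence an: "g (r n) analytic_on {w}" using chart_analytic_pole(2)[OF chart, of n w] elim(2) by auto
          have "deriv (g (r n)) w = b" using sb[OF an] gE by simp
          thus ?thesis using deriv_inverse_analytic[OF an] gE elim(2)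
            by (simp add: \<epsilon>_def power_inverse divide_inverse)
        qed
        thus ?case using elim analytic_imp_holomorphic by blast
      qed
      show "\<forall>\<^sub>F n in sequentially. \<epsilon> n \<noteq> 0" using evE by eventually_elim (simp add: \<epsilon>_def)
      show "\<epsilon> \<longlonglongrightarrow> 0" unfolding \<epsilon>_def by (rule filterlim_compose[OF tendsto_inverse_0 E'])
      show "v z = 0" using v(5)[of z] v(1) pz by (auto split: if_splits)
    qed
    moreover have "\<forall>\<^sub>F w in nhds z. w \<in> ball z \<delta>" using v(1) by (intro eventually_nhds_in_open) auto
    ultimately have "\<forall>\<^sub>F w in nhds z. p w = Infty" by eventually_elim (simp add: v(5))
    hence "\<forall>\<^sub>F w in at z. p w = Infty" by (simp add: eventually_nhds_conv_at)
    with iso[of z] have "\<forall>\<^sub>F w in at z. False" by eventually_elim auto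
    thus False by simp
  qed
  obtain G where G: "G holomorphic_on UNIV" "\<And>z. p z = Fin (G z)"
    and loc: "\<And>z. \<exists>\<delta>>0. (\<forall>\<^sub>F n in sequentially. g (r n) analytic_on ball z \<delta>) \<and> uniform_limit (ball z \<delta>) (\<lambda>n. g (r n)) G sequentially"
    by (rule entire_limit[OF fin]) blast
  have upper: "norm (deriv G z) \<le> C * (1 + (norm (G z))\<^sup>2)" for z by (rule limit_deriv_upper[OF G(1) loc bd'])
  have lower: "norm (deriv G 0) \<ge> c * (1 + (norm (G 0))\<^sup>2)" by (rule limit_deriv_lower[OF G(1) loc]) (use nd in blast)
  \<comment> \<open>As \<open>c > |a|\<close>, the derivative of the limit at 0 is neither
    \<open>a\<close> nor 0; this excludes constants and affine limits of slope
    \<open>a\<close>.\<close>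
  have "c \<le> c * (1 + (norm (G 0))\<^sup>2)" using c0 by simp
  hence "norm (deriv G 0) > norm a" using lower c by linarith
  hence G0: "deriv G 0 \<noteq> a" "deriv G 0 \<noteq> 0" using norm_ge_zero[of a] by auto
  have contG: "isCont G z" for z using holomorphic_on_imp_continuous_on[OF G(1)] by (simp add: continuous_on_eq_continuous_at)
  \<comment> \<open>Near \<open>z\<close> the value \<open>b\<close> of the derivative would force
    \<open>g (r n) = E (r n)\<close>, which is too large for functions close to the locally bounded
    \<open>G\<close>.\<close>
  have derivb: "deriv G x = b" if z: "deriv G z = b" for x z
  proof -
    have "\<forall>\<^sub>F w in nhds z. norm (G w) < norm (G z) + 1"
      using order_tendstoD(2)[OF tendsto_norm[OF contG[unfolded isCont_def, of z]], of "norm (G z) + 1"]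
      by (simp add: eventually_nhds_conv_at)
    then obtain \<delta> where \<delta>: "\<delta> > 0" "\<And>w. w \<in> ball z \<delta> \<Longrightarrow> norm (G w) < norm (G z) + 1"
      "\<forall>\<^sub>F n in sequentially. g (r n) holomorphic_on ball z \<delta> \<and> (\<forall>w\<in>ball z \<delta>. g (r n) analytic_on {w})"
      "uniform_limit (ball z \<delta>) (\<lambda>n. g (r n)) G sequentially" "uniform_limit (ball z \<delta>) (\<lambda>n. deriv (g (r n))) (deriv G) sequentially"
      using limit_shrink[OF G(1) loc] by blast
    have "\<forall>\<^sub>F n in sequentially. g (r n) holomorphic_on ball z \<delta> \<and> (\<forall>w\<in>ball z \<delta>. deriv (g (r n)) w \<noteq> b)"
      using \<delta>(3) uniform_limitD[OF \<delta>(4) zero_less_one] Ebig[of "norm (G z) + 2"]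
    proof eventually_elim
      case (elim n)
      have "deriv (g (r n)) w \<noteq> b" if w: "w \<in> ball z \<delta>" for w
      proof
        assume "deriv (g (r n)) w = b"
        hence "g (r n) w = E (r n)" using sb elim(1) w by blast
        moreover have "norm (g (r n) w) \<le> norm (G w) + norm (g (r n) w - G w)" by (rule norm_triangle_sub)
        moreover have "norm (g (r n) w - G w) < 1" using elim(2) w by (simp add: dist_norm)
        ultimately show False using elim(3) \<delta>(2)[OF w] by simp
      qed
      thus ?case using elim by blast
    qed
    from Hurwitz_deriv[OF G(1) \<delta>(1,5) this z] show ?thesis .
  qed
  have deriva: "G z = 0" if z: "deriv G z = a" for z
  proof (rule ccontr)
    assume nz: "G z \<noteq> 0"
    have "\<forall>\<^sub>F w in nhds z. norm (G w) > norm (G z) / 2"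
      using order_tendstoD(1)[OF tendsto_norm[OF contG[unfolded isCont_def, of z]], of "norm (G z) / 2"] nz
      by (simp add: eventually_nhds_conv_at)
    then obtain \<delta> where \<delta>: "\<delta> > 0" "\<And>w. w \<in> ball z \<delta> \<Longrightarrow> norm (G w) > norm (G z) / 2"
      "\<forall>\<^sub>F n in sequentially. g (r n) holomorphic_on ball z \<delta> \<and> (\<forall>w\<in>ball z \<delta>. g (r n) analytic_on {w})"
      "uniform_limit (ball z \<delta>) (\<lambda>n. g (r n)) G sequentially" "uniform_limit (ball z \<delta>) (\<lambda>n. deriv (g (r n))) (deriv G) sequentially"
      using limit_shrink[OF G(1) loc] by blast
    have "norm (G z) / 2 > 0" using nz by simp
    from uniform_limitD[OF \<delta>(4) this] \<delta>(3)
    have "\<forall>\<^sub>F n in sequentially. g (r n) holomorphic_on ball z \<delta> \<and> (\<forall>w\<in>ball z \<delta>. deriv (g (r n)) w \<noteq> a)"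
    proof eventually_elim
      case (elim n)
      have "deriv (g (r n)) w \<noteq> a" if w: "w \<in> ball z \<delta>" for w
      proof
        assume "deriv (g (r n)) w = a"
        hence "g (r n) w = 0" using sa elim(2) w by blast
        thus False using elim(1) \<delta>(2)[OF w] w by (force simp: dist_norm)
      qed
      thus ?case using elim by blast
    qed
    from Hurwitz_deriv[OF G(1) \<delta>(1,5) this z, of 0] G0 show False by simp
  qed
  \<comment> \<open>An affine limit of slope \<open>k\<close> has a zero, near which
    \<open>g n\<close> has zeros and hence derivative \<open>a\<close>; but the derivatives tend to
    \<open>k\<close>.\<close>
  have linear: False if c': "\<And>z. deriv G z = k" "k \<noteq> a" "k \<noteq> 0" for k
  proof -
    define z where "z = - G 0 / k"
    have Gz: "G z = 0" using constant_deriv_imp_affine[OF G(1) c'(1), of z] c' by (simp add: z_def)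
    have "\<forall>\<^sub>F w in nhds z. True" by simp
    then obtain \<delta> where \<delta>: "\<delta> > 0"
      "\<forall>\<^sub>F n in sequentially. g (r n) holomorphic_on ball z \<delta> \<and> (\<forall>w\<in>ball z \<delta>. g (r n) analytic_on {w})"
      "uniform_limit (ball z \<delta>) (\<lambda>n. g (r n)) G sequentially" "uniform_limit (ball z \<delta>) (\<lambda>n. deriv (g (r n))) (deriv G) sequentially"
      using limit_shrink[OF G(1) loc] by blast
    have "norm (k - a) > 0" using c' by simp
    from uniform_limitD[OF \<delta>(4) this] \<delta>(2)
    have ev: "\<forall>\<^sub>F n in sequentially. g (r n) holomorphic_on ball z \<delta> \<and> (\<forall>w\<in>ball z \<delta>. g (r n) w \<noteq> 0)"
    proof eventually_elim
      case (elim n)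
      have "g (r n) w \<noteq> 0" if w: "w \<in> ball z \<delta>" for w
      proof
        assume "g (r n) w = 0"
        hence "deriv (g (r n)) w = a" using sa elim(2) w by blast
        thus False using elim(1) w c'(1)[of w] by (force simp: dist_norm norm_minus_commute)
      qed
      thus ?case using elim by blast
    qed
    have "G w = 0" if "w \<in> ball z \<delta>" for w
      by (rule Hurwitz_ball[OF ev holomorphic_on_subset[OF G(1)] \<delta>(3) _ Gz that]) (use \<delta>(1) in auto)
    hence "\<forall>\<^sub>F w in nhds z. G w = 0"
      using \<delta>(1) eventually_nhds_in_open[of "ball z \<delta>" z] by (auto elim!: eventually_mono)
    hence "deriv G z = deriv (\<lambda>_. 0) z" by (intro deriv_cong_ev) auto
    thus False using c' by simp
  qed
  show False
  proof (cases "\<exists>z. deriv G z = b")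
    case True
    thus False using derivb linear[of b] ab by metis
  next
    case False
    then obtain \<alpha> \<beta> where ex: "\<And>z. deriv G z = b + exp (\<alpha> * z + \<beta>)"
      using entire_spherical_deriv_omits[OF G(1) upper, of b] by blast
    show False
    proof (cases "\<alpha> = 0")
      case True
      hence "deriv G z = deriv G 0" for z using ex by simp
      thus False using linear[of "deriv G 0"] G0 by blast
    next
      case False
      have "((\<lambda>w. G w - b * w - exp (\<alpha> * w + \<beta>) / \<alpha>) has_field_derivative 0) (at w)" for w
        using holomorphic_derivI[OF G(1) open_UNIV, of w] False ex[of w] by (auto intro!: derivative_eq_intros)
      hence const: "G z - b * z - exp (\<alpha> * z + \<beta>) / \<alpha> = G 0 - b * 0 - exp (\<alpha> * 0 + \<beta>) / \<alpha>" for z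
        using has_field_derivative_zero_constant[of UNIV "\<lambda>w. G w - b * w - exp (\<alpha> * w + \<beta>) / \<alpha>"]
        by (metis UNIV_I convex_UNIV)
      \<comment> \<open>Two solutions of \<open>exp (\<alpha> * z + \<beta>) = a - b\<close> one
        period apart suffice. \<open>G\<close> vanishes at both, and their exponential terms agree,
        so \<open>b * z0 = b * z1\<close>, against \<open>b \<noteq> 0\<close>.\<close>
      define z0 where "z0 = (Ln (a - b) - \<beta>) / \<alpha>"
      define z1 where "z1 = z0 + 2 * of_real pi * \<i> / \<alpha>"
      have e0: "exp (\<alpha> * z0 + \<beta>) = a - b" using False ab by (simp add: z0_def)
      have "\<alpha> * z1 + \<beta> = (\<alpha> * z0 + \<beta>) + 2 * of_real pi * \<i>" using False by (simp add: z1_def algebra_simps)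
      hence e1: "exp (\<alpha> * z1 + \<beta>) = a - b" using e0 by (simp add: exp_add)
      have "G z0 = 0" "G z1 = 0" using deriva ex e0 e1 by auto
      hence "- (b * z0) = - (b * z1)"
        using trans[OF const[of z0] const[of z1, symmetric]] e0 e1 by simp
      thus False using ab False by (simp add: z1_def)
    qed
  qed
qed

section \<open>Boundedness of the spherical derivatives\<close>

lemma analytic_affine_iff:
  fixes f :: "complex \<Rightarrow> complex"
  assumes \<mu>: "\<mu> \<noteq> 0"
  shows "(\<lambda>\<zeta>. f (c + \<mu> * \<zeta>)) analytic_on {\<zeta>0} \<longleftrightarrow> f analytic_on {c + \<mu> * \<zeta>0}"
proof
  assume "f analytic_on {c + \<mu> * \<zeta>0}"
  moreover have "(\<lambda>\<zeta>. c + \<mu> * \<zeta>) analytic_on {\<zeta>0}" by (auto intro!: analytic_intros)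
  ultimately have "f \<circ> (\<lambda>\<zeta>. c + \<mu> * \<zeta>) analytic_on {\<zeta>0}"
    by (intro analytic_on_compose_gen[of _ _ _ "{c + \<mu> * \<zeta>0}"]) auto
  thus "(\<lambda>\<zeta>. f (c + \<mu> * \<zeta>)) analytic_on {\<zeta>0}" by (simp add: o_def)
next
  assume "(\<lambda>\<zeta>. f (c + \<mu> * \<zeta>)) analytic_on {\<zeta>0}"
  moreover have "(\<lambda>z. (z - c) / \<mu>) analytic_on {c + \<mu> * \<zeta>0}" using \<mu> by (auto intro!: analytic_intros)
  ultimately have "(\<lambda>\<zeta>. f (c + \<mu> * \<zeta>)) \<circ> (\<lambda>z. (z - c) / \<mu>) analytic_on {c + \<mu> * \<zeta>0}"
    using \<mu> by (intro analytic_on_compose_gen[of _ _ _ "{\<zeta>0}"]) auto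
  thus "f analytic_on {c + \<mu> * \<zeta>0}" using \<mu> by (simp add: o_def)
qed

lemma analytic_scaled_iff:
  fixes f :: "complex \<Rightarrow> complex"
  assumes m: "m \<noteq> 0"
  shows "(\<lambda>\<zeta>. m * f \<zeta>) analytic_on A \<longleftrightarrow> f analytic_on A"
proof
  assume "(\<lambda>\<zeta>. m * f \<zeta>) analytic_on A"
  hence "(\<lambda>\<zeta>. inverse m * (m * f \<zeta>)) analytic_on A" by (rule analytic_on_mult[OF analytic_on_const])
  moreover have "(\<lambda>\<zeta>. inverse m * (m * f \<zeta>)) = f" using m by (simp add: fun_eq_iff)
  ultimately show "f analytic_on A" by metis
qed (intro analytic_intros)

lemma analytic_rescaled_iff:
  fixes f :: "complex \<Rightarrow> complex"
  assumes "m \<noteq> 0" "\<mu> \<noteq> 0"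
  shows "(\<lambda>\<zeta>. m * f (c + \<mu> * \<zeta>)) analytic_on {\<zeta>0} \<longleftrightarrow> f analytic_on {c + \<mu> * \<zeta>0}"
  using analytic_scaled_iff[OF assms(1)] analytic_affine_iff[OF assms(2)] by simp

lemma chart_analytic_rescaled:
  assumes "chart_analytic f" "m \<noteq> 0" "\<mu> \<noteq> 0"
  shows "chart_analytic (\<lambda>\<zeta>. m * f (c + \<mu> * \<zeta>))"
  using assms analytic_rescaled_iff[of m \<mu> f c] analytic_rescaled_iff[of "inverse m" \<mu> "\<lambda>w. inverse (f w)" c]
  unfolding chart_analytic_def by (simp add: inverse_mult_distrib)

lemma deriv_rescaled:
  assumes "f analytic_on {c + \<mu> * \<zeta>0}"
  shows "deriv (\<lambda>\<zeta>. m * f (c + \<mu> * \<zeta>)) \<zeta>0 = m * \<mu> * deriv f (c + \<mu> * \<zeta>0)"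
proof (rule DERIV_imp_deriv)
  have "(f has_field_derivative deriv f (c + \<mu> * \<zeta>0)) (at (c + \<mu> * \<zeta>0))"
    using analytic_on_imp_differentiable_at[OF assms] field_differentiable_derivI by blast
  moreover have "((\<lambda>\<zeta>. c + \<mu> * \<zeta>) has_field_derivative \<mu>) (at \<zeta>0)" by (auto intro!: derivative_eq_intros)
  ultimately have "((\<lambda>\<zeta>. f (c + \<mu> * \<zeta>)) has_field_derivative deriv f (c + \<mu> * \<zeta>0) * \<mu>) (at \<zeta>0)"
    by (rule DERIV_chain2)
  from DERIV_cmult[OF this, of m]
  show "((\<lambda>\<zeta>. m * f (c + \<mu> * \<zeta>)) has_field_derivative m * \<mu> * deriv f (c + \<mu> * \<zeta>0)) (at \<zeta>0)"
    by (simp add: mult_ac)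
qed

lemma chart_analytic_imp_meromorphic: "chart_analytic f \<Longrightarrow> f meromorphic_on A"
  using nicely_meromorphic_iff_chart_analytic[of f] meromorphic_on_subset unfolding nicely_meromorphic_on_def by blast

text \<open>Plain subtraction would leave the value \<open>- a\<close> at a pole, where 0 is
  required; \<open>remove_sings\<close> restores it.\<close>

lemma chart_analytic_shift:
  fixes a :: complex
  assumes f: "chart_analytic f"
  defines "F \<equiv> remove_sings (\<lambda>z. f z - a)"
  shows "chart_analytic F" "F analytic_on {z} \<longleftrightarrow> f analytic_on {z}"
    "f analytic_on {z} \<Longrightarrow> F z = f z - a" "f analytic_on {z} \<Longrightarrow> deriv F z = deriv f z"
proof -
  have m: "(\<lambda>z. f z - a) meromorphic_on A" for A
    using chart_analytic_imp_meromorphic[OF f] by (intro meromorphic_intros)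
  show F: "chart_analytic F"
    using remove_sings_nicely_meromorphic[OF m] unfolding F_def nicely_meromorphic_iff_chart_analytic[symmetric] .
  have "is_pole F z \<longleftrightarrow> is_pole (\<lambda>z. f z - a) z"
    unfolding F_def by (rule is_pole_remove_sings_iff)
      (use m[of "{z}"] in \<open>auto simp: meromorphic_at_iff\<close>)
  also have "\<dots> \<longleftrightarrow> is_pole f z" by (rule is_pole_minus_const_iff)
  finally show "F analytic_on {z} \<longleftrightarrow> f analytic_on {z}"
    using chart_analytic_is_pole_iff[OF F] chart_analytic_is_pole_iff[OF f] by blast
  assume an: "f analytic_on {z}"
  hence an': "(\<lambda>z. f z - a) analytic_on {z}" by (intro analytic_intros)
  show "F z = f z - a" using an' by (simp add: F_def)
  have "f field_differentiable at z" using analytic_on_imp_differentiable_at[OF an] by simp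
  thus "deriv F z = deriv f z" using an' by (simp add: F_def)
qed

text \<open>\<open>deriv f\<close> is arbitrary at the poles of \<open>f\<close>. Normalising it
  there does not change the associated map into the sphere.\<close>

lemma chart_analytic_derivative:
  assumes f: "chart_analytic f"
  defines "N \<equiv> remove_sings (deriv f)"
  shows "chart_analytic N" "N analytic_on {z} \<longleftrightarrow> f analytic_on {z}"
    "f analytic_on {z} \<Longrightarrow> N z = deriv f z" "f analytic_on {z} \<Longrightarrow> deriv N z = deriv (deriv f) z"
    "to_sphere N = to_sphere (deriv f)"
proof -
  have m: "deriv f meromorphic_on A" for A
    using chart_analytic_imp_meromorphic[OF f] by (intro meromorphic_intros)
  show N: "chart_analytic N"
    using remove_sings_nicely_meromorphic[OF m] unfolding N_def nicely_meromorphic_iff_chart_analytic[symmetric] .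
  have pole: "is_pole N z \<longleftrightarrow> is_pole (deriv f) z" "is_pole (deriv f) z \<longleftrightarrow> is_pole f z" for z
  proof -
    show "is_pole N z \<longleftrightarrow> is_pole (deriv f) z" unfolding N_def by (rule is_pole_remove_sings_iff)
      (use m[of "{z}"] in \<open>auto simp: meromorphic_at_iff\<close>)
    show "is_pole (deriv f) z \<longleftrightarrow> is_pole f z" by (rule is_pole_deriv_iff[OF chart_analytic_imp_meromorphic[OF f]])
  qed
  thus "N analytic_on {z} \<longleftrightarrow> f analytic_on {z}" for z
    using chart_analytic_is_pole_iff[OF N] chart_analytic_is_pole_iff[OF f] by blast
  show val: "N z = deriv f z" if an: "f analytic_on {z}" for z using analytic_deriv[OF an] by (simp add: N_def)
  show "deriv N z = deriv (deriv f) z" if an: "f analytic_on {z}" using analytic_deriv[OF an] by (simp add: N_def)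
  show "to_sphere N = to_sphere (deriv f)"
    using pole val chart_analytic_is_pole_iff[OF f] unfolding to_sphere_def by fastforce
qed

lemma spherical_deriv_le_shift:
  assumes f: "chart_analytic f" and C: "spherical_deriv_le (remove_sings (\<lambda>z. f z - a)) C UNIV" "C \<ge> 0"
  shows "spherical_deriv_le f (2 * C * (1 + (norm a)\<^sup>2)) UNIV"
  unfolding spherical_deriv_le_def
proof (intro ballI impI)
  fix z assume an: "f analytic_on {z}"
  note F = chart_analytic_shift[OF f, where a = a]
  have "norm (deriv f z) \<le> C * (1 + (norm (f z - a))\<^sup>2)"
    using C(1) F an by (auto simp: spherical_deriv_le_def)
  also have "1 + (norm (f z - a))\<^sup>2 \<le> 2 * (1 + (norm a)\<^sup>2) * (1 + (norm (f z))\<^sup>2)"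
  proof -
    have "(norm (f z - a))\<^sup>2 \<le> (norm (f z) + norm a)\<^sup>2" by (intro power_mono norm_triangle_ineq4) auto
    also have "\<dots> \<le> 2 * (norm (f z))\<^sup>2 + 2 * (norm a)\<^sup>2"
      using zero_le_power2[of "norm (f z) - norm a"] by (simp add: power2_eq_square algebra_simps)
    finally have "(norm (f z - a))\<^sup>2 \<le> 2 * (norm (f z))\<^sup>2 + 2 * (norm a)\<^sup>2" .
    moreover have "2 * (1 + (norm a)\<^sup>2) * (1 + (norm (f z))\<^sup>2)
       = 2 + 2 * (norm a)\<^sup>2 + 2 * (norm (f z))\<^sup>2 + 2 * ((norm a)\<^sup>2 * (norm (f z))\<^sup>2)" by (simp add: algebra_simps)
    moreover have "(norm a)\<^sup>2 * (norm (f z))\<^sup>2 \<ge> 0" by simp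
    ultimately show ?thesis by linarith
  qed
  hence "C * (1 + (norm (f z - a))\<^sup>2) \<le> C * (2 * (1 + (norm a)\<^sup>2) * (1 + (norm (f z))\<^sup>2))"
    using C(2) by (rule mult_left_mono)
  finally show "norm (deriv f z) \<le> 2 * C * (1 + (norm a)\<^sup>2) * (1 + (norm (f z))\<^sup>2)" by (simp add: mult_ac)
qed

lemma spherical_deriv_le_inverse:
  assumes f: "chart_analytic f" and C: "spherical_deriv_le f C UNIV" "C \<ge> 0"
  shows "spherical_deriv_le (\<lambda>w. inverse (f w)) C UNIV"
  unfolding spherical_deriv_le_def
proof (intro ballI impI)
  fix z assume an: "(\<lambda>w. inverse (f w)) analytic_on {z}"
  show "norm (deriv (\<lambda>w. inverse (f w)) z) \<le> C * (1 + (norm (inverse (f z)))\<^sup>2)"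
  proof (cases "f analytic_on {z}")
    case False
    show ?thesis by (rule spherical_deriv_le_inverse_pole[OF f open_UNIV UNIV_I C(1) False])
  next
    case True
    show ?thesis
    proof (cases "f z = 0")
      case False
      have "norm (deriv f z) \<le> C * (1 + (norm (f z))\<^sup>2)" using C(1) True by (auto simp: spherical_deriv_le_def)
      hence "norm (deriv f z) / (norm (f z))\<^sup>2 \<le> C * (1 + (norm (f z))\<^sup>2) / (norm (f z))\<^sup>2" by (rule divide_right_mono) simp
      also have "\<dots> = C * (1 + (norm (inverse (f z)))\<^sup>2)"
      proof -
        have "t * (1 + s) / s = t * (1 + inverse s)" if "s \<noteq> 0" for s t :: real using that by (simp add: field_simps)
        thus ?thesis using False by (simp only: norm_inverse power_inverse) simp
      qed
      finally show ?thesis using deriv_inverse_analytic[OF True False] by (simp only: norm_divide norm_minus_cancel norm_power)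
    next
      case z0: True
      \<comment> \<open>At a zero of \<open>f\<close>, analyticity of the pointwise inverse means
        that \<open>f\<close> vanishes nearby: the product tends to 0 and so cannot equal 1 on a
        punctured neighbourhood.\<close>
      have "((\<lambda>w. inverse (f w) * f w) \<longlongrightarrow> inverse (f z) * f z) (at z)"
        using analytic_at_imp_isCont[OF an] analytic_at_imp_isCont[OF True] unfolding isCont_def by (rule tendsto_mult)
      hence lim0: "((\<lambda>w. inverse (f w) * f w) \<longlongrightarrow> 0) (at z)" using z0 by simp
      have "\<not> (\<forall>\<^sub>F w in at z. inverse (f w) \<noteq> 0)"
      proof
        assume "\<forall>\<^sub>F w in at z. inverse (f w) \<noteq> 0"
        hence "\<forall>\<^sub>F w in at z. inverse (f w) * f w = 1" by eventually_elim auto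
        hence "((\<lambda>w. inverse (f w) * f w) \<longlongrightarrow> 1) (at z)" by (rule tendsto_eventually)
        from tendsto_unique[OF at_neq_bot lim0 this] show False by simp
      qed
      hence "\<forall>\<^sub>F w in nhds z. inverse (f w) = 0" using zero_free_or_zero[OF an] by blast
      hence "deriv (\<lambda>w. inverse (f w)) z = deriv (\<lambda>_. 0) z" by (intro deriv_cong_ev) auto
      thus ?thesis using C(2) by simp
    qed
  qed
qed

section \<open>Rescaling and the bound for \<open>f\<close>\<close>

lemma locally_bounded_near_pole:
  assumes f: "chart_analytic f" and inv: "(\<lambda>w. inverse (f w)) analytic_on {z}"
    and M: "\<And>w. M w \<le> 0 \<or> (f analytic_on {w} \<and> f w \<noteq> 0 \<and> M w \<le> norm (deriv f w) / (norm (f w))\<^sup>2)"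
  shows "\<exists>B. \<forall>\<^sub>F w in nhds z. M w \<le> (B::real)"
proof -
  let ?h = "\<lambda>w. inverse (f w)"
  have "isCont (deriv ?h) z" by (rule analytic_at_imp_isCont[OF analytic_deriv[OF inv]])
  hence "\<forall>\<^sub>F w in nhds z. norm (deriv ?h w) < norm (deriv ?h z) + 1"
    unfolding eventually_nhds_conv_at isCont_def by (auto intro: order_tendstoD(2)[OF tendsto_norm])
  hence "\<forall>\<^sub>F w in nhds z. M w \<le> norm (deriv ?h z) + 1"
  proof eventually_elim
    case (elim w)
    show ?case using M[of w]
    proof
      assume "M w \<le> 0" thus ?case using norm_ge_zero[of "deriv ?h z"] by linarith
    next
      assume *: "f analytic_on {w} \<and> f w \<noteq> 0 \<and> M w \<le> norm (deriv f w) / (norm (f w))\<^sup>2"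
      hence "norm (deriv ?h w) = norm (deriv f w) / (norm (f w))\<^sup>2"
        using deriv_inverse_analytic[of f w] by (simp add: norm_divide norm_power)
      thus ?case using * elim by linarith
    qed
  qed
  thus ?thesis by blast
qed

text \<open>The factor \<open>n + 1\<close> in the radius makes the discs exhaust the plane after
  rescaling by \<open>M (\<xi> n)\<close>.\<close>

lemma doubling_sequence:
  fixes M :: "complex \<Rightarrow> real"
  assumes locb: "\<And>z. \<exists>B. \<forall>\<^sub>F w in nhds z. M w \<le> B" and unb: "\<And>B. \<exists>z. M z > B"
  obtains \<xi> where "\<And>n::nat. M (\<xi> n) > real n + 1"
    "\<And>n w. norm (w - \<xi> n) < (real n + 1) / M (\<xi> n) \<Longrightarrow> M w \<le> 2 * M (\<xi> n)"
proof -
  have locb': "\<exists>d>0. \<exists>B. \<forall>w\<in>ball z d. M w \<le> B" for z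
  proof -
    obtain B where "\<forall>\<^sub>F w in nhds z. M w \<le> B" using locb by blast
    then obtain d where "d > 0" "\<And>w. dist w z < d \<Longrightarrow> M w \<le> B" unfolding eventually_nhds_metric by blast
    hence "d > 0 \<and> (\<forall>w\<in>ball z d. M w \<le> B)" by (simp add: dist_commute)
    thus ?thesis by blast
  qed
  have "\<exists>z. M z > real n + 1 \<and> (\<forall>w\<in>ball z ((real n + 1) / M z). M w \<le> 2 * M z)" for n :: nat
    by (rule doubling[OF locb' unb]) auto
  then obtain \<xi> where "\<And>n. M (\<xi> n) > real n + 1 \<and> (\<forall>w\<in>ball (\<xi> n) ((real n + 1) / M (\<xi> n)). M w \<le> 2 * M (\<xi> n))"
    by metis
  thus thesis by (intro that[of \<xi>]) (auto simp: dist_norm norm_minus_commute)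
qed

lemma shared_values_spherical_deriv_bounded:
  assumes f: "chart_analytic f" and ab: "a \<noteq> b" "b \<noteq> 0"
    and sa: "\<And>z. f analytic_on {z} \<Longrightarrow> f z = a \<longleftrightarrow> deriv f z = a"
    and sb: "\<And>z. f analytic_on {z} \<Longrightarrow> f z = b \<longleftrightarrow> deriv f z = b"
  shows "\<exists>C\<ge>0. spherical_deriv_le f C UNIV"
proof -
  define F where "F = remove_sings (\<lambda>z. f z - a)"
  note sh = chart_analytic_shift[OF f, where a = a, folded F_def]
  have sa': "F z = 0 \<longleftrightarrow> deriv F z = a" and sb': "F z = b - a \<longleftrightarrow> deriv F z = b" if "F analytic_on {z}" for z
    using that sa[of z] sb[of z] sh(2-4)[of z] by auto
  define c where "c = norm a + 1"
  have c: "c \<ge> 1" "c > norm a" by (auto simp: c_def)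
  \<comment> \<open>\<open>1 / M z\<close> is the scale \<open>\<rho>\<close> at which the spherical derivative of \<open>F / \<rho>\<close>, rescaled at \<open>z\<close>, equals \<open>c\<close>;
    at the zeros of \<open>F\<close> division by zero gives \<open>M z = 0\<close>, as desired since \<open>|F'| < c\<close> there.\<close>
  define M where "M = (\<lambda>z. if F analytic_on {z} then sqrt (max 0 ((norm (deriv F z) / c - 1) / (norm (F z))\<^sup>2)) else 0)"
  have M0: "M z \<ge> 0" for z by (simp add: M_def)
  have M2: "(M z)\<^sup>2 = max 0 ((norm (deriv F z) / c - 1) / (norm (F z))\<^sup>2)" if "F analytic_on {z}" for z
    using that by (simp add: M_def)
  \<comment> \<open>The definition of \<open>M\<close> read backwards. At a zero of \<open>F\<close>
    the bound comes instead from \<open>|F'| = |a| < c\<close>.\<close>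
  have key: "norm (deriv F z) \<le> c * (1 + x\<^sup>2 * (norm (F z))\<^sup>2)" if an: "F analytic_on {z}" and le: "M z \<le> x" for z x
  proof (cases "F z = 0")
    case True
    thus ?thesis using sa'[OF an] c by auto
  next
    case False
    have "(norm (deriv F z) / c - 1) / (norm (F z))\<^sup>2 \<le> (M z)\<^sup>2" using M2[OF an] by simp
    also have "\<dots> \<le> x\<^sup>2" using le M0[of z] by (intro power_mono) auto
    finally show ?thesis using False c by (simp add: divide_le_eq algebra_simps)
  qed
  have "\<exists>C\<ge>0. spherical_deriv_le F C UNIV"
  proof (cases "\<exists>B. \<forall>z. M z \<le> B")
    case True
    then obtain B where B: "\<And>z. M z \<le> B" by blast
    have "norm (deriv F z) \<le> c * (1 + B\<^sup>2) * (1 + (norm (F z))\<^sup>2)" if an: "F analytic_on {z}" for z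
    proof -
      have "norm (deriv F z) \<le> c * (1 + B\<^sup>2 * (norm (F z))\<^sup>2)" by (rule key[OF an B])
      also have "\<dots> \<le> c * ((1 + B\<^sup>2) * (1 + (norm (F z))\<^sup>2))"
        using c by (intro mult_left_mono) (auto simp: algebra_simps)
      finally show ?thesis by (simp add: mult_ac)
    qed
    thus ?thesis using c by (intro exI[of _ "c * (1 + B\<^sup>2)"]) (auto simp: spherical_deriv_le_def)
  next
    case False
    hence unb: "\<exists>z. M z > B" for B by (meson not_le)
    have locb: "\<exists>B. \<forall>\<^sub>F w in nhds z. M w \<le> B" for z
    proof (cases "(\<lambda>w. inverse (F w)) analytic_on {z}")
      case True
      have "\<exists>B. \<forall>\<^sub>F w in nhds z. (M w)\<^sup>2 \<le> B"
      proof (rule locally_bounded_near_pole[OF sh(1) True])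
        fix w
        show "(M w)\<^sup>2 \<le> 0 \<or> F analytic_on {w} \<and> F w \<noteq> 0 \<and> (M w)\<^sup>2 \<le> norm (deriv F w) / (norm (F w))\<^sup>2"
        proof (cases "F analytic_on {w} \<and> F w \<noteq> 0")
          case True
          have "norm (deriv F w) / c \<le> norm (deriv F w) / 1" using c by (intro divide_left_mono) auto
          hence "(norm (deriv F w) / c - 1) / (norm (F w))\<^sup>2 \<le> norm (deriv F w) / (norm (F w))\<^sup>2"
            by (intro divide_right_mono) auto
          thus ?thesis using True M2[of w] by simp
        next
          case False
          thus ?thesis by (auto simp: M_def)
        qed
      qed
      then obtain B where "\<forall>\<^sub>F w in nhds z. (M w)\<^sup>2 \<le> B" by blast
      hence "\<forall>\<^sub>F w in nhds z. M w \<le> sqrt B" by eventually_elim (use M0 real_le_rsqrt in auto)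
      thus ?thesis by blast
    next
      case False
      \<comment> \<open>Only zeros of \<open>F\<close> remain. There \<open>|F'| = |a| < c\<close>,
        and by continuity \<open>M\<close> is 0 on a neighbourhood.\<close>
      hence an: "F analytic_on {z}" using sh(1) by (auto simp: chart_analytic_def)
      hence "F z = 0" using False inverse_analytic by blast
      hence "norm (deriv F z) < c" using sa'[OF an] c by simp
      moreover have "isCont (deriv F) z" by (rule analytic_at_imp_isCont[OF analytic_deriv[OF an]])
      ultimately have "\<forall>\<^sub>F w in nhds z. norm (deriv F w) < c"
        unfolding eventually_nhds_conv_at isCont_def by (auto intro: order_tendstoD(2)[OF tendsto_norm])
      hence "\<forall>\<^sub>F w in nhds z. M w \<le> 0"
      proof eventually_elim
        case (elim w)
        hence "(norm (deriv F w) / c - 1) / (norm (F w))\<^sup>2 \<le> 0"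
          using c by (intro divide_nonpos_nonneg) (auto simp: divide_le_eq)
        thus ?case by (simp add: M_def)
      qed
      thus ?thesis by blast
    qed
    obtain \<xi> where \<xi>: "\<And>n::nat. M (\<xi> n) > real n + 1"
      "\<And>n w. norm (w - \<xi> n) < (real n + 1) / M (\<xi> n) \<Longrightarrow> M w \<le> 2 * M (\<xi> n)"
      using doubling_sequence[OF locb unb] by blast
    define m where "m = (\<lambda>n. M (\<xi> n))"
    have m: "m n > real n + 1" "m n > 0" for n using \<xi>(1)[of n] by (auto simp: m_def intro: le_less_trans[of 0 "real n + 1"])
    \<comment> \<open>The two factors cancel in the derivative, so \<open>deriv (g n)\<close> takes
      the values of \<open>deriv F\<close>, while the value \<open>b - a\<close> of \<open>F\<close>
      becomes \<open>m n * (b - a)\<close>.\<close>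
    define g where "g = (\<lambda>n \<zeta>. of_real (m n) * F (\<xi> n + of_real (inverse (m n)) * \<zeta>))"
    have nz: "of_real (m n) \<noteq> (0::complex)" "of_real (inverse (m n)) \<noteq> (0::complex)" for n using m(2)[of n] by auto
    define W where "W = (\<lambda>n \<zeta>. \<xi> n + of_real (inverse (m n)) * \<zeta>)"
    have gan: "g n analytic_on {\<zeta>} \<longleftrightarrow> F analytic_on {W n \<zeta>}" for n \<zeta>
      unfolding g_def W_def by (rule analytic_rescaled_iff[OF nz])
    have gval: "g n \<zeta> = of_real (m n) * F (W n \<zeta>)" for n \<zeta> by (simp add: g_def W_def)
    have gder: "deriv (g n) \<zeta> = deriv F (W n \<zeta>)" if "F analytic_on {W n \<zeta>}" for n \<zeta>
      using deriv_rescaled[of F "\<xi> n" "of_real (inverse (m n))" \<zeta> "of_real (m n)"] that m(2)[of n] by (simp add: g_def W_def)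
    have False
    proof (rule shared_values_no_rescaled_limit[of g "4 * c" "\<lambda>n. of_real (m n) * (b - a)" a b c])
      show "chart_analytic (g n)" for n unfolding g_def by (rule chart_analytic_rescaled[OF sh(1) nz])
      show "4 * c \<ge> 0" using c by simp
      show "a \<noteq> b" "b \<noteq> 0" "c > norm a" using ab c by auto
      show "filterlim (\<lambda>n. of_real (m n) * (b - a)) at_infinity sequentially"
      proof (rule filterlim_norm_at_top_imp_at_infinity)
        have m_ge: "real n \<le> m n" for n using m(1)[of n] by linarith
        have "filterlim (\<lambda>n. real n) at_top sequentially" by (rule filterlim_real_sequentially)
        hence "filterlim m at_top sequentially"
          by (rule filterlim_at_top_mono) (simp add: m_ge)
        hence "filterlim (\<lambda>n. m n * norm (b - a)) at_top sequentially"
          using ab by (intro filterlim_at_top_mult_tendsto_pos[OF tendsto_const]) auto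
        moreover have "norm (of_real (m n) * (b - a)) = m n * norm (b - a)" for n
          using m(2)[of n] by (simp add: norm_mult)
        ultimately show "filterlim (\<lambda>n. norm (of_real (m n) * (b - a))) at_top sequentially" by simp
      qed
      show "g n z = 0 \<longleftrightarrow> deriv (g n) z = a" if "g n analytic_on {z}" for n z
        using that sa'[of "W n z"] gder[of n z] nz(1)[of n] by (simp add: gan gval)
      show "g n z = of_real (m n) * (b - a) \<longleftrightarrow> deriv (g n) z = b" if "g n analytic_on {z}" for n z
        using that sb'[of "W n z"] gder[of n z] nz(1)[of n] by (simp add: gan gval)
      fix n
      have W0: "W n 0 = \<xi> n" by (simp add: W_def)
      have an: "F analytic_on {\<xi> n}" using m(2)[of n] by (auto simp: m_def M_def split: if_splits)
      have "(m n)\<^sup>2 = (norm (deriv F (\<xi> n)) / c - 1) / (norm (F (\<xi> n)))\<^sup>2" "F (\<xi> n) \<noteq> 0"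
        using M2[OF an] m(2)[of n] by (auto simp: m_def max_def split: if_splits)
      hence "norm (deriv F (\<xi> n)) = c * (1 + (m n)\<^sup>2 * (norm (F (\<xi> n)))\<^sup>2)" using c by (simp add: field_simps)
      moreover have "(norm (g n 0))\<^sup>2 = (m n)\<^sup>2 * (norm (F (\<xi> n)))\<^sup>2"
        by (simp add: gval W0 norm_mult power_mult_distrib)
      ultimately show "g n analytic_on {0} \<and> norm (deriv (g n) 0) \<ge> c * (1 + (norm (g n 0))\<^sup>2)"
        using an by (simp add: gan W0 gder)
    next
      fix R :: real
      show "\<forall>\<^sub>F n in sequentially. spherical_deriv_le (g n) (4 * c) (ball 0 R)"
        using eventually_ge_at_top[of "nat \<lceil>R\<rceil>"]
      proof eventually_elim
        case (elim n)
        show ?case unfolding spherical_deriv_le_def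
        proof (intro ballI impI)
          fix \<zeta> assume \<zeta>: "\<zeta> \<in> ball 0 R" "g n analytic_on {\<zeta>}"
          have an: "F analytic_on {W n \<zeta>}" using \<zeta> by (simp add: gan)
          \<comment> \<open>For \<open>n \<ge> R\<close> the disc of radius \<open>R\<close> is
            mapped by \<open>W n\<close> to where \<open>M \<le> 2 * m n\<close>; squaring the 2
            gives the constant \<open>4 * c\<close>.\<close>
          have "norm \<zeta> < real n + 1" using \<zeta>(1) elim by (simp add: nat_le_iff ceiling_le_iff)
          hence "norm (W n \<zeta> - \<xi> n) < (real n + 1) / m n"
            using m(2)[of n] by (simp add: W_def norm_mult norm_inverse norm_divide divide_inverse mult.commute)
          hence "M (W n \<zeta>) \<le> 2 * m n" using \<xi>(2) by (simp add: m_def)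
          from key[OF an this] have "norm (deriv F (W n \<zeta>)) \<le> c * (1 + 4 * (m n)\<^sup>2 * (norm (F (W n \<zeta>)))\<^sup>2)"
            by (simp add: power_mult_distrib)
          also have "\<dots> \<le> c * (4 * (1 + (m n)\<^sup>2 * (norm (F (W n \<zeta>)))\<^sup>2))" using c by (intro mult_left_mono) auto
          finally show "norm (deriv (g n) \<zeta>) \<le> 4 * c * (1 + (norm (g n \<zeta>))\<^sup>2)"
            using gder[OF an] by (simp add: gval norm_mult power_mult_distrib mult_ac)
        qed
      qed
    qed
    thus ?thesis ..
  qed
  then obtain C where "C \<ge> 0" "spherical_deriv_le F C UNIV" by blast
  thus ?thesis using spherical_deriv_le_shift[OF f, of a C] unfolding F_def
    by (intro exI[of _ "2 * C * (1 + (norm a)\<^sup>2)"]) auto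
qed

section \<open>Normality from a bounded spherical derivative\<close>

lemma stereo_close_imp_dist_less:
  assumes "e > 0"
  shows "\<exists>d>0. \<forall>p q. norm (stereo p - stereo q) < d \<longrightarrow> dist p q < e"
proof -
  have "continuous_on {-1..1} arccos" by (rule continuous_on_arccos')
  moreover have "(1::real) \<in> {-1..1}" "2 * e > 0" using assms by auto
  ultimately obtain \<delta> where \<delta>: "\<delta> > 0" "\<And>y. y \<in> {-1..1} \<Longrightarrow> dist y 1 < \<delta> \<Longrightarrow> dist (arccos y) (arccos 1) < 2 * e"
    unfolding continuous_on_iff by blast
  \<comment> \<open>For unit vectors the inner product is \<open>1 - ?x^2 / 2\<close>, so continuity
    of \<open>arccos\<close> at 1 suffices. The bound 1 gives \<open>?x^2 \<le> ?x\<close> and keeps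
    the inner product in the domain of \<open>arccos\<close>.\<close>
  have "dist p q < e" if pq: "norm (stereo p - stereo q) < min 1 \<delta>" for p q
  proof -
    let ?x = "norm (stereo p - stereo q)"
    have inner: "inner (stereo p) (stereo q) = 1 - ?x\<^sup>2 / 2"
      by (simp add: dot_norm_neg norm_stereo diff_divide_distrib)
    have x: "?x\<^sup>2 \<le> 1" "?x\<^sup>2 \<le> ?x" using pq mult_left_le[of ?x ?x] by (auto simp: power_le_one power2_eq_square)
    have "dist (arccos (inner (stereo p) (stereo q))) (arccos 1) < 2 * e"
      using x pq zero_le_power2[of ?x] by (intro \<delta>) (simp_all only: inner dist_real_def atLeastAtMost_iff, auto)
    thus ?thesis by (simp add: dist_riemann_sphere_def dist_real_def)
  qed
  thus ?thesis using \<delta>(1) by (intro exI[of _ "min 1 \<delta>"]) auto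
qed

text \<open>Translation preserves the bound, so the compactness theorem applies to the translates,
  and a spherical limit is meromorphic or constantly infinite.\<close>

lemma normal_function_if_spherical_deriv_bounded:
  assumes f: "chart_analytic f" and C: "spherical_deriv_le f C UNIV" "C \<ge> 0"
  shows "normal_function (to_sphere f)"
  unfolding normal_function_def normal_family_def
proof (intro conjI allI impI)
  show "meromorphic_function (to_sphere f)"
    using f unfolding meromorphic_function_def nicely_meromorphic_iff_chart_analytic by blast
  fix \<zeta> :: "nat \<Rightarrow> complex" and s :: "nat \<Rightarrow> complex \<Rightarrow> riemann_sphere"
  assume "range s \<subseteq> range (\<lambda>n z. to_sphere f (\<zeta> n + z))"
  hence "\<forall>k. \<exists>m. s k = (\<lambda>z. to_sphere f (\<zeta> m + z))" by blast
  then obtain m where m: "\<And>k. s k = (\<lambda>z. to_sphere f (\<zeta> (m k) + z))" by metis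
  define F where "F = (\<lambda>k z. f (\<zeta> (m k) + z))"
  have an: "F k analytic_on {z} \<longleftrightarrow> f analytic_on {\<zeta> (m k) + z}" for k z
    using analytic_affine_iff[of 1 f "\<zeta> (m k)" z] by (simp add: F_def)
  have F: "chart_analytic (F k)" for k
    using chart_analytic_rescaled[OF f, of 1 1 "\<zeta> (m k)"] by (simp add: F_def)
  have sF: "s k z = to_sphere (F k) z" for k z
    by (simp add: m to_sphere_chart_analytic[OF f] to_sphere_chart_analytic[OF F] an) (simp add: F_def)
  have "spherical_deriv_le (F k) C S" for k S
    unfolding spherical_deriv_le_def
  proof (intro ballI impI)
    fix z assume "F k analytic_on {z}"
    hence a: "f analytic_on {\<zeta> (m k) + z}" by (simp add: an)
    have "deriv (F k) z = deriv f (\<zeta> (m k) + z)"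
      using deriv_rescaled[of f "\<zeta> (m k)" 1 z 1] a by (simp add: F_def)
    thus "norm (deriv (F k) z) \<le> C * (1 + (norm (F k z))\<^sup>2)"
      using C(1) a by (auto simp: spherical_deriv_le_def F_def)
  qed
  then obtain r p where r: "strict_mono (r :: nat \<Rightarrow> nat)" and sl: "spherical_limit (\<lambda>n. F (r n)) p"
    by (rule_tac spherical_limit_exists[OF F C(2)]) auto
  interpret spherical_limit "\<lambda>n. F (r n)" p by (rule sl)
  have "locally_uniform_limit (s \<circ> r) p"
    unfolding locally_uniform_limit_def
  proof
    fix z :: complex
    have "uniform_limit (ball z 1) (s \<circ> r) p sequentially"
    proof (rule uniform_limitI)
      fix e :: real assume "e > 0"
      then obtain d where d: "d > 0" "\<And>p q. norm (stereo p - stereo q) < d \<Longrightarrow> dist p q < e"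
        using stereo_close_imp_dist_less by blast
      show "\<forall>\<^sub>F n in sequentially. \<forall>x\<in>ball z 1. dist ((s \<circ> r) n x) (p x) < e"
        using uniform_limitD[OF ul_ball[of z] d(1)] by eventually_elim (auto simp: sF dist_norm intro!: d(2))
    qed
    moreover have "open (ball z 1)" "z \<in> ball z 1" by auto
    ultimately show "\<exists>U. open U \<and> z \<in> U \<and> uniform_limit U (s \<circ> r) p sequentially" by blast
  qed
  thus "\<exists>r g. strict_mono r \<and> (meromorphic_function g \<or> g = (\<lambda>_. Infty)) \<and> locally_uniform_limit (s \<circ> r) g"
    using r limit_meromorphic by blast
qed

section \<open>The bound for the derivative of \<open>f\<close>\<close>

lemma second_deriv_bound_near_finite_value:
  assumes f: "chart_analytic f" and C: "spherical_deriv_le f C UNIV" "C > 0"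
  shows "\<exists>\<delta>>0. \<exists>D. \<forall>z w. dist w z < \<delta> \<and> f analytic_on {w} \<and> norm (f w) \<le> K \<longrightarrow>
           f analytic_on {z} \<and> norm (deriv (deriv f) z) \<le> D"
proof -
  define I where "I = stereo Infty"
  \<comment> \<open>Values of modulus at most \<open>K\<close> are at chordal distance at least
    \<open>2 * \<kappa>\<close> from infinity. Points of \<open>ball z (2 * \<delta>)\<close> are
    within \<open>3 * \<delta>\<close> of \<open>w\<close>, so \<open>f\<close> moves by at most
    \<open>2 * C * 3 * \<delta> = \<kappa>\<close> and remains bounded by
    \<open>2 / \<kappa>\<close>. Cauchy's estimate then bounds \<open>f''\<close>.\<close>
  define \<kappa> where "\<kappa> = 1 / sqrt (1 + K\<^sup>2)"
  have \<kappa>: "\<kappa> > 0" by (simp add: \<kappa>_def add_pos_nonneg)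
  define \<delta> where "\<delta> = \<kappa> / (6 * C)"
  have \<delta>: "\<delta> > 0" using \<kappa> C by (simp add: \<delta>_def)
  define B where "B = 2 / \<kappa>"
  have main: "f analytic_on {z} \<and> norm (deriv (deriv f) z) \<le> 2 * B / \<delta>\<^sup>2"
    if w: "dist w z < \<delta>" "f analytic_on {w}" "norm (f w) \<le> K" for z w
  proof -
    have fx: "f analytic_on {x} \<and> norm (f x) \<le> B" if x: "x \<in> ball z (2 * \<delta>)" for x
    proof -
      have "dist w x < 3 * \<delta>" using dist_triangle[of w x z] w(1) x by simp
      hence wx: "norm (x - w) \<le> 3 * \<delta>" by (simp add: dist_norm norm_minus_commute)
      have "norm (stereo (to_sphere f x) - stereo (to_sphere f w)) \<le> 2 * C * norm (x - w)"
        using C by (intro spherical_lipschitz[OF f open_UNIV convex_UNIV C(1)]) auto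
      also have "\<dots> \<le> 2 * C * (3 * \<delta>)" using wx C by (intro mult_left_mono) auto
      also have "\<dots> = \<kappa>" using C by (simp add: \<delta>_def)
      finally have close: "norm (stereo (to_sphere f x) - stereo (to_sphere f w)) \<le> \<kappa>" .
      have "sqrt (1 + (norm (f w))\<^sup>2) \<le> sqrt (1 + K\<^sup>2)" using w(3) by (simp add: power_mono)
      hence "2 / sqrt (1 + K\<^sup>2) \<le> 2 / sqrt (1 + (norm (f w))\<^sup>2)"
        by (intro divide_left_mono mult_pos_pos) (auto simp: add_pos_nonneg)
      hence "2 * \<kappa> \<le> norm (stereo (to_sphere f w) - I)"
        using w(2) by (simp add: \<kappa>_def I_def to_sphere_chart_analytic[OF f] norm_stereo_diff_Infty del: stereo.simps)
      also have "\<dots> \<le> norm (stereo (to_sphere f w) - stereo (to_sphere f x)) + norm (stereo (to_sphere f x) - I)"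
        by (rule norm_diff_triangle_le[OF order_refl order_refl])
      finally have far: "\<kappa> \<le> norm (stereo (to_sphere f x) - I)"
        using close by (simp add: norm_minus_commute)
      show ?thesis
      proof (cases "f analytic_on {x}")
        case True
        have sq: "sqrt (1 + (norm (f x))\<^sup>2) > 0" by (simp add: add_pos_nonneg)
        have "\<kappa> \<le> 2 / sqrt (1 + (norm (f x))\<^sup>2)"
          using far True by (simp add: I_def to_sphere_chart_analytic[OF f] norm_stereo_diff_Infty del: stereo.simps)
        hence "sqrt (1 + (norm (f x))\<^sup>2) \<le> B" using sq \<kappa> by (simp add: B_def field_simps)
        moreover have "norm (f x) \<le> sqrt (1 + (norm (f x))\<^sup>2)" by (rule real_le_rsqrt) simp
        ultimately show ?thesis using True by linarith
      next
        case False
        hence "stereo (to_sphere f x) = I" by (simp add: I_def to_sphere_chart_analytic[OF f])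
        thus ?thesis using far \<kappa> by simp
      qed
    qed
    have "f analytic_on ball z (2 * \<delta>)" using fx analytic_on_analytic_at by blast
    hence hol: "f holomorphic_on ball z (2 * \<delta>)" by (rule analytic_imp_holomorphic)
    have sub: "cball z \<delta> \<subseteq> ball z (2 * \<delta>)" "ball z \<delta> \<subseteq> ball z (2 * \<delta>)" using \<delta> by auto
    have "norm ((deriv ^^ 2) f z) \<le> fact 2 * B / \<delta> ^ 2"
    proof (rule Cauchy_inequality)
      show "f holomorphic_on ball z \<delta>" by (rule holomorphic_on_subset[OF hol sub(2)])
      show "continuous_on (cball z \<delta>) f"
        by (rule holomorphic_on_imp_continuous_on[OF holomorphic_on_subset[OF hol sub(1)]])
      fix x assume "norm (z - x) = \<delta>"
      thus "norm (f x) \<le> B" using fx \<delta> by (auto simp: dist_norm)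
    qed (rule \<delta>)
    moreover have "f analytic_on {z}" using fx[of z] \<delta> by simp
    ultimately show ?thesis by (simp add: numeral_2_eq_2)
  qed
  show ?thesis using \<delta> main by (intro exI[of _ \<delta>] conjI exI[of _ "2 * B / \<delta>\<^sup>2"]) auto
qed

text \<open>Applied to \<open>h = 1/f\<close> and \<open>P = 1/(f' - b)\<close> at a pole of \<open>f\<close>. If \<open>P' z \<noteq> 0\<close>, then \<open>h = O(P)\<close>, so the
  identity gives \<open>h' = O(h)\<close> and \<open>h\<close> vanishes identically.\<close>

lemma reciprocal_deriv_zero_at_pole:
  fixes h P :: "complex \<Rightarrow> complex"
  assumes h: "h analytic_on {z}" "h z = 0" and P: "P analytic_on {z}" "P z = 0"
    and eq: "\<forall>\<^sub>F x in at z. P x * (- deriv h x - b * (h x)\<^sup>2) = (h x)\<^sup>2"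
    and nz: "\<forall>\<^sub>F x in at z. h x \<noteq> 0"
  shows "deriv P z = 0"
proof (rule ccontr)
  assume P': "deriv P z \<noteq> 0"
  \<comment> \<open>Near \<open>z\<close>, \<open>|h| \<le> (|h'(z)| + 1) |x - z|\<close> and
    \<open>|P| \<ge> |P'(z)| / 2 * |x - z|\<close>; \<open>k\<close> is the quotient of the
    constants.\<close>
  define k where "k = (norm (deriv h z) + 1) / (norm (deriv P z) / 2)"
  have k0: "k > 0" using P' by (simp add: k_def add_nonneg_pos)
  have q: "((\<lambda>x. u x / (x - z)) \<longlongrightarrow> deriv u z) (at z)" if "u analytic_on {z}" "u z = 0" for u
  proof -
    have "(u has_field_derivative deriv u z) (at z)"
      using analytic_on_imp_differentiable_at[OF that(1)] field_differentiable_derivI by blast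
    thus ?thesis using that(2) by (simp add: has_field_derivative_iff)
  qed
  have "\<forall>\<^sub>F x in at z. norm (h x / (x - z)) < norm (deriv h z) + 1"
    by (rule order_tendstoD(2)[OF tendsto_norm[OF q[OF h]]]) simp
  moreover have "\<forall>\<^sub>F x in at z. norm (P x / (x - z)) > norm (deriv P z) / 2"
    by (rule order_tendstoD(1)[OF tendsto_norm[OF q[OF P]]]) (use P' in simp)
  moreover have "\<forall>\<^sub>F x in at z. norm (h x) < 1"
    using order_tendstoD(2)[OF tendsto_norm[OF analytic_at_imp_isCont[OF h(1), unfolded isCont_def]], of 1] h(2) by simp
  moreover have "\<forall>\<^sub>F x in at z. x \<noteq> z" by (simp add: eventually_at_filter)
  ultimately have ev: "\<forall>\<^sub>F x in at z. norm (deriv h x) \<le> (k + norm b) * norm (h x)"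
    using eq
  proof eventually_elim
    case (elim x)
    have d: "norm (x - z) > 0" using elim by simp
    have hx: "norm (h x) \<le> (norm (deriv h z) + 1) * norm (x - z)" using elim(1) d by (simp add: norm_divide divide_less_eq)
    have px: "norm (deriv P z) / 2 * norm (x - z) \<le> norm (P x)" using elim(2) d by (simp add: norm_divide less_divide_eq)
    have "norm (h x) \<le> k * (norm (deriv P z) / 2 * norm (x - z))"
    proof -
      have "k * (norm (deriv P z) / 2) = norm (deriv h z) + 1" unfolding k_def using P' by (subst nonzero_eq_divide_eq[symmetric]) auto
      thus ?thesis using hx by (simp only: mult.assoc[symmetric])
    qed
    also have "\<dots> \<le> k * norm (P x)" using px k0 by (intro mult_left_mono) auto
    finally have hP: "norm (h x) \<le> k * norm (P x)" .
    have P0: "norm (P x) > 0"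
      using px d P' by (meson half_gt_zero less_le_trans mult_pos_pos zero_less_norm_iff)
    \<comment> \<open>The identity is solved for \<open>P h'\<close>. Of each \<open>h^2\<close> one
      factor is kept; the other is estimated by \<open>k |P|\<close> or by 1, after which
      \<open>|P|\<close> cancels.\<close>
    have "norm (P x) * norm (deriv h x) = norm ((h x)\<^sup>2 + b * (h x)\<^sup>2 * P x)"
    proof -
      have "- (P x * deriv h x) = (h x)\<^sup>2 + b * (h x)\<^sup>2 * P x" using elim(5) by (simp add: algebra_simps)
      thus ?thesis by (metis norm_minus_cancel norm_mult)
    qed
    also have "\<dots> \<le> norm ((h x)\<^sup>2) + norm (b * (h x)\<^sup>2 * P x)" by (rule norm_triangle_ineq)
    also have "\<dots> = norm (h x) * norm (h x) + norm b * (norm (h x) * norm (h x)) * norm (P x)"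
      by (simp add: norm_mult power2_eq_square)
    also have "\<dots> \<le> (k * norm (P x)) * norm (h x) + norm b * (1 * norm (h x)) * norm (P x)"
      using hP elim(3) by (intro add_mono mult_right_mono mult_left_mono) auto
    also have "\<dots> = norm (P x) * ((k + norm b) * norm (h x))" by (simp add: algebra_simps)
    finally show ?case using P0 by simp
  qed
  have "norm (deriv h z) \<le> (k + norm b) * norm (h z)"
  proof (rule tendsto_le[OF at_neq_bot _ _ ev])
    show "((\<lambda>x. (k + norm b) * norm (h x)) \<longlongrightarrow> (k + norm b) * norm (h z)) (at z)"
      using analytic_at_imp_isCont[OF h(1)] unfolding isCont_def by (intro tendsto_intros)
    show "((\<lambda>x. norm (deriv h x)) \<longlongrightarrow> norm (deriv h z)) (at z)"
      using analytic_at_imp_isCont[OF analytic_deriv[OF h(1)]] unfolding isCont_def by (intro tendsto_intros)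
  qed
  hence "\<forall>\<^sub>F x in nhds z. norm (deriv h x) \<le> (k + norm b) * norm (h x)" using ev by (simp add: eventually_nhds_conv_at)
  then obtain d where d: "d > 0" "\<And>x. dist x z < d \<Longrightarrow> norm (deriv h x) \<le> (k + norm b) * norm (h x)"
    unfolding eventually_nhds_metric by blast
  obtain e where e: "e > 0" "h holomorphic_on ball z e" using h(1) by (meson analytic_at_ball)
  have "\<forall>\<^sub>F x in nhds z. h x = 0"
  proof (rule deriv_le_imp_zero[of h z "min d e"])
    show "h holomorphic_on ball z (min d e)" by (rule holomorphic_on_subset[OF e(2)]) auto
  qed (use d e h(2) in \<open>auto simp: dist_commute\<close>)
  hence "\<forall>\<^sub>F x in at z. h x = 0" by (simp add: eventually_nhds_conv_at)
  with nz have "\<forall>\<^sub>F x in at z. False" by eventually_elim simp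
  thus False by simp
qed

text \<open>Inverting the normalised function keeps \<open>P\<close> in chart form. Where
  \<open>f' = b\<close> the formula for \<open>P z\<close> yields the conventional 0, although this
  is a pole unless \<open>f'\<close> is constantly \<open>b\<close> nearby.\<close>

lemma reciprocal_deriv_minus_const:
  fixes b :: complex
  assumes f: "chart_analytic f"
    and P_def: "P = (\<lambda>z. inverse (remove_sings (\<lambda>z. remove_sings (deriv f) z - b) z))"
  shows "chart_analytic P"
    "\<And>C. C \<ge> 0 \<Longrightarrow> spherical_deriv_le P C UNIV \<Longrightarrow> \<exists>C'\<ge>0. spherical_deriv_le (remove_sings (deriv f)) C' UNIV"
    "f analytic_on {z} \<Longrightarrow> P z = inverse (deriv f z - b)"
    "f analytic_on {z} \<Longrightarrow> deriv f z \<noteq> b \<Longrightarrow> P analytic_on {z}"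
    "f analytic_on {z} \<Longrightarrow> deriv f z \<noteq> b \<Longrightarrow> deriv P z = - deriv (deriv f) z / (deriv f z - b)\<^sup>2"
    "\<not> f analytic_on {z} \<Longrightarrow> P analytic_on {z} \<and> P z = 0 \<and> deriv P z = 0"
proof -
  define N where "N = remove_sings (deriv f)"
  define T where "T = remove_sings (\<lambda>z. N z - b)"
  note N = chart_analytic_derivative[OF f, folded N_def]
  note T = chart_analytic_shift[OF N(1), where a = b, folded T_def]
  have PT: "P = (\<lambda>z. inverse (T z))" by (simp add: P_def T_def N_def)
  show cP: "chart_analytic P" unfolding PT by (rule chart_analytic_inverse[OF T(1)])
  show "\<exists>C'\<ge>0. spherical_deriv_le (remove_sings (deriv f)) C' UNIV" if C: "C \<ge> 0" "spherical_deriv_le P C UNIV" for C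
  proof -
    have "spherical_deriv_le T C UNIV" using spherical_deriv_le_inverse[OF cP C(2,1)] by (simp add: PT)
    from spherical_deriv_le_shift[OF N(1) this[unfolded T_def] C(1)] C(1) show ?thesis
      by (intro exI[of _ "2 * C * (1 + (norm b)\<^sup>2)"]) (auto simp: N_def)
  qed
  have Tv: "T analytic_on {z} \<longleftrightarrow> f analytic_on {z}" "f analytic_on {z} \<Longrightarrow> T z = deriv f z - b"
    "f analytic_on {z} \<Longrightarrow> deriv T z = deriv (deriv f) z" for z
    using T N by simp_all
  show Pv: "P z = inverse (deriv f z - b)" if "f analytic_on {z}" for z using Tv(2)[OF that] by (simp add: PT)
  show "P analytic_on {z}" if "f analytic_on {z}" "deriv f z \<noteq> b"
    unfolding PT using that Tv by (intro inverse_analytic) auto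
  show "deriv P z = - deriv (deriv f) z / (deriv f z - b)\<^sup>2" if "f analytic_on {z}" "deriv f z \<noteq> b"
    unfolding PT using deriv_inverse_analytic[of T z] that Tv by simp
  assume na: "\<not> f analytic_on {z}"
  hence naT: "\<not> T analytic_on {z}" by (simp add: Tv)
  note pT = chart_analytic_pole[OF T(1) naT] and pf = chart_analytic_pole[OF f na]
  have P: "P analytic_on {z}" "P z = 0" using pT by (simp_all add: PT)
  have "\<forall>\<^sub>F x in at z. P x * (- deriv (\<lambda>w. inverse (f w)) x - b * (inverse (f x))\<^sup>2) = (inverse (f x))\<^sup>2"
    using pf(3) pT(3)
  proof eventually_elim
    case (elim x)
    have d: "deriv (\<lambda>w. inverse (f w)) x = - deriv f x / (f x)\<^sup>2" using elim by (intro deriv_inverse_analytic) auto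
    have "deriv f x - b \<noteq> 0" using elim Tv(2)[of x] by auto
    \<comment> \<open>Dividing this by \<open>(f x)^2\<close> and using
      \<open>f' = - h' / h^2\<close> for \<open>h = 1/f\<close> gives the required relation between
      \<open>P\<close> and \<open>h\<close>.\<close>
    hence "P x * (deriv f x - b) = 1" using elim Pv[of x] by simp
    hence "P x * ((deriv f x - b) / (f x)\<^sup>2) = (inverse (f x))\<^sup>2"
      by (simp only: times_divide_eq_right) (simp add: power_inverse divide_inverse)
    moreover have "- deriv (\<lambda>w. inverse (f w)) x - b * (inverse (f x))\<^sup>2 = (deriv f x - b) / (f x)\<^sup>2"
      unfolding d by (simp add: power_inverse divide_inverse algebra_simps)
    ultimately show ?case by simp
  qed
  moreover have "\<forall>\<^sub>F x in at z. inverse (f x) \<noteq> 0" using pf(3) by eventually_elim auto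
  ultimately have "deriv P z = 0"
    using reciprocal_deriv_zero_at_pole[OF pf(1) _ P, of b] pf(2) by simp
  thus "P analytic_on {z} \<and> P z = 0 \<and> deriv P z = 0" using P by blast
qed

text \<open>Because \<open>e \<noteq> 0\<close>, a nonconstant limit of the form
  \<open>e + exp (\<alpha> * z + \<beta>)\<close> attains 0, and does so with multiplicity one,
  whereas the zeros of the approximants are multiple.\<close>

lemma no_rescaled_limit_omitting:
  fixes g :: "nat \<Rightarrow> complex \<Rightarrow> complex"
  assumes ca: "\<And>n. chart_analytic (g n)" and C: "C \<ge> 0"
    and bd: "\<And>R. \<forall>\<^sub>F n in sequentially. spherical_deriv_le (g n) C (ball 0 R)"
    and e: "e \<noteq> 0"
    and om: "\<And>R. \<forall>\<^sub>F n in sequentially. \<forall>z\<in>ball 0 R. g n analytic_on {z} \<and> g n z \<noteq> e \<and> (g n z = 0 \<longrightarrow> deriv (g n) z = 0)"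
    and nd: "\<And>n. g n analytic_on {0} \<and> norm (deriv (g n) 0) \<ge> c * (1 + (norm (g n 0))\<^sup>2)" and c: "c > 0"
  shows False
proof -
  obtain r p where r: "strict_mono (r :: nat \<Rightarrow> nat)" and sl: "spherical_limit (\<lambda>n. g (r n)) p"
    and bd': "\<And>R. \<forall>\<^sub>F n in sequentially. spherical_deriv_le (g (r n)) C (ball 0 R)"
    by (rule spherical_limit_exists[OF ca C bd]) blast
  interpret spherical_limit "\<lambda>n. g (r n)" p by (rule sl)
  have om': "\<forall>\<^sub>F n in sequentially. \<forall>w\<in>ball z \<delta>. g (r n) analytic_on {w} \<and> g (r n) w \<noteq> e
       \<and> (g (r n) w = 0 \<longrightarrow> deriv (g (r n)) w = 0)" for z \<delta>
    using eventually_subseq[OF r om[of "norm z + \<delta>"]]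
  proof eventually_elim
    case (elim n)
    have "ball z \<delta> \<subseteq> ball 0 (norm z + \<delta>)"
    proof
      fix w assume "w \<in> ball z \<delta>"
      thus "w \<in> ball 0 (norm z + \<delta>)" using dist_triangle[of 0 w z] by simp
    qed
    thus ?case using elim by blast
  qed
  note iso = nondegenerate_not_Infty[OF c, OF nd]
  have fin: "p z \<noteq> Infty" for z
  proof
    assume pz: "p z = Infty"
    obtain \<delta> v where v: "\<delta> > 0" "v holomorphic_on ball z \<delta>"
      "\<forall>\<^sub>F n in sequentially. (\<lambda>w. inverse (g (r n) w)) analytic_on ball z \<delta> \<and>
        (\<forall>w\<in>ball z \<delta>. g (r n) analytic_on {w} \<longrightarrow> g (r n) w \<noteq> 0)"
      "uniform_limit (ball z \<delta>) (\<lambda>n w. inverse (g (r n) w)) v sequentially"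
      "\<And>w. w \<in> ball z \<delta> \<Longrightarrow> p w = sphere_inv (Fin (v w))"
      by (rule infinite_chart[OF pz]) blast
    have vz: "v z = 0" using v(5)[of z] v(1) pz by (auto split: if_splits)
    \<comment> \<open>The approximants are analytic, so their inverses have no zeros, and Hurwitz
      would make an infinite value of the limit spread to a disc.\<close>
    have ev: "\<forall>\<^sub>F n in sequentially. (\<lambda>w. inverse (g (r n) w)) holomorphic_on ball z \<delta> \<and> (\<forall>w\<in>ball z \<delta>. inverse (g (r n) w) \<noteq> 0)"
      using v(3) om'[of z \<delta>] by eventually_elim (auto intro: analytic_imp_holomorphic)
    have "v w = 0" if "w \<in> ball z \<delta>" for w
      by (rule Hurwitz_ball[OF ev v(2,4) _ vz that]) (use v(1) in auto)
    hence "p w = Infty" if "w \<in> ball z \<delta>" for w using v(5)[OF that] that by simp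
    hence "\<forall>\<^sub>F w in at z. p w = Infty"
      using v(1) by (intro eventually_mono[OF eventually_at_in_open'[of "ball z \<delta>" z]]) auto
    with iso[of z] have "\<forall>\<^sub>F w in at z. False" by eventually_elim auto
    thus False by simp
  qed
  obtain G where G: "G holomorphic_on UNIV" "\<And>z. p z = Fin (G z)"
    and loc: "\<And>z. \<exists>\<delta>>0. (\<forall>\<^sub>F n in sequentially. g (r n) analytic_on ball z \<delta>) \<and> uniform_limit (ball z \<delta>) (\<lambda>n. g (r n)) G sequentially"
    by (rule entire_limit[OF fin]) blast
  have upper: "norm (deriv G z) \<le> C * (1 + (norm (G z))\<^sup>2)" for z by (rule limit_deriv_upper[OF G(1) loc bd'])
  have lower: "norm (deriv G 0) \<ge> c * (1 + (norm (G 0))\<^sup>2)" by (rule limit_deriv_lower[OF G(1) loc]) (use nd in blast)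
  have "c * (1 + (norm (G 0))\<^sup>2) > 0" using c by (simp add: add_pos_nonneg)
  hence G0: "deriv G 0 \<noteq> 0" using lower by auto
  have hGe: "(\<lambda>w. G w - e) holomorphic_on A" for A
    by (rule holomorphic_on_subset[OF holomorphic_on_diff[OF G(1) holomorphic_on_const]]) simp
  have "G z \<noteq> e" for z
  proof
    assume z: "G z = e"
    obtain \<delta> where \<delta>: "\<delta> > 0" "\<forall>\<^sub>F n in sequentially. g (r n) analytic_on ball z \<delta>"
      "uniform_limit (ball z \<delta>) (\<lambda>n. g (r n)) G sequentially" using loc by blast
    have ev: "\<forall>\<^sub>F n in sequentially. (\<lambda>w. g (r n) w - e) holomorphic_on ball z \<delta> \<and> (\<forall>w\<in>ball z \<delta>. g (r n) w - e \<noteq> 0)"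
      using \<delta>(2) om'[of z \<delta>] by eventually_elim (auto intro!: analytic_imp_holomorphic analytic_on_diff)
    have ul': "uniform_limit (ball z \<delta>) (\<lambda>n w. g (r n) w - e) (\<lambda>w. G w - e) sequentially"
      by (intro uniform_limit_minus \<delta>(3) uniform_limit_const)
    have near: "G w - e = 0" if "w \<in> ball z \<delta>" for w
      by (rule Hurwitz_ball[OF ev hGe ul' _ _ that, of z]) (use \<delta>(1) z in auto)
    have "G w - e = 0" for w
      by (rule analytic_continuation_open[of "ball z \<delta>" UNIV "\<lambda>y. G y - e" "\<lambda>_. 0"])
        (use \<delta>(1) in \<open>simp_all add: hGe near connected_UNIV\<close>)
    hence "G = (\<lambda>_. e)" by (simp add: fun_eq_iff)
    thus False using G0 by simp
  qed
  then obtain \<alpha> \<beta> where ex: "\<And>z. G z = e + exp (\<alpha> * z + \<beta>)"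
    using entire_spherical_omits[OF G(1) upper, of e] by blast
  have dG: "deriv G z = \<alpha> * exp (\<alpha> * z + \<beta>)" for z
  proof (rule DERIV_imp_deriv)
    have "((\<lambda>z. e + exp (\<alpha> * z + \<beta>)) has_field_derivative \<alpha> * exp (\<alpha> * z + \<beta>)) (at z)"
      by (auto intro!: derivative_eq_intros)
    thus "(G has_field_derivative \<alpha> * exp (\<alpha> * z + \<beta>)) (at z)" using ex by presburger
  qed
  have \<alpha>: "\<alpha> \<noteq> 0" using G0 dG by auto
  \<comment> \<open>A zero of \<open>G\<close>, with \<open>G' = - \<alpha> * e \<noteq> 0\<close>.
    Nearby the derivatives of \<open>g (r n)\<close> are not 0, so these functions have no zeros
    there.\<close>
  define z where "z = (Ln (- e) - \<beta>) / \<alpha>"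
  have ez: "exp (\<alpha> * z + \<beta>) = - e" using \<alpha> e by (simp add: z_def)
  have Gz: "G z = 0" "deriv G z \<noteq> 0" using ex[of z] dG[of z] ez \<alpha> e by auto
  have "isCont (deriv G) z"
    using holomorphic_on_imp_continuous_on[OF holomorphic_deriv[OF G(1) open_UNIV]] by (simp add: continuous_on_eq_continuous_at)
  hence "\<forall>\<^sub>F w in nhds z. norm (deriv G w) > norm (deriv G z) / 2"
    using order_tendstoD(1)[OF tendsto_norm, of "deriv G" "deriv G z" "at z" "norm (deriv G z) / 2"] Gz
    by (simp add: eventually_nhds_conv_at isCont_def)
  then obtain \<delta> where \<delta>: "\<delta> > 0" "\<And>w. w \<in> ball z \<delta> \<Longrightarrow> norm (deriv G w) > norm (deriv G z) / 2"
    "\<forall>\<^sub>F n in sequentially. g (r n) holomorphic_on ball z \<delta> \<and> (\<forall>w\<in>ball z \<delta>. g (r n) analytic_on {w})"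
    "uniform_limit (ball z \<delta>) (\<lambda>n. g (r n)) G sequentially" "uniform_limit (ball z \<delta>) (\<lambda>n. deriv (g (r n))) (deriv G) sequentially"
    using limit_shrink[OF G(1) loc] by blast
  have "norm (deriv G z) / 2 > 0" using Gz by simp
  from uniform_limitD[OF \<delta>(5) this] \<delta>(3) om'[of z \<delta>]
  have ev: "\<forall>\<^sub>F n in sequentially. g (r n) holomorphic_on ball z \<delta> \<and> (\<forall>w\<in>ball z \<delta>. g (r n) w \<noteq> 0)"
  proof eventually_elim
    case (elim n)
    have "g (r n) w \<noteq> 0" if w: "w \<in> ball z \<delta>" for w
    proof
      assume "g (r n) w = 0"
      hence "deriv (g (r n)) w = 0" using elim(3) w by blast
      thus False using elim(1)[rule_format, OF w] \<delta>(2)[OF w] by (simp add: dist_norm)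
    qed
    thus ?case using elim by blast
  qed
  have "G w = 0" if "w \<in> ball z \<delta>" for w
    by (rule Hurwitz_ball[OF ev holomorphic_on_subset[OF G(1)] \<delta>(4) _ Gz(1) that]) (use \<delta>(1) in auto)
  hence "\<forall>\<^sub>F w in nhds z. G w = 0"
    using \<delta>(1) by (intro eventually_mono[OF eventually_nhds_in_open[of "ball z \<delta>" z]]) auto
  hence "deriv G z = deriv (\<lambda>_. 0) z" by (intro deriv_cong_ev) auto
  thus False using Gz by simp
qed

lemma shared_values_deriv_spherical_deriv_bounded:
  assumes f: "chart_analytic f" and C: "spherical_deriv_le f C UNIV" "C \<ge> 0" and ab: "a \<noteq> b"
    and sa: "\<And>z. f analytic_on {z} \<Longrightarrow> f z = a \<longleftrightarrow> deriv f z = a"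
    and sb: "\<And>z. f analytic_on {z} \<Longrightarrow> f z = b \<longleftrightarrow> deriv f z = b"
  shows "\<exists>C'\<ge>0. spherical_deriv_le (remove_sings (deriv f)) C' UNIV"
proof -
  define P where "P = (\<lambda>z. inverse (remove_sings (\<lambda>z. remove_sings (deriv f) z - b) z))"
  note P = reciprocal_deriv_minus_const[OF f P_def]
  \<comment> \<open>The spherical derivative of \<open>P\<close>, set to 0 at the poles; thus
    \<open>M > 0\<close> already implies that \<open>P\<close> is analytic at the point.\<close>
  define M where "M = (\<lambda>z. if P analytic_on {z} then norm (deriv P z) / (1 + (norm (P z))\<^sup>2) else 0)"
  have pos: "1 + (norm x)\<^sup>2 > 0" for x :: complex by (simp add: add_pos_nonneg)
  have M0: "M z \<ge> 0" for z by (auto simp: M_def intro!: divide_nonneg_nonneg)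
  have key: "norm (deriv P z) \<le> x * (1 + (norm (P z))\<^sup>2)" if "P analytic_on {z}" "M z \<le> x" for z x
    using that pos[of "P z"] by (simp add: M_def divide_le_eq)
  show ?thesis
  proof (cases "\<exists>B. \<forall>z. M z \<le> B")
    case True
    then obtain B where B: "\<And>z. M z \<le> B" by blast
    have "B \<ge> 0" using order_trans[OF M0 B] .
    moreover have "spherical_deriv_le P B UNIV" using key B by (auto simp: spherical_deriv_le_def)
    ultimately show ?thesis by (rule P(2))
  next
    case False
    hence unb: "\<exists>z. M z > B" for B by (meson not_le)
    have locb: "\<exists>B. \<forall>\<^sub>F w in nhds z. M w \<le> B" for z
    proof (cases "P analytic_on {z}")
      case True
      have "isCont (deriv P) z" by (rule analytic_at_imp_isCont[OF analytic_deriv[OF True]])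
      hence "\<forall>\<^sub>F w in nhds z. norm (deriv P w) < norm (deriv P z) + 1"
        unfolding eventually_nhds_conv_at isCont_def by (auto intro: order_tendstoD(2)[OF tendsto_norm])
      hence "\<forall>\<^sub>F w in nhds z. M w \<le> norm (deriv P z) + 1"
      proof eventually_elim
        case (elim w)
        have "norm (deriv P w) / (1 + (norm (P w))\<^sup>2) \<le> norm (deriv P w) / 1"
          by (intro divide_left_mono) (auto simp: pos)
        thus ?case using elim norm_ge_zero[of "deriv P z"] unfolding M_def by (auto simp del: norm_ge_zero)
      qed
      thus ?thesis by blast
    next
      case False
      note pole = chart_analytic_pole[OF P(1) False]
      have "isCont (deriv (\<lambda>w. inverse (P w))) z" by (rule analytic_at_imp_isCont[OF analytic_deriv[OF pole(1)]])
      hence "\<forall>\<^sub>F w in at z. norm (deriv (\<lambda>w. inverse (P w)) w) < norm (deriv (\<lambda>w. inverse (P w)) z) + 1"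
        unfolding isCont_def by (auto intro: order_tendstoD(2)[OF tendsto_norm])
      hence "\<forall>\<^sub>F w in at z. M w \<le> norm (deriv (\<lambda>w. inverse (P w)) z) + 1"
        using pole(3)
      proof eventually_elim
        case (elim w)
        have "norm (deriv P w) / (1 + (norm (P w))\<^sup>2) \<le> norm (deriv P w) / (norm (P w))\<^sup>2"
          using elim by (intro divide_left_mono mult_pos_pos) (auto simp: pos)
        also have "\<dots> = norm (deriv (\<lambda>w. inverse (P w)) w)"
          using elim deriv_inverse_analytic[of P w] by (simp add: norm_divide norm_power)
        finally show ?case using elim by (simp add: M_def)
      qed
      moreover have "M z = 0" using False by (simp add: M_def)
      ultimately have "\<forall>\<^sub>F w in nhds z. M w \<le> norm (deriv (\<lambda>w. inverse (P w)) z) + 1"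
        by (simp add: eventually_nhds_conv_at)
      thus ?thesis by blast
    qed
    obtain \<xi> where \<xi>: "\<And>n::nat. M (\<xi> n) > real n + 1"
      "\<And>n w. norm (w - \<xi> n) < (real n + 1) / M (\<xi> n) \<Longrightarrow> M w \<le> 2 * M (\<xi> n)"
      using doubling_sequence[OF locb unb] by blast
    define m where "m = (\<lambda>n. M (\<xi> n))"
    have m: "m n > real n + 1" "m n > 0" for n using \<xi>(1)[of n] by (auto simp: m_def intro: le_less_trans[of 0 "real n + 1"])
    have Pan0: "P analytic_on {\<xi> n}" for n using m(2)[of n] by (auto simp: m_def M_def split: if_splits)
    have Pd0: "deriv P (\<xi> n) \<noteq> 0" for n using m(2)[of n] by (auto simp: m_def M_def split: if_splits)
    \<comment> \<open>Strict positivity is needed, since the radius \<open>\<delta>\<close> is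
      obtained by dividing by this constant.\<close>
    have "spherical_deriv_le f (C + 1) UNIV" "C + 1 > 0"
    proof -
      have "C * (1 + (norm (f z))\<^sup>2) \<le> (C + 1) * (1 + (norm (f z))\<^sup>2)" for z by (intro mult_right_mono) auto
      thus "spherical_deriv_le f (C + 1) UNIV" using C(1) order_trans by (fastforce simp: spherical_deriv_le_def)
    qed (use C in auto)
    from second_deriv_bound_near_finite_value[OF f this, of "max (norm a) (norm b)"]
    obtain \<delta> D where \<delta>: "\<delta> > 0" and D: "\<And>z w. dist w z < \<delta> \<Longrightarrow> f analytic_on {w} \<Longrightarrow> norm (f w) \<le> max (norm a) (norm b)
       \<Longrightarrow> f analytic_on {z} \<and> norm (deriv (deriv f) z) \<le> D" by blast
    \<comment> \<open>A moderate value of \<open>f\<close> near \<open>\<xi> n\<close> gives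
      \<open>|f''| \<le> D\<close> at \<open>\<xi> n\<close>. \<open>P\<close> and
      \<open>f' - b\<close> have the same spherical derivative, at most \<open>|f''|\<close>,
      whereas \<open>m n > n + 1 > D\<close>.\<close>
    have avoid: "f w \<noteq> a \<and> f w \<noteq> b" if n: "real n \<ge> D" and w: "w \<in> ball (\<xi> n) \<delta>" "f analytic_on {w}" for n w
    proof (rule ccontr)
      assume "\<not> ?thesis"
      hence "norm (f w) \<le> max (norm a) (norm b)" by auto
      from D[OF _ w(2) this, of "\<xi> n"] w(1)
      have an: "f analytic_on {\<xi> n}" and le: "norm (deriv (deriv f) (\<xi> n)) \<le> D" by (auto simp: dist_commute)
      \<comment> \<open>If \<open>f' = b\<close> at \<open>\<xi> n\<close>, then \<open>P\<close> is
        0 there by convention, yet analytic. So \<open>P * (f' - b)\<close> tends to 0 and not to 1,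
        \<open>P\<close> vanishes nearby, and \<open>M (\<xi> n)\<close> would be 0.\<close>
      have ne: "deriv f (\<xi> n) \<noteq> b"
      proof
        assume "deriv f (\<xi> n) = b"
        hence P0: "P (\<xi> n) = 0" using P(3)[OF an] by simp
        have "isCont P (\<xi> n)" by (rule analytic_at_imp_isCont[OF Pan0])
        hence l0: "(P \<longlongrightarrow> 0) (at (\<xi> n))" using P0 by (simp add: isCont_def)
        have "isCont (deriv f) (\<xi> n)" by (rule analytic_at_imp_isCont[OF analytic_deriv[OF an]])
        hence "((\<lambda>x. P x * (deriv f x - b)) \<longlongrightarrow> 0 * (deriv f (\<xi> n) - b)) (at (\<xi> n))"
          using l0 by (intro tendsto_intros) (simp_all add: isCont_def)
        hence l1: "((\<lambda>x. P x * (deriv f x - b)) \<longlongrightarrow> 0) (at (\<xi> n))" by simp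
        have "\<not> (\<forall>\<^sub>F x in at (\<xi> n). P x \<noteq> 0)"
        proof
          assume "\<forall>\<^sub>F x in at (\<xi> n). P x \<noteq> 0"
          hence "\<forall>\<^sub>F x in at (\<xi> n). P x * (deriv f x - b) = 1"
            using eventually_at_analytic[OF an] by eventually_elim (auto simp: P(3))
          hence "((\<lambda>x. P x * (deriv f x - b)) \<longlongrightarrow> 1) (at (\<xi> n))" by (rule tendsto_eventually)
          from tendsto_unique[OF at_neq_bot l1 this] show False by simp
        qed
        hence "\<forall>\<^sub>F x in nhds (\<xi> n). P x = 0" using zero_free_or_zero[OF Pan0] by blast
        hence "deriv P (\<xi> n) = deriv (\<lambda>_. 0) (\<xi> n)" by (intro deriv_cong_ev) auto
        thus False using Pd0 by simp
      qed
      let ?t = "norm (deriv f (\<xi> n) - b)"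
      have t: "?t > 0" using ne by simp
      have "m n = norm (deriv (deriv f) (\<xi> n)) / ?t\<^sup>2 / (1 + (inverse ?t)\<^sup>2)"
        using Pan0[of n] P(3)[OF an] P(5)[OF an ne] by (simp add: m_def M_def norm_divide norm_power norm_inverse)
      also have "\<dots> = norm (deriv (deriv f) (\<xi> n)) / (?t\<^sup>2 + 1)"
      proof -
        have "x / s\<^sup>2 / (1 + (inverse s)\<^sup>2) = x / (s\<^sup>2 + 1)" if "s > 0" for x s :: real
        proof -
          have "s\<^sup>2 * (1 + (inverse s)\<^sup>2) = s\<^sup>2 + 1" using that by (simp add: distrib_left power_inverse)
          thus ?thesis by (simp add: divide_divide_eq_left)
        qed
        thus ?thesis using t by blast
      qed
      also have "\<dots> \<le> norm (deriv (deriv f) (\<xi> n)) / 1"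
        by (intro divide_left_mono) (auto simp: add_nonneg_pos)
      also have "\<dots> \<le> D" using le by simp
      finally show False using m(1)[of n] n by simp
    qed
    \<comment> \<open>The value of \<open>P\<close> where \<open>f' = a\<close>.\<close>
    define e where "e = inverse (a - b)"
    have e: "e \<noteq> 0" using ab by (simp add: e_def)
    have om: "P analytic_on {w} \<and> P w \<noteq> e \<and> (P w = 0 \<longrightarrow> deriv P w = 0)" if n: "real n \<ge> D" and w: "w \<in> ball (\<xi> n) \<delta>" for n w
    proof (cases "f analytic_on {w}")
      case True
      have "deriv f w \<noteq> a" "deriv f w \<noteq> b" using avoid[OF n w True] sa[OF True] sb[OF True] by auto
      thus ?thesis using P(3)[OF True] P(4)[OF True] by (auto simp: e_def)
    next
      case False
      thus ?thesis using P(6)[OF False] e by auto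
    qed
    \<comment> \<open>The spherical derivative of \<open>P\<close> already scales by
      \<open>1 / m n\<close>, so values are not rescaled; the factor 1 matches the shape of
      \<open>chart_analytic_rescaled\<close>.\<close>
    define g where "g = (\<lambda>n \<zeta>. 1 * P (\<xi> n + of_real (inverse (m n)) * \<zeta>))"
    have nz: "1 \<noteq> (0::complex)" "of_real (inverse (m n)) \<noteq> (0::complex)" for n using m(2)[of n] by auto
    define W where "W = (\<lambda>n \<zeta>. \<xi> n + of_real (inverse (m n)) * \<zeta>)"
    have gan: "g n analytic_on {\<zeta>} \<longleftrightarrow> P analytic_on {W n \<zeta>}" for n \<zeta>
      unfolding g_def W_def by (rule analytic_rescaled_iff[OF nz])
    have gval: "g n \<zeta> = P (W n \<zeta>)" for n \<zeta> by (simp add: g_def W_def)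
    have gder: "deriv (g n) \<zeta> = deriv P (W n \<zeta>) / of_real (m n)" if "P analytic_on {W n \<zeta>}" for n \<zeta>
      using deriv_rescaled[of P "\<xi> n" "of_real (inverse (m n))" \<zeta> 1] that m(2)[of n]
      by (simp add: g_def W_def divide_inverse mult.commute)
    have False
    proof (rule no_rescaled_limit_omitting[of g 2 e 1])
      show "chart_analytic (g n)" for n unfolding g_def by (rule chart_analytic_rescaled[OF P(1) nz])
      show "e \<noteq> 0" by (rule e)
      fix n
      have W0: "W n 0 = \<xi> n" by (simp add: W_def)
      have "norm (deriv P (\<xi> n)) = m n * (1 + (norm (P (\<xi> n)))\<^sup>2)"
        using Pan0[of n] pos[of "P (\<xi> n)"] by (simp add: m_def M_def)
      thus "g n analytic_on {0} \<and> norm (deriv (g n) 0) \<ge> 1 * (1 + (norm (g n 0))\<^sup>2)"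
        using Pan0[of n] m(2)[of n] by (simp add: gan W0 gder gval norm_divide)
    next
      fix R :: real
      show "\<forall>\<^sub>F n in sequentially. spherical_deriv_le (g n) 2 (ball 0 R)"
        using eventually_ge_at_top[of "nat \<lceil>R\<rceil>"]
      proof eventually_elim
        case (elim n)
        show ?case unfolding spherical_deriv_le_def
        proof (intro ballI impI)
          fix \<zeta> assume \<zeta>: "\<zeta> \<in> ball 0 R" "g n analytic_on {\<zeta>}"
          have an: "P analytic_on {W n \<zeta>}" using \<zeta> by (simp add: gan)
          have "norm \<zeta> < real n + 1" using \<zeta>(1) elim by (simp add: nat_le_iff ceiling_le_iff)
          hence "norm (W n \<zeta> - \<xi> n) < (real n + 1) / m n"
            using m(2)[of n] by (simp add: W_def norm_mult norm_inverse norm_divide divide_inverse mult.commute)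
          hence "M (W n \<zeta>) \<le> 2 * m n" using \<xi>(2) by (simp add: m_def)
          from key[OF an this] show "norm (deriv (g n) \<zeta>) \<le> 2 * (1 + (norm (g n \<zeta>))\<^sup>2)"
            using m(2)[of n] by (simp add: gder[OF an] gval norm_divide divide_le_eq mult_ac)
        qed
      qed
      show "\<forall>\<^sub>F n in sequentially. \<forall>z\<in>ball 0 R. g n analytic_on {z} \<and> g n z \<noteq> e \<and> (g n z = 0 \<longrightarrow> deriv (g n) z = 0)"
        using eventually_ge_at_top[of "nat \<lceil>R / \<delta>\<rceil>"] eventually_ge_at_top[of "nat \<lceil>D\<rceil>"]
      proof eventually_elim
        case (elim n)
        \<comment> \<open>\<open>W n\<close> shrinks the disc of radius \<open>R\<close> to radius
          \<open>R / m n < \<delta>\<close>, inside the disc where \<open>om\<close> holds.\<close>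
        have "real n \<ge> R / \<delta>" using elim(1) by (simp add: nat_le_iff ceiling_le_iff)
        hence "R / \<delta> < m n" using m(1)[of n] by linarith
        hence Rm: "R < \<delta> * m n" using \<delta> by (simp add: divide_less_eq mult.commute)
        have nD: "real n \<ge> D" using elim(2) by (simp add: nat_le_iff ceiling_le_iff)
        show ?case
        proof
          fix z assume "z \<in> ball (0::complex) R"
          hence "norm z < \<delta> * m n" using Rm by simp
          hence "W n z \<in> ball (\<xi> n) \<delta>" using m(2)[of n]
            by (simp add: W_def dist_norm norm_mult norm_inverse norm_divide divide_inverse[symmetric] divide_less_eq inverse_eq_divide)
          from om[OF nD this] show "g n analytic_on {z} \<and> g n z \<noteq> e \<and> (g n z = 0 \<longrightarrow> deriv (g n) z = 0)"
            by (auto simp: gan gval gder)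
        qed
      qed
    qed auto
    thus ?thesis ..
  qed
qed

theorem corollary3p2:
  fixes f :: "complex \<Rightarrow> complex" and a b :: complex
  assumes "f nicely_meromorphic_on UNIV"
    and "a \<noteq> b"
    and "\<And>z. to_sphere f z = Fin a \<longleftrightarrow> to_sphere (deriv f) z = Fin a"
    and "\<And>z. to_sphere f z = Fin b \<longleftrightarrow> to_sphere (deriv f) z = Fin b"
  shows "normal_function (to_sphere f) \<and> normal_function (to_sphere (deriv f))"
proof -
  have f: "chart_analytic f" using assms(1) by (simp add: nicely_meromorphic_iff_chart_analytic)
  note N = chart_analytic_derivative[OF f]
  have sh: "f z = x \<longleftrightarrow> deriv f z = x"
    if "\<And>z. to_sphere f z = Fin x \<longleftrightarrow> to_sphere (deriv f) z = Fin x" "f analytic_on {z}" for x z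
    using that(1)[of z] that(2) N(2,3)[of z] unfolding N(5)[symmetric]
    by (simp add: to_sphere_chart_analytic[OF f] to_sphere_chart_analytic[OF N(1)])
  note sa = sh[OF assms(3)] and sb = sh[OF assms(4)]
  obtain C where C: "C \<ge> 0" "spherical_deriv_le f C UNIV"
  \<comment> \<open>The bound for \<open>f\<close> needs a nonzero second value; if
    \<open>b = 0\<close> the two values exchange roles.\<close>
  proof (cases "b = 0")
    case False
    thus thesis using shared_values_spherical_deriv_bounded[OF f assms(2) False sa sb] that by blast
  next
    case True
    hence "b \<noteq> a" "a \<noteq> 0" using assms(2) by auto
    thus thesis using shared_values_spherical_deriv_bounded[OF f _ _ sb sa] that by blast
  qed
  obtain C' where C': "C' \<ge> 0" "spherical_deriv_le (remove_sings (deriv f)) C' UNIV"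
    using shared_values_deriv_spherical_deriv_bounded[OF f C(2,1) assms(2) sa sb] by blast
  show ?thesis
    using normal_function_if_spherical_deriv_bounded[OF f C(2,1)]
      normal_function_if_spherical_deriv_bounded[OF N(1) C'(2,1)] by (simp add: N(5))
qed

end
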